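(* Let $\mathcal H\subset\mathbb R^2$ be a nonempty bounded open set with $B_2(0)\subset\mathcal H\subset B_{\mathcal R}(0)$ for some $\mathcal R\in(2,\infty)$. Let $J\in C^2_c(\mathbb R^2)$ be radially symmetric with $J(x)>0$ if $|x|<d$, $J(x)=0$ if $|x|\ge d$ (for some $d>0$), and $\int_{\mathbb R^2}J=1$. Let $u_0\ge0$ with $u_0=0$ in $\mathcal H$, $u_0\in L^\infty(\mathbb R^2)$, $u_0\in L^1(\mathbb R^2,\log|x|\,dx)$ and $u_0\in L^1(\mathbb R^2,|x|^2\,dx)$. Let $u$ be the solution of the nonlocal exterior problem with hole $\mathcal H$ and initial datum $u_0$, and let $M_\phi^*=\int_{\mathbb R^2}u_0\phi$, where $\phi$ is the stationary solution with logarithmic behavior at infinity. Then, for all $\delta>0$, $$\lim_{t\to\infty}t\log t\,\sup\left\{\left|u(x,t)-2M_\phi^*\frac{\Gamma_{\mathfrak q}(x,t)}{\log t}\right|:\ |x|\ge\delta\sqrt t\right\}=0.$$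
   Context: $L$ is the operator $Lg:=J*g-g$. The solution $u\in C([0,\infty);L^1(\mathbb R^2))$ is the unique solution of: $\partial_tu=Lu$ in $(\mathbb R^2\setminus\mathcal H)\times(0,\infty)$, $u=0$ in $\mathcal H\times(0,\infty)$, $u(\cdot,0)=u_0$ in $\mathbb R^2$. Pointwise statements and suprema in $x$ involving $u(\cdot,t)$ are understood up to null sets. $\phi$ is the unique (locally bounded measurable) function with $L\phi=0$ in $\mathbb R^2\setminus\mathcal H$, $\phi=0$ in $\mathcal H$, and $\phi(x)-\log|x|\in L^\infty(\mathbb R^2\setminus\mathcal H)$. $\mathfrak q:=\frac14\int_{\mathbb R^2}|z|^2J(z)\,dz$ and $\Gamma_{\mathfrak q}(x,t)=\frac{1}{4\pi\mathfrak q t}e^{-|x|^2/(4\mathfrak q t)}$. *)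

theory Defs
  imports "HOL-Probability.Essential_Supremum"
begin

type_synonym plane = "real^2"

text \<open>Second derivatives are derivatives of the map \<open>x \<mapsto> Df(x)\<close> into the normed space of
  bounded linear functionals.\<close>

definition C2 :: "(plane \<Rightarrow> real) \<Rightarrow> bool" where
  "C2 f \<longleftrightarrow>
    (\<exists>(D1 :: plane \<Rightarrow> plane \<Rightarrow>\<^sub>L real) (D2 :: plane \<Rightarrow> plane \<Rightarrow>\<^sub>L (plane \<Rightarrow>\<^sub>L real)).
       (\<forall>x. (f has_derivative blinfun_apply (D1 x)) (at x)) \<and>
       (\<forall>x. (D1 has_derivative blinfun_apply (D2 x)) (at x)) \<and>
       continuous_on UNIV D2)"

definition radially_symmetric :: "(plane \<Rightarrow> real) \<Rightarrow> bool" where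
  "radially_symmetric f \<longleftrightarrow> (\<forall>x y. norm x = norm y \<longrightarrow> f x = f y)"

definition Linfty_on :: "plane set \<Rightarrow> (plane \<Rightarrow> real) \<Rightarrow> bool" where
  "Linfty_on A f \<longleftrightarrow>
    f \<in> borel_measurable (restrict_space lebesgue A) \<and>
    (\<exists>C. AE x in lebesgue. x \<in> A \<longrightarrow> \<bar>f x\<bar> \<le> C)"

definition locally_bounded :: "(plane \<Rightarrow> real) \<Rightarrow> bool" where
  "locally_bounded f \<longleftrightarrow> (\<forall>K. compact K \<longrightarrow> bounded (f ` K))"

definition L1_seminorm_on :: "plane set \<Rightarrow> (plane \<Rightarrow> real) \<Rightarrow> ennreal" where
  "L1_seminorm_on A f = (\<integral>\<^sup>+ x \<in> A. ennreal \<bar>f x\<bar> \<partial>lebesgue)"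

definition convolution2 :: "(plane \<Rightarrow> real) \<Rightarrow> (plane \<Rightarrow> real) \<Rightarrow> plane \<Rightarrow> real" where
  "convolution2 J g x = (LINT y|lebesgue. J (x - y) * g y)"

definition nonlocal_op :: "(plane \<Rightarrow> real) \<Rightarrow> (plane \<Rightarrow> real) \<Rightarrow> plane \<Rightarrow> real" where
  "nonlocal_op J g x = convolution2 J g x - g x"

definition continuous_into_L1 :: "(real \<Rightarrow> plane \<Rightarrow> real) \<Rightarrow> bool" where
  "continuous_into_L1 u \<longleftrightarrow>
    (\<forall>t\<ge>0. integrable lebesgue (u t)) \<and>
    (\<forall>t\<ge>0. ((\<lambda>s. L1_seminorm_on UNIV (\<lambda>x. u s x - u t x)) \<longlongrightarrow> 0) (at t within {0..}))"

text \<open>Since \<open>u t\<close> is only an \<open>L\<^sup>1\<close> class, determined up to a null set that may depend on \<open>t\<close>,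
  \<open>\<partial>\<^sub>t u\<close> is the derivative of the \<open>L\<^sup>1\<close>-valued map \<open>t \<mapsto> u t\<close>, restricted to the complement of
  the hole.\<close>

definition exterior_solution ::
  "(plane \<Rightarrow> real) \<Rightarrow> plane set \<Rightarrow> (plane \<Rightarrow> real) \<Rightarrow> (real \<Rightarrow> plane \<Rightarrow> real) \<Rightarrow> bool" where
  "exterior_solution J H u0 u \<longleftrightarrow>
    continuous_into_L1 u \<and>
    (\<forall>t>0. ((\<lambda>h. L1_seminorm_on (- H)
                 (\<lambda>x. (u (t + h) x - u t x) / h - nonlocal_op J (u t) x)) \<longlongrightarrow> 0) (at 0)) \<and>
    (\<forall>t>0. AE x in lebesgue. x \<in> H \<longrightarrow> u t x = 0) \<and>
    (AE x in lebesgue. u 0 x = u0 x)"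

definition log_stationary_solution ::
  "(plane \<Rightarrow> real) \<Rightarrow> plane set \<Rightarrow> (plane \<Rightarrow> real) \<Rightarrow> bool" where
  "log_stationary_solution J H \<phi> \<longleftrightarrow>
    \<phi> \<in> borel_measurable lebesgue \<and> locally_bounded \<phi> \<and>
    (\<forall>x. x \<notin> H \<longrightarrow> nonlocal_op J \<phi> x = 0) \<and>
    (\<forall>x\<in>H. \<phi> x = 0) \<and>
    Linfty_on (- H) (\<lambda>x. \<phi> x - ln (norm x))"

definition diffusivity :: "(plane \<Rightarrow> real) \<Rightarrow> real" where
  "diffusivity J = 1 / 4 * (LINT z|lebesgue. (norm z)\<^sup>2 * J z)"

definition heat_kernel2 :: "real \<Rightarrow> plane \<Rightarrow> real \<Rightarrow> real" where
  "heat_kernel2 q x t = 1 / (4 * pi * q * t) * exp (- (norm x)\<^sup>2 / (4 * q * t))"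

text \<open>The extended-real codomain makes \<open>esssup\<close> take the value \<open>\<infinity>\<close> on essentially unbounded
  functions.\<close>

definition esssup_on :: "plane set \<Rightarrow> (plane \<Rightarrow> real) \<Rightarrow> ereal" where
  "esssup_on A f = esssup (restrict_space lebesgue A) (\<lambda>x. ereal (f x))"

end

theory Submission
  imports Defs "HOL-Probability.Probability" "HOL-Real_Asymp.Real_Asymp"
begin

text \<open>On functions vanishing in the hole the equation reads \<open>u' = K u - u\<close> in \<open>L\<^sup>1\<close>, where
  \<open>K g = 1\<^bsub>- H\<^esub> (J * g)\<close> is bounded. Hence \<open>u t\<close> is the Poisson average of the iterates
  \<open>v n = K\<^sup>n u0\<close>, the densities of a random walk with step density \<open>J\<close> killed in \<open>H\<close>, and it suffices
  to find the asymptotics of \<open>v n\<close>.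

  Let \<open>M n\<close> be the mass of \<open>v n\<close>. The pairing of \<open>v n\<close> with \<open>\<phi>\<close> is conserved, \<open>\<phi>\<close> is logarithmic, the
  second moment of \<open>v n\<close> is \<open>O(n)\<close> and \<open>v n = O(1/n)\<close>; so essentially all the mass sits where
  \<open>\<phi> \<approx> (ln n) / 2\<close>, which gives \<open>M n * ln n \<longlonglongrightarrow> 2 M\<^sub>\<phi>\<^sup>*\<close>. For the profile, run the killed walk up to time
  \<open>m = n / ln n\<close> and the free walk afterwards: the mass \<open>M m - M n\<close> absorbed in between is \<open>o(1 / ln n)\<close>
  and contributes \<open>O(1/n)\<close> of itself at distance of order \<open>sqrt n\<close> from the hole, while the free walk turns \<open>v m\<close>
  into a Gaussian by the local limit theorem with rate \<open>n powr (-3/2)\<close>.\<close>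

unbundle inner_syntax

subsection \<open>Gaussian integrals and reflections of Lebesgue measure\<close>

text \<open>The accuracy wanted is o(1/(n ln n)), while the free kernel has size 1/n, so every error
  of order 1/n must carry a further factor o(1/ln n). This dictates the splitting time m. On the one
  hand m/n must tend to 0, so that the mass still sits at scale o(sqrt n) and the Gaussian may be
  moved from time n - m to time n; on the other hand ln m must be asymptotic to ln n, so that M m -
  M n = o(1/ln n). It also forces the second moment bound O(m / ln m): with O(m) alone the spreading
  error at this m would only be O(1/(n ln n)). Mass may be absorbed shortly before time n, so the
  free kernel is needed at all times at once; this is the role of the bound C/|x|^2, uniform in the
  number of steps. On the Fourier side two factors of the transform of \<open>J\<close> are set
  aside at high frequencies: their product is integrable, and the remaining factors decay
  geometrically. Poisson averaging adds only O(t powr (-3/2)), because the index fluctuates by sqrt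
  t while the profile changes at relative rate O(1/t).\<close>

lemma integral_lborel_prod:
  fixes f :: "'a::euclidean_space \<Rightarrow> real \<Rightarrow> 'b::{real_normed_field, banach, second_countable_topology}"
  assumes "\<And>b. b \<in> Basis \<Longrightarrow> integrable lborel (f b)"
  shows integrable_lborel_prod: "integrable lborel (\<lambda>x::'a. \<Prod>b\<in>Basis. f b (x \<bullet> b))"
    and "(LINT x::'a|lborel. (\<Prod>b\<in>Basis. f b (x \<bullet> b))) = (\<Prod>b\<in>Basis. (LINT t|lborel. f b t))"
proof -
  interpret product_sigma_finite "\<lambda>_::'a. lborel :: real measure" ..
  have [measurable]: "f b \<in> borel_measurable borel" if "b \<in> Basis" for b
    using assms[OF that] by auto
  have [measurable]: "(\<lambda>x::'a. \<Prod>b\<in>Basis. f b (x \<bullet> b)) \<in> borel_measurable borel"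
    by (intro borel_measurable_prod) measurable
  have eq: "(\<Prod>b\<in>Basis. f b ((\<Sum>b'\<in>Basis. g b' *\<^sub>R b') \<bullet> b)) = (\<Prod>b\<in>Basis. f b (g b))" for g
    by (intro prod.cong) auto
  show "integrable lborel (\<lambda>x::'a. \<Prod>b\<in>Basis. f b (x \<bullet> b))"
    by (subst lborel_eq, subst integrable_distr_eq) (auto simp: eq intro!: product_integrable_prod assms)
  show "(LINT x::'a|lborel. (\<Prod>b\<in>Basis. f b (x \<bullet> b))) = (\<Prod>b\<in>Basis. (LINT t|lborel. f b t))"
    by (subst lborel_eq, subst integral_distr) (auto simp: eq intro!: product_integral_prod assms)
qed

text \<open>The characteristic function of the standard normal law, rescaled by
  \<open>c = sqrt (2 * s)\<close> so that the exponent \<open>- x^2 / 2\<close> becomes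
  \<open>- s * t^2\<close>.\<close>

lemma gaussian_fourier_real:
  fixes s y :: real
  assumes "s > 0"
  shows integrable_gaussian_fourier_real: "integrable lborel (\<lambda>t. cis (t * y) * exp (- s * t\<^sup>2))"
    and "(LINT t|lborel. cis (t * y) * exp (- s * t\<^sup>2)) = sqrt (pi / s) * exp (- y\<^sup>2 / (4 * s))"
proof -
  define c where "c = sqrt (2 * s)"
  have c: "c > 0" "c\<^sup>2 = 2 * s" using assms by (auto simp: c_def)
  let ?f = "\<lambda>x::real. std_normal_density x *\<^sub>R iexp (y / c * x)"
  have *: "integrable lborel ?f"
  proof (rule Bochner_Integration.integrable_bound)
    show "integrable lborel std_normal_density" by simp
  qed (auto simp: normal_density_nonneg)
  have I: "(LINT x|lborel. ?f x) = exp (- ((y / c)\<^sup>2) / 2)"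
    using fun_cong[OF char_std_normal_distribution, of "y / c"]
    unfolding char_def by (subst (asm) integral_density) (auto simp: normal_density_nonneg)
  have eq: "?f (0 + c * t) = (1 / sqrt (2 * pi)) *\<^sub>R (cis (t * y) * exp (- s * t\<^sup>2))" for t
    using c by (simp add: normal_density_def cis_conv_exp power_mult_distrib scaleR_conv_of_real field_simps)
  have "integrable lborel (\<lambda>t. ?f (0 + c * t))"
    using * c by (intro lborel_integrable_real_affine) auto
  then have "integrable lborel (\<lambda>t. sqrt (2 * pi) *\<^sub>R ((1 / sqrt (2 * pi)) *\<^sub>R (cis (t * y) * exp (- s * t\<^sup>2))))"
    unfolding eq by (rule integrable_scaleR_right)
  then show "integrable lborel (\<lambda>t. cis (t * y) * exp (- s * t\<^sup>2))"
    by (simp del: integrable_scaleR_right)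
  have "(LINT x|lborel. ?f x) = c *\<^sub>R (1 / sqrt (2 * pi)) *\<^sub>R (LINT t|lborel. cis (t * y) * exp (- s * t\<^sup>2))"
    using lborel_integral_real_affine[of c ?f 0] c unfolding eq by simp
  then have "(c / sqrt (2 * pi)) *\<^sub>R (LINT t|lborel. cis (t * y) * exp (- s * t\<^sup>2)) = exp (- ((y / c)\<^sup>2) / 2)"
    using I by simp
  then have "(LINT t|lborel. cis (t * y) * exp (- s * t\<^sup>2)) = (sqrt (2 * pi) / c) *\<^sub>R exp (- ((y / c)\<^sup>2) / 2)"
    using c by (simp add: field_simps scaleR_conv_of_real)
  also have "sqrt (2 * pi) / c = sqrt (pi / s)"
    using assms unfolding c_def by (simp add: real_sqrt_divide[symmetric] real_sqrt_mult)
  also have "exp (- ((y / c)\<^sup>2) / 2) = exp (- y\<^sup>2 / (4 * s))"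
    using c by (simp add: power_divide)
  finally show "(LINT t|lborel. cis (t * y) * exp (- s * t\<^sup>2)) = sqrt (pi / s) * exp (- y\<^sup>2 / (4 * s))"
    by (simp add: scaleR_conv_of_real)
qed

text \<open>The integrand is a product of functions of one coordinate each, so the one-dimensional
  formula is applied in every direction of \<open>Basis\<close>.\<close>

lemma gaussian_fourier:
  fixes x :: "'a::euclidean_space"
  assumes "s > 0"
  shows integrable_gaussian_fourier: "integrable lborel (\<lambda>\<xi>::'a. cis (\<xi> \<bullet> x) * exp (- s * (norm \<xi>)\<^sup>2))"
    and "(LINT \<xi>::'a|lborel. cis (\<xi> \<bullet> x) * exp (- s * (norm \<xi>)\<^sup>2)) =
           sqrt (pi / s) ^ DIM('a) * exp (- (norm x)\<^sup>2 / (4 * s))"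
proof -
  have ip: "\<xi> \<bullet> x = (\<Sum>b\<in>Basis. (\<xi> \<bullet> b) * (x \<bullet> b))" for \<xi> :: 'a
    by (rule euclidean_inner)
  have n2: "(norm \<xi>)\<^sup>2 = (\<Sum>b\<in>Basis. (\<xi> \<bullet> b)\<^sup>2)" for \<xi> :: 'a
    unfolding power2_norm_eq_inner by (subst euclidean_inner) (simp add: power2_eq_square)
  have eq: "cis (\<xi> \<bullet> x) * exp (- s * (norm \<xi>)\<^sup>2) =
      (\<Prod>b\<in>Basis. cis ((\<xi> \<bullet> b) * (x \<bullet> b)) * exp (- s * (\<xi> \<bullet> b)\<^sup>2))" for \<xi> :: 'a
    by (simp add: prod.distrib ip n2 cis_conv_exp sum_distrib_left sum_negf[symmetric]
        exp_sum[symmetric] exp_of_real[symmetric] del: exp_of_real sum_negf)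
  note G = gaussian_fourier_real[OF assms]
  show "integrable lborel (\<lambda>\<xi>::'a. cis (\<xi> \<bullet> x) * exp (- s * (norm \<xi>)\<^sup>2))"
    unfolding eq by (rule integrable_lborel_prod) (rule G(1))
  have "(LINT \<xi>::'a|lborel. cis (\<xi> \<bullet> x) * exp (- s * (norm \<xi>)\<^sup>2)) =
      (\<Prod>b\<in>Basis. sqrt (pi / s) * exp (- (x \<bullet> b)\<^sup>2 / (4 * s)))"
    unfolding eq by (subst integral_lborel_prod(2)) (use G in auto)
  also have "\<dots> = sqrt (pi / s) ^ DIM('a) * exp (- (norm x)\<^sup>2 / (4 * s))"
    by (simp add: prod.distrib n2 sum_divide_distrib sum_negf[symmetric] exp_sum[symmetric]
       exp_of_real[symmetric] del: exp_of_real sum_negf)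
  finally show "(LINT \<xi>::'a|lborel. cis (\<xi> \<bullet> x) * exp (- s * (norm \<xi>)\<^sup>2)) =
           sqrt (pi / s) ^ DIM('a) * exp (- (norm x)\<^sup>2 / (4 * s))" .
qed

lemma gaussian_integral:
  assumes "s > 0"
  shows integrable_gaussian: "integrable lborel (\<lambda>\<xi>::'a::euclidean_space. exp (- s * (norm \<xi>)\<^sup>2))"
    and "(LINT \<xi>::'a|lborel. exp (- s * (norm \<xi>)\<^sup>2)) = sqrt (pi / s) ^ DIM('a)"
proof -
  note G = gaussian_fourier[OF assms, of "0::'a", simplified]
  have I: "integrable lborel (\<lambda>\<xi>::'a. complex_of_real (exp (- s * (norm \<xi>)\<^sup>2)))"
    using G(1) by simp
  then show "integrable lborel (\<lambda>\<xi>::'a. exp (- s * (norm \<xi>)\<^sup>2))"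
    using integrable_Re[OF I] by simp
  have "complex_of_real (LINT \<xi>::'a|lborel. exp (- s * (norm \<xi>)\<^sup>2)) = sqrt (pi / s) ^ DIM('a)"
    using G(2) by (simp flip: integral_complex_of_real)
  then show "(LINT \<xi>::'a|lborel. exp (- s * (norm \<xi>)\<^sup>2)) = sqrt (pi / s) ^ DIM('a)"
    by (metis of_real_eq_iff of_real_power)
qed

lemma distr_lborel_diff: "distr lborel borel (\<lambda>x. t - x) = (lborel :: 'a::euclidean_space measure)"
  using lborel_affine[of "-1" t] by (simp add: density_1)

lemma distr_lborel_diff': "distr lborel borel (\<lambda>x. x - t) = (lborel :: 'a::euclidean_space measure)"
  using lborel_affine[of "1" "-t"] by (simp add: density_1)

lemma integral_lborel_diff:
  fixes f :: "'a::euclidean_space \<Rightarrow> 'b::{banach, second_countable_topology}"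
  assumes [measurable]: "f \<in> borel_measurable borel"
  shows "(LINT x|lborel. f (t - x)) = (LINT x|lborel. f x)"
    and "(LINT x|lborel. f (x - t)) = (LINT x|lborel. f x)"
  by (subst (2) distr_lborel_diff[symmetric, of t], subst integral_distr, simp_all)
     (subst (2) distr_lborel_diff'[symmetric, of t], subst integral_distr, simp_all)

lemma integrable_lborel_diff:
  fixes f :: "'a::euclidean_space \<Rightarrow> 'b::{banach, second_countable_topology}"
  assumes [measurable]: "f \<in> borel_measurable borel"
  shows "integrable lborel (\<lambda>x. f (t - x)) \<longleftrightarrow> integrable lborel f"
    and "integrable lborel (\<lambda>x. f (x - t)) \<longleftrightarrow> integrable lborel f"
  by (subst (2) distr_lborel_diff[symmetric, of t], subst integrable_distr_eq, simp_all)
     (subst (2) distr_lborel_diff'[symmetric, of t], subst integrable_distr_eq, simp_all)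

subsection \<open>Convolution with the kernel\<close>

text \<open>Borel counterpart of \<open>convolution2\<close>. The whole analysis works with Borel
  functions over \<open>lborel\<close>, where joint measurability and Fubini are at hand;
  \<open>lebesgue\<close> returns only in the final theorem.\<close>

definition conv :: "(plane \<Rightarrow> real) \<Rightarrow> (plane \<Rightarrow> real) \<Rightarrow> plane \<Rightarrow> real" where
  "conv f g x = (LINT y|lborel. f (x - y) * g y)"

text \<open>A class of densities stable under \<open>conv J\<close> and under cutting off. The bound
  serves the sup estimates; the weight combines integrability with the second moment, which
  dominates the logarithmic growth of \<phi>.\<close>

definition tame :: "(plane \<Rightarrow> real) \<Rightarrow> bool" where
  "tame g \<longleftrightarrow> g \<in> borel_measurable borel \<and> (\<forall>x. 0 \<le> g x) \<and> (\<exists>C. \<forall>x. g x \<le> C) \<and>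
    integrable lborel (\<lambda>x. g x * (1 + (norm x)\<^sup>2))"

lemma tameD:
  assumes "tame g"
  shows tame_measurable: "g \<in> borel_measurable borel"
    and tame_nonneg: "0 \<le> g x"
    and tame_integrable: "integrable lborel g"
    and tame_integrable_norm2: "integrable lborel (\<lambda>x. g x * (norm x)\<^sup>2)"
    and tame_integrable_weight: "integrable lborel (\<lambda>x. g x * (1 + (norm x)\<^sup>2))"
proof -
  have m[measurable]: "g \<in> borel_measurable borel" and nn: "\<And>x. 0 \<le> g x"
    and I: "integrable lborel (\<lambda>x. g x * (1 + (norm x)\<^sup>2))"
    using assms unfolding tame_def by auto
  show "g \<in> borel_measurable borel" "0 \<le> g x" "integrable lborel (\<lambda>x. g x * (1 + (norm x)\<^sup>2))"
    by (fact m nn I)+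
  have le: "g x \<le> g x * (1 + (norm x)\<^sup>2)" "g x * (norm x)\<^sup>2 \<le> g x * (1 + (norm x)\<^sup>2)" for x
    using nn[of x] by (simp_all add: distrib_left)
  show "integrable lborel g"
    by (rule Bochner_Integration.integrable_bound[OF I]) (use nn le in auto)
  show "integrable lborel (\<lambda>x. g x * (norm x)\<^sup>2)"
    by (rule Bochner_Integration.integrable_bound[OF I]) (use nn le in auto)
qed

lemma tame_bounded: assumes "tame g" obtains C where "C \<ge> 0" "\<And>x. g x \<le> C"
  using assms unfolding tame_def by (meson order_trans)

lemma tame_integrable_le:
  fixes w :: "plane \<Rightarrow> 'b::{banach, second_countable_topology}"
  assumes "tame g" and [measurable]: "w \<in> borel_measurable borel"
    and "\<And>x. norm (w x) \<le> C * (1 + (norm x)\<^sup>2)"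
  shows "integrable lborel (\<lambda>x. g x *\<^sub>R w x)"
proof (rule Bochner_Integration.integrable_bound)
  show "integrable lborel (\<lambda>x. C * (g x * (1 + (norm x)\<^sup>2)))"
    using tame_integrable_weight[OF assms(1)] by simp
  have [measurable]: "g \<in> borel_measurable borel" using assms(1) by (rule tame_measurable)
  show "(\<lambda>x. g x *\<^sub>R w x) \<in> borel_measurable lborel" by measurable
  show "AE x in lborel. norm (g x *\<^sub>R w x) \<le> norm (C * (g x * (1 + (norm x)\<^sup>2)))"
  proof (rule AE_I2)
    fix x
    have "norm (g x *\<^sub>R w x) \<le> g x * (C * (1 + (norm x)\<^sup>2))"
      using tame_nonneg[OF assms(1), of x] assms(3)[of x] by (simp add: mult_left_mono)
    then show "norm (g x *\<^sub>R w x) \<le> norm (C * (g x * (1 + (norm x)\<^sup>2)))"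
      by (simp add: algebra_simps)
  qed
qed

lemma tame_indicator:
  assumes "tame g" and [measurable]: "A \<in> sets borel"
  shows "tame (\<lambda>x. indicator A x * g x)"
proof -
  note [measurable] = tame_measurable[OF assms(1)]
  obtain C where "C \<ge> 0" "\<And>x. g x \<le> C" using tame_bounded[OF assms(1)] by blast
  moreover have "integrable lborel (\<lambda>x. indicator A x * g x * (1 + (norm x)\<^sup>2))"
    using integrable_real_mult_indicator[OF _ tame_integrable_weight[OF assms(1)], of A]
    by (simp add: mult_ac)
  ultimately show ?thesis
    unfolding tame_def using tame_nonneg[OF assms(1)]
    by (auto intro!: exI[of _ C] simp: indicator_def)
qed

lemma conv_measurable[measurable]:
  assumes [measurable]: "f \<in> borel_measurable borel" "g \<in> borel_measurable borel"
  shows "conv f g \<in> borel_measurable borel"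
proof -
  have "(\<lambda>x. conv f g x) \<in> borel_measurable lborel"
    unfolding conv_def by (rule lborel.borel_measurable_lebesgue_integral) measurable
  then show ?thesis by simp
qed

text \<open>Fubini, with an abstract majorant \<open>B\<close> of the inner absolute integral
  because the weight \<open>w\<close> may grow. The weight is vector-valued so that one lemma covers
  moments and complex characters.\<close>

lemma conv_duality_general:
  fixes w :: "plane \<Rightarrow> 'b::{banach, second_countable_topology}"
  assumes [measurable]: "f \<in> borel_measurable borel" "g \<in> borel_measurable borel" "w \<in> borel_measurable borel"
    and int: "\<And>y. integrable lborel (\<lambda>x. f (x - y) *\<^sub>R w x)"
    and B: "\<And>y. (LINT x|lborel. \<bar>f (x - y)\<bar> * norm (w x)) \<le> B y"
    and gB: "integrable lborel (\<lambda>y. g y * B y)"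
  shows conv_duality_general_integrable: "integrable lborel (\<lambda>x. conv f g x *\<^sub>R w x)"
    and "(LINT x|lborel. conv f g x *\<^sub>R w x) = (LINT y|lborel. g y *\<^sub>R (LINT x|lborel. f (x - y) *\<^sub>R w x))"
proof -
  let ?F = "\<lambda>(y, x). (f (x - y) * g y) *\<^sub>R w x"
  have m: "?F \<in> borel_measurable (lborel \<Otimes>\<^sub>M lborel)" by measurable
  have I: "integrable (lborel \<Otimes>\<^sub>M lborel) ?F"
  proof (rule lborel_pair.Fubini_integrable[OF m])
    show "AE y in lborel. integrable lborel (\<lambda>x. ?F (y, x))"
    proof (rule AE_I2)
      fix y show "integrable lborel (\<lambda>x. ?F (y, x))"
        using integrable_scaleR_right[of "g y", OF int[of y]] by (simp add: mult.commute)
    qed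
    have eq: "(LINT x|lborel. norm (?F (y, x))) = \<bar>g y\<bar> * (LINT x|lborel. \<bar>f (x - y)\<bar> * norm (w x))" for y
      by (subst integral_mult_right_zero[symmetric], rule Bochner_Integration.integral_cong) (simp_all add: abs_mult mult_ac)
    have nn: "0 \<le> (LINT x|lborel. \<bar>f (x - y)\<bar> * norm (w x))" for y by (intro Bochner_Integration.integral_nonneg) auto
    show "integrable lborel (\<lambda>y. LINT x|lborel. norm (?F (y, x)))"
      unfolding eq
    proof (rule Bochner_Integration.integrable_bound[OF gB])
      show "(\<lambda>y. \<bar>g y\<bar> * (LINT x|lborel. \<bar>f (x - y)\<bar> * norm (w x))) \<in> borel_measurable lborel"
        by measurable
      show "AE y in lborel. norm (\<bar>g y\<bar> * (LINT x|lborel. \<bar>f (x - y)\<bar> * norm (w x))) \<le> norm (g y * B y)"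
        using B nn by (auto simp: abs_mult intro!: mult_left_mono AE_I2 order_trans[OF B abs_ge_self])
    qed
  qed
  have eq: "(LINT y|lborel. ?F (y, x)) = conv f g x *\<^sub>R w x" for x
  proof (cases "w x \<noteq> 0 \<longrightarrow> integrable lborel (\<lambda>y. f (x - y) * g y)")
    case True
    then show ?thesis unfolding conv_def split_conv by (intro integral_scaleR_left) auto
  next
    case False
    \<comment> \<open>Here both sides equal 0, the default value of a divergent integral.\<close>
    have "\<not> integrable lborel (\<lambda>y. (f (x - y) * g y) *\<^sub>R w x)"
    proof
      assume "integrable lborel (\<lambda>y. (f (x - y) * g y) *\<^sub>R w x)"
      then have "integrable lborel (\<lambda>y. norm ((f (x - y) * g y) *\<^sub>R w x) / norm (w x))"
        by (intro integrable_divide integrable_norm)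
      then have "integrable lborel (\<lambda>y. \<bar>f (x - y) * g y\<bar>)"
        using False by simp
      then have "integrable lborel (\<lambda>y. f (x - y) * g y)"
        by (subst (asm) integrable_abs_iff) measurable
      with False show False by simp
    qed
    then show ?thesis using False by (simp add: conv_def not_integrable_integral_eq)
  qed
  show "integrable lborel (\<lambda>x. conv f g x *\<^sub>R w x)"
    using lborel_pair.integrable_snd[OF I] eq by simp
  have "(LINT x|lborel. (LINT y|lborel. ?F (y, x))) = (LINT y|lborel. (LINT x|lborel. ?F (y, x)))"
    using I by (intro lborel_pair.Fubini_integral) simp
  moreover have "(LINT x|lborel. ?F (y, x)) = g y *\<^sub>R (LINT x|lborel. f (x - y) *\<^sub>R w x)" for y
    by (subst integral_scaleR_right[symmetric]) (auto simp: mult.commute)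
  ultimately show "(LINT x|lborel. conv f g x *\<^sub>R w x) = (LINT y|lborel. g y *\<^sub>R (LINT x|lborel. f (x - y) *\<^sub>R w x))"
    unfolding eq by simp
qed

section \<open>One step of the free walk: integrability, symmetry and moments of the kernel\<close>

locale radial_kernel =
  fixes J :: "plane \<Rightarrow> real" and d :: real
  assumes J_cont: "continuous_on UNIV J"
    and J_radial: "radially_symmetric J"
    and d_pos: "0 < d"
    and J_pos: "norm x < d \<Longrightarrow> 0 < J x"
    and J_zero: "d \<le> norm x \<Longrightarrow> J x = 0"
    and J_int: "(LINT x|lborel. J x) = 1"
begin

lemma J_measurable[measurable]: "J \<in> borel_measurable borel"
  using J_cont by (rule borel_measurable_continuous_onI)

lemma J_nonneg: "0 \<le> J x"
  using J_pos[of x] J_zero[of x] by force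

lemma J_even: "J (- x) = J x"
  using J_radial[unfolded radially_symmetric_def, rule_format, of "- x" x] by simp

lemma J_diff_commute: "J (x - y) = J (y - x)"
  using J_even[of "x - y"] by simp

lemma J_bounded: obtains C where "C > 0" "\<And>x. J x \<le> C"
proof -
  have "bounded (J ` cball 0 d)"
    using J_cont by (intro compact_imp_bounded compact_continuous_image) (auto intro: continuous_on_subset)
  then obtain C where C: "\<And>x. norm x \<le> d \<Longrightarrow> \<bar>J x\<bar> \<le> C" unfolding bounded_iff by (metis imageI mem_cball_0 real_norm_def)
  have "J x \<le> \<bar>C\<bar> + 1" for x
    using C[of x] J_zero[of x] by (cases "norm x \<le> d") auto
  then show ?thesis by (intro that[of "\<bar>C\<bar> + 1"]) auto
qed

lemma J_integrable: "integrable lborel J"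
  using J_int not_integrable_integral_eq by force

text \<open>\<open>J (x - y)\<close> vanishes for \<open>norm (x - y) \<ge> d\<close>, so only the
  values of \<open>w\<close> on the ball of radius \<open>d + norm y\<close> matter.\<close>

lemma J_growth_integrable:
  fixes w :: "plane \<Rightarrow> 'b::{banach, second_countable_topology}"
  assumes [measurable]: "w \<in> borel_measurable borel" and w: "\<And>x. norm x \<le> d + norm y \<Longrightarrow> norm (w x) \<le> C"
  shows "integrable lborel (\<lambda>x. J (x - y) *\<^sub>R w x)"
proof (rule Bochner_Integration.integrable_bound)
  show "integrable lborel (\<lambda>x. C * J (x - y))"
    using J_integrable integrable_lborel_diff(2)[OF J_measurable, of y] by simp
  show "AE x in lborel. norm (J (x - y) *\<^sub>R w x) \<le> norm (C * J (x - y))"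
  proof (rule AE_I2)
    fix x
    show "norm (J (x - y) *\<^sub>R w x) \<le> norm (C * J (x - y))"
    proof (cases "norm (x - y) < d")
      case True
      then have "norm x \<le> d + norm y" using norm_triangle_ineq2[of x y] by linarith
      then have "norm (w x) \<le> C" by (rule w)
      then show ?thesis using J_nonneg[of "x - y"] by (simp add: mult.commute[of C] abs_mult mult_left_mono)
    qed (use J_zero[of "x - y"] in auto)
  qed
qed measurable

lemma J_moment_integrable:
  assumes "w \<in> borel_measurable borel" and "\<And>x. norm x \<le> d \<Longrightarrow> \<bar>w x :: real\<bar> \<le> C"
  shows "integrable lborel (\<lambda>x. J x * w x)"
  using J_growth_integrable[of w 0 C] assms by simp

lemma tame_J: "tame J"
  unfolding tame_def
proof (intro conjI)
  show "\<exists>C. \<forall>x. J x \<le> C" using J_bounded by metis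
  show "integrable lborel (\<lambda>x. J x * (1 + (norm x)\<^sup>2))"
    by (rule J_moment_integrable[where C = "1 + d\<^sup>2"]) (auto intro!: power_mono)
qed (use J_nonneg in auto)

lemma J_odd_integral:
  assumes [measurable]: "w \<in> borel_measurable borel" and "\<And>x. w (- x) = - (w x :: real)"
  shows "(LINT x|lborel. J x * w x) = 0"
proof -
  have "(LINT x|lborel. J x * w x) = (LINT x|lborel. J (0 - x) * w (0 - x))"
    by (rule integral_lborel_diff(1)[symmetric]) measurable
  also have "\<dots> = - (LINT x|lborel. J x * w x)"
    by (simp add: J_even assms(2))
  finally show ?thesis by simp
qed

definition q :: real where "q = diffusivity J"

lemma q_eq: "(LINT z|lborel. J z * (norm z)\<^sup>2) = 4 * q"
  unfolding q_def diffusivity_def by (subst integral_completion) (auto simp: mult.commute)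

lemma J_shift:
  fixes w :: "plane \<Rightarrow> 'b::{banach, second_countable_topology}"
  assumes [measurable]: "w \<in> borel_measurable borel"
  shows "(LINT x|lborel. J (x - y) *\<^sub>R w x) = (LINT x|lborel. J x *\<^sub>R w (x + y))"
  using integral_lborel_diff(2)[of "\<lambda>x. J x *\<^sub>R w (x + y)" y] by simp

lemma J_shift_mass: "(LINT x|lborel. J (x - y)) = 1"
  using integral_lborel_diff(2)[OF J_measurable, of y] J_int by simp

text \<open>In the expansion of \<open>|x + y|^2\<close> the cross term is odd in \<open>x\<close>
  and integrates to 0. Thus each free step adds \<open>4 * q\<close> to the second moment per unit
  of mass.\<close>

lemma J_shift_norm2: "(LINT x|lborel. J (x - y) * (norm x)\<^sup>2) = (norm y)\<^sup>2 + 4 * q"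
proof -
  have I: "integrable lborel (\<lambda>x. J x * (norm x)\<^sup>2)" "integrable lborel (\<lambda>x. J x * (2 * (x \<bullet> y)))"
    by (rule J_moment_integrable[where C = "d\<^sup>2"]; auto intro!: power_mono)
       (rule J_moment_integrable[where C = "2 * (d * norm y)"]; auto simp: abs_mult
          intro!: order_trans[OF Cauchy_Schwarz_ineq2] mult_right_mono)
  have "(LINT x|lborel. J (x - y) * (norm x)\<^sup>2) = (LINT x|lborel. J x * (norm (x + y))\<^sup>2)"
    using J_shift[of "\<lambda>x. (norm x)\<^sup>2" y] by simp
  also have "\<dots> = (LINT x|lborel. J x * (norm x)\<^sup>2 + J x * (2 * (x \<bullet> y)) + (norm y)\<^sup>2 * J x)"
    by (intro Bochner_Integration.integral_cong) (auto simp: dot_norm field_simps)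
  also have "\<dots> = 4 * q + (LINT x|lborel. J x * (2 * (x \<bullet> y))) + (norm y)\<^sup>2"
    using I J_integrable J_int q_eq by simp
  also have "(LINT x|lborel. J x * (2 * (x \<bullet> y))) = 0"
    by (rule J_odd_integral) auto
  finally show ?thesis by simp
qed

lemma J_shift_weight: "(LINT x|lborel. J (x - y) * (1 + (norm x)\<^sup>2)) = 1 + (norm y)\<^sup>2 + 4 * q"
proof -
  have "integrable lborel (\<lambda>x. J (x - y) * (norm x)\<^sup>2)" "integrable lborel (\<lambda>x. J (x - y))"
    using J_growth_integrable[of "\<lambda>x. (norm x)\<^sup>2" y "(d + norm y)\<^sup>2"] J_growth_integrable[of "\<lambda>x. 1::real" y 1] d_pos
    by (auto intro: power_mono)
  then show ?thesis by (simp add: distrib_left J_shift_norm2 J_shift_mass)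
qed

lemma q_pos: "q > 0"
proof -
  have I: "integrable lborel (\<lambda>x. J x * (norm x)\<^sup>2)"
    using tame_integrable_norm2[OF tame_J] .
  have "(LINT z|lborel. J z * (norm z)\<^sup>2) \<noteq> 0"
  proof
    assume "(LINT z|lborel. J z * (norm z)\<^sup>2) = 0"
    then have "AE z in lborel. J z * (norm z)\<^sup>2 = 0"
      using integral_nonneg_eq_0_iff_AE[OF I] J_nonneg by auto
    then have "AE z in lborel. J z = 0"
      using AE_lborel_singleton[of "0::plane"] by eventually_elim auto
    then have "(LINT z|lborel. J z) = 0" by (simp add: integral_eq_zero_AE)
    then show False using J_int by simp
  qed
  moreover have "(LINT z|lborel. J z * (norm z)\<^sup>2) \<ge> 0" using J_nonneg by (intro Bochner_Integration.integral_nonneg) auto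
  ultimately show ?thesis using q_eq by linarith
qed

lemma conv_duality:
  fixes w :: "plane \<Rightarrow> 'b::{banach, second_countable_topology}"
  assumes g: "tame g" and [measurable]: "w \<in> borel_measurable borel"
    and w: "\<And>x. norm (w x) \<le> C * (1 + (norm x)\<^sup>2)"
  shows conv_duality_integrable: "integrable lborel (\<lambda>x. conv J g x *\<^sub>R w x)"
    and "(LINT x|lborel. conv J g x *\<^sub>R w x) = (LINT y|lborel. g y *\<^sub>R (LINT x|lborel. J (x - y) *\<^sub>R w x))"
proof -
  note [measurable] = tame_measurable[OF g]
  have C: "C \<ge> 0" using order_trans[OF norm_ge_zero w[of 0]] by simp
  have i1: "integrable lborel (\<lambda>x. J (x - y) *\<^sub>R w x)" for y
    using d_pos by (rule_tac J_growth_integrable[where C = "C * (1 + (d + norm y)\<^sup>2)"])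
       (auto intro!: order_trans[OF w] mult_left_mono power_mono C)
  have "(LINT x|lborel. \<bar>J (x - y)\<bar> * norm (w x)) \<le> C * (1 + (norm y)\<^sup>2 + 4 * q)" for y
  proof -
    have "(LINT x|lborel. \<bar>J (x - y)\<bar> * norm (w x)) \<le> (LINT x|lborel. C * (J (x - y) * (1 + (norm x)\<^sup>2)))"
    proof (rule integral_mono)
      show "integrable lborel (\<lambda>x. \<bar>J (x - y)\<bar> * norm (w x))"
        using integrable_norm[OF i1[of y]] by simp
      have "integrable lborel (\<lambda>x. J (x - y) *\<^sub>R (1 + (norm x)\<^sup>2))"
        by (rule J_growth_integrable[where C = "1 + (d + norm y)\<^sup>2"]) (auto intro!: power_mono)
      then show "integrable lborel (\<lambda>x. C * (J (x - y) * (1 + (norm x)\<^sup>2)))" by simp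
      show "\<bar>J (x - y)\<bar> * norm (w x) \<le> C * (J (x - y) * (1 + (norm x)\<^sup>2))" for x
        using mult_left_mono[OF w[of x] J_nonneg[of "x - y"]] J_nonneg[of "x - y"] by (simp add: mult_ac)
    qed
    then show ?thesis by (simp add: J_shift_weight)
  qed
  moreover have "integrable lborel (\<lambda>y. g y * (C * (1 + (norm y)\<^sup>2 + 4 * q)))"
    using tame_integrable_weight[OF g] tame_integrable[OF g]
    by (auto simp: algebra_simps intro!: Bochner_Integration.integrable_add tame_integrable_norm2[OF g])
  ultimately have "integrable lborel (\<lambda>x. conv J g x *\<^sub>R w x) \<and>
    (LINT x|lborel. conv J g x *\<^sub>R w x) = (LINT y|lborel. g y *\<^sub>R (LINT x|lborel. J (x - y) *\<^sub>R w x))"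
    by (intro conjI conv_duality_general[OF _ _ _ i1]) auto
  then show "integrable lborel (\<lambda>x. conv J g x *\<^sub>R w x)"
    "(LINT x|lborel. conv J g x *\<^sub>R w x) = (LINT y|lborel. g y *\<^sub>R (LINT x|lborel. J (x - y) *\<^sub>R w x))"
    by auto
qed

lemma conv_J_le:
  assumes "g \<in> borel_measurable borel" "\<And>x. \<bar>g x\<bar> \<le> C"
  shows "\<bar>conv J g x\<bar> \<le> C"
proof -
  note [measurable] = assms(1)
  have I: "integrable lborel (\<lambda>y. J (y - x) *\<^sub>R g y)"
    by (rule J_growth_integrable) (use assms in auto)
  have "\<bar>conv J g x\<bar> \<le> (LINT y|lborel. \<bar>J (y - x) *\<^sub>R g y\<bar>)"
    unfolding conv_def by (subst J_diff_commute) (use integral_abs_bound[of lborel "\<lambda>y. J (y - x) *\<^sub>R g y"] in simp)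
  also have "\<dots> \<le> (LINT y|lborel. C * J (y - x))"
  proof (rule integral_mono)
    show "integrable lborel (\<lambda>y. \<bar>J (y - x) *\<^sub>R g y\<bar>)" using I by (rule integrable_abs)
    show "integrable lborel (\<lambda>y. C * J (y - x))"
      using J_integrable integrable_lborel_diff(2)[OF J_measurable, of x] by simp
    show "\<bar>J (y - x) *\<^sub>R g y\<bar> \<le> C * J (y - x)" for y
      using mult_left_mono[OF assms(2)[of y] J_nonneg[of "y - x"]] J_nonneg[of "y - x"] by (simp add: abs_mult mult_ac)
  qed
  finally show ?thesis by (simp add: J_shift_mass)
qed

lemma tame_conv:
  assumes g: "tame g" shows "tame (conv J g)"
  unfolding tame_def
proof (intro conjI allI)
  note [measurable] = tame_measurable[OF g]
  show "conv J g \<in> borel_measurable borel" by measurable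
  show "0 \<le> conv J g x" for x
    unfolding conv_def using J_nonneg tame_nonneg[OF g] by (intro Bochner_Integration.integral_nonneg) auto
  obtain C where "C \<ge> 0" "\<And>x. g x \<le> C" using tame_bounded[OF g] by blast
  then have "conv J g x \<le> C" for x
    using conv_J_le[of g C x] tame_nonneg[OF g] by auto
  then show "\<exists>C. \<forall>x. conv J g x \<le> C" by auto
  show "integrable lborel (\<lambda>x. conv J g x * (1 + (norm x)\<^sup>2))"
    using conv_duality_integrable[OF g, of "\<lambda>x. 1 + (norm x)\<^sup>2" 1] by simp
qed

lemma conv_mass: "tame g \<Longrightarrow> (LINT x|lborel. conv J g x) = (LINT x|lborel. g x)"
  using conv_duality(2)[of g "\<lambda>x. 1::real" 1] by (simp add: J_shift_mass)

lemma conv_norm2: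
  assumes "tame g"
  shows "(LINT x|lborel. conv J g x * (norm x)\<^sup>2) = (LINT x|lborel. g x * (norm x)\<^sup>2) + 4 * q * (LINT x|lborel. g x)"
  using conv_duality(2)[OF assms, of "\<lambda>x. (norm x)\<^sup>2" 1] tame_integrable_norm2[OF assms] tame_integrable[OF assms]
  by (simp add: J_shift_norm2 distrib_left)

section \<open>Convolution powers\<close>

lemma tame_funpow: "tame g \<Longrightarrow> tame ((conv J ^^ n) g)"
  by (induction n) (auto intro: tame_conv)

lemma funpow_mass: "tame g \<Longrightarrow> (LINT x|lborel. (conv J ^^ n) g x) = (LINT x|lborel. g x)"
  by (induction n) (auto simp: conv_mass tame_funpow)

lemma funpow_norm2:
  "tame g \<Longrightarrow> (LINT x|lborel. (conv J ^^ n) g x * (norm x)\<^sup>2) =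
     (LINT x|lborel. g x * (norm x)\<^sup>2) + 4 * q * n * (LINT x|lborel. g x)"
proof (induction n)
  case (Suc n)
  then show ?case
    by (simp add: conv_norm2 tame_funpow funpow_mass) (simp add: algebra_simps)
qed simp

text \<open>The density \<open>J\<^sup>*\<^sup>n\<close> of \<open>n \<ge> 1\<close> steps; \<open>p 0 = J\<close> is a junk value.\<close>

definition p :: "nat \<Rightarrow> plane \<Rightarrow> real" where "p n = (conv J ^^ (n - 1)) J"

lemma p_1[simp]: "p (Suc 0) = J" by (simp add: p_def)

lemma p_Suc: "n \<ge> 1 \<Longrightarrow> p (Suc n) = conv J (p n)"
  by (cases n) (auto simp: p_def)

lemma tame_p: "tame (p n)"
  by (simp add: p_def tame_funpow tame_J)

lemma p_nonneg: "0 \<le> p n x" by (rule tame_nonneg[OF tame_p])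

lemma p_measurable[measurable]: "p n \<in> borel_measurable borel" by (rule tame_measurable[OF tame_p])

lemma p_norm2: "n \<ge> 1 \<Longrightarrow> (LINT x|lborel. p n x * (norm x)\<^sup>2) = 4 * q * n"
  by (cases n) (auto simp: p_def funpow_norm2 tame_J J_int q_eq algebra_simps)

lemma conv_integrable:
  assumes "tame f" "tame g"
  shows "integrable lborel (\<lambda>y. f (x - y) * g y)"
proof -
  note [measurable] = tame_measurable[OF assms(1)] tame_measurable[OF assms(2)]
  obtain C where C: "C \<ge> 0" "\<And>x. f x \<le> C" using tame_bounded[OF assms(1)] by blast
  have "f x \<le> C * (1 + (norm y)\<^sup>2)" for x y
    using C(2)[of x] mult_left_mono[of 1 "1 + (norm y)\<^sup>2" C] C(1) by simp
  then have "integrable lborel (\<lambda>y. g y *\<^sub>R f (x - y))"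
    using tame_nonneg[OF assms(1)] by (intro tame_integrable_le[OF assms(2), where C = C]) auto
  then show ?thesis by (simp add: mult.commute)
qed

text \<open>Duality with the weight \<open>x' \<mapsto> J (x - x')\<close>: its inner integral
  against \<open>f (x' - y)\<close> is \<open>conv J f (x - y)\<close>.\<close>

lemma conv_assoc:
  assumes "tame f" "tame g"
  shows "conv J (conv f g) = conv (conv J f) g"
proof
  fix x
  note [measurable] = tame_measurable[OF assms(1)] tame_measurable[OF assms(2)]
  have eq: "(LINT x'|lborel. f (x' - y) * J (x - x')) = conv J f (x - y)" for y
    unfolding conv_def using integral_lborel_diff(2)[of "\<lambda>z. J (x - y - z) * f z" y]
    by (simp add: mult.commute)
  have "(LINT x'|lborel. conv f g x' *\<^sub>R J (x - x')) = (LINT y|lborel. g y *\<^sub>R (LINT x'|lborel. f (x' - y) *\<^sub>R J (x - x')))"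
  proof (rule conv_duality_general(2))
    show "integrable lborel (\<lambda>x'. f (x' - y) *\<^sub>R J (x - x'))" for y
      using conv_integrable[OF tame_J assms(1), of "x - y"] integrable_lborel_diff(2)[of "\<lambda>z. J (x - y - z) * f z" y]
      by (simp add: mult.commute)
    show "(LINT x'|lborel. \<bar>f (x' - y)\<bar> * norm (J (x - x'))) \<le> conv J f (x - y)" for y
      using eq tame_nonneg[OF assms(1)] J_nonneg by simp
    show "integrable lborel (\<lambda>y. g y * conv J f (x - y))"
      using conv_integrable[OF tame_conv[OF assms(1)] assms(2), of x] by (simp add: mult.commute)
  qed measurable
  then show "conv J (conv f g) x = conv (conv J f) g x"
    unfolding conv_def[of J "conv f g"] conv_def[of "conv J f" g] real_scaleR_def eq
    by (simp add: mult.commute)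
qed

lemma funpow_conv:
  assumes "tame g" "n \<ge> 1" shows "(conv J ^^ n) g = conv (p n) g"
  using assms(2)
proof (induction n rule: dec_induct)
  case (step n)
  then show ?case by (simp add: conv_assoc tame_p assms(1) p_Suc)
qed simp

lemma p_add:
  assumes "m \<ge> 1" "n \<ge> 1" shows "p (m + n) = conv (p m) (p n)"
proof -
  have "m + n - 1 = m + (n - 1)" using assms by simp
  then have "p (m + n) = (conv J ^^ m) (p n)"
    by (simp only: p_def funpow_add comp_apply)
  then show ?thesis using funpow_conv[OF tame_p assms(1)] by simp
qed

end

subsection \<open>Fourier inversion for the convolution powers\<close>

text \<open>The weight is the Fourier transform of \<open>exp (- s * |xi|^2)\<close> and has total
  mass \<open>4 * pi^2\<close>, the constant of planar Fourier inversion. Substituting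
  \<open>y = x + sqrt s * z\<close> leaves a fixed Gaussian, to which dominated convergence
  applies.\<close>

lemma tendsto_gaussian_average:
  fixes f :: "plane \<Rightarrow> real"
  assumes [measurable]: "f \<in> borel_measurable borel" and C: "\<And>x. \<bar>f x\<bar> \<le> C"
    and cont: "continuous (at x) f" and s: "\<And>k. s k > 0" "s \<longlonglongrightarrow> 0"
  shows "(\<lambda>k. LINT y|lborel. f y * (pi / s k * exp (- (norm (y - x))\<^sup>2 / (4 * s k)))) \<longlonglongrightarrow> 4 * pi\<^sup>2 * f x"
proof -
  let ?G = "\<lambda>z::plane. pi * exp (- (1/4) * (norm z)\<^sup>2)"
  have eq: "(LINT y|lborel. f y * (pi / s k * exp (- (norm (y - x))\<^sup>2 / (4 * s k)))) =
      (LINT z|lborel. f (x + sqrt (s k) *\<^sub>R z) * ?G z)" for k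
  proof -
    let ?F = "\<lambda>y. f y * (pi / s k * exp (- (norm (y - x))\<^sup>2 / (4 * s k)))"
    have "(LINT y|lborel. ?F y) =
        (LINT y|density (distr lborel borel (\<lambda>z. x + sqrt (s k) *\<^sub>R z)) (\<lambda>_. \<bar>sqrt (s k)\<bar>^DIM(plane)). ?F y)"
      using s(1)[of k] by (subst lborel_affine[of "sqrt (s k)" x]) auto
    also have "\<dots> = (LINT z|lborel. s k *\<^sub>R ?F (x + sqrt (s k) *\<^sub>R z))"
      using s(1)[of k] by (subst integral_density, simp, simp, simp, subst integral_distr) auto
    also have "\<dots> = (LINT z|lborel. f (x + sqrt (s k) *\<^sub>R z) * ?G z)"
      using s(1)[of k] by (intro Bochner_Integration.integral_cong) (auto simp: power_mult_distrib field_simps)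
    finally show ?thesis .
  qed
  have int: "integrable lborel ?G" "(LINT z|lborel. ?G z) = 4 * pi\<^sup>2"
    using integrable_gaussian[of "1/4", where 'a=plane] gaussian_integral(2)[of "1/4", where 'a=plane]
    by (simp_all add: power2_eq_square)
  have "(\<lambda>k. LINT z|lborel. f (x + sqrt (s k) *\<^sub>R z) * ?G z) \<longlonglongrightarrow> (LINT z|lborel. f x * ?G z)"
  proof (rule integral_dominated_convergence)
    show "integrable lborel (\<lambda>z. C * ?G z)" using int(1) by (rule integrable_mult_right)
    show "AE z in lborel. (\<lambda>k. f (x + sqrt (s k) *\<^sub>R z) * ?G z) \<longlonglongrightarrow> f x * ?G z"
    proof (rule AE_I2)
      fix z :: plane
      have "(\<lambda>k. x + sqrt (s k) *\<^sub>R z) \<longlonglongrightarrow> x + sqrt 0 *\<^sub>R z"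
        by (intro tendsto_intros s)
      then have "(\<lambda>k. f (x + sqrt (s k) *\<^sub>R z)) \<longlonglongrightarrow> f x"
        using cont by (intro isCont_tendsto_compose[of x f]) auto
      then show "(\<lambda>k. f (x + sqrt (s k) *\<^sub>R z) * ?G z) \<longlonglongrightarrow> f x * ?G z"
        by (intro tendsto_intros)
    qed
    show "AE z in lborel. norm (f (x + sqrt (s k) *\<^sub>R z) * ?G z) \<le> C * ?G z" for k
      by (auto simp: abs_mult C intro!: mult_right_mono)
  qed measurable
  then show ?thesis unfolding eq using int by (simp add: mult.commute)
qed

context radial_kernel begin

lemma cis_weight_integrable:
  assumes "tame g" shows "integrable lborel (\<lambda>x. g x *\<^sub>R cis (\<xi> \<bullet> x))"
proof (rule tame_integrable_le[OF assms, where C = 1])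
  have "continuous_on UNIV (\<lambda>x. cis (\<xi> \<bullet> x))"
    unfolding cis_conv_exp by (intro continuous_intros)
  then show "(\<lambda>x. cis (\<xi> \<bullet> x)) \<in> borel_measurable borel" by (rule borel_measurable_continuous_onI)
qed simp

text \<open>The Fourier transform of \<open>J\<close>; the sine part vanishes because
  \<open>J\<close> is even, see \<open>J_fourier\<close>.\<close>

definition a :: "plane \<Rightarrow> real" where "a \<xi> = (LINT x|lborel. J x * cos (\<xi> \<bullet> x))"

lemma J_fourier: "(LINT x|lborel. J x *\<^sub>R cis (\<xi> \<bullet> x)) = complex_of_real (a \<xi>)"
proof (rule complex_eqI)
  note I = cis_weight_integrable[OF tame_J, of \<xi>]
  show "Re (LINT x|lborel. J x *\<^sub>R cis (\<xi> \<bullet> x)) = Re (complex_of_real (a \<xi>))"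
    by (subst integral_Re[OF I, symmetric]) (simp add: a_def)
  have "(LINT x|lborel. J x * sin (\<xi> \<bullet> x)) = 0"
    by (rule J_odd_integral) auto
  then show "Im (LINT x|lborel. J x *\<^sub>R cis (\<xi> \<bullet> x)) = Im (complex_of_real (a \<xi>))"
    by (subst integral_Im[OF I, symmetric]) simp
qed

lemma a_measurable[measurable]: "a \<in> borel_measurable borel"
proof -
  have "(\<lambda>\<xi>. a \<xi>) \<in> borel_measurable lborel"
    unfolding a_def by (rule lborel.borel_measurable_lebesgue_integral) measurable
  then show ?thesis by simp
qed

lemma abs_a_le_1: "\<bar>a \<xi>\<bar> \<le> 1"
proof -
  have "\<bar>a \<xi>\<bar> \<le> (LINT x|lborel. \<bar>J x * cos (\<xi> \<bullet> x)\<bar>)"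
    unfolding a_def using integral_abs_bound by blast
  also have "\<dots> \<le> (LINT x|lborel. J x)"
  proof (rule integral_mono[OF _ J_integrable])
    show "integrable lborel (\<lambda>x. \<bar>J x * cos (\<xi> \<bullet> x)\<bar>)"
      by (intro integrable_abs J_moment_integrable[where C=1]) auto
    show "\<bar>J x * cos (\<xi> \<bullet> x)\<bar> \<le> J x" for x
      using J_nonneg[of x] by (simp add: abs_mult mult_left_le)
  qed
  finally show ?thesis by (simp add: J_int)
qed

lemma conv_fourier:
  assumes "tame g"
  shows "(LINT x|lborel. conv J g x *\<^sub>R cis (\<xi> \<bullet> x)) = a \<xi> * (LINT x|lborel. g x *\<^sub>R cis (\<xi> \<bullet> x))"
proof -
  have "continuous_on UNIV (\<lambda>x. cis (\<xi> \<bullet> x))"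
    unfolding cis_conv_exp by (intro continuous_intros)
  then have m[measurable]: "(\<lambda>x. cis (\<xi> \<bullet> x)) \<in> borel_measurable borel" by (rule borel_measurable_continuous_onI)
  have "(LINT x|lborel. J (x - y) *\<^sub>R cis (\<xi> \<bullet> x)) = a \<xi> * cis (\<xi> \<bullet> y)" for y
  proof -
    have "(LINT x|lborel. J (x - y) *\<^sub>R cis (\<xi> \<bullet> x)) = (LINT x|lborel. J x *\<^sub>R cis (\<xi> \<bullet> x) * cis (\<xi> \<bullet> y))"
      by (subst J_shift) (auto simp: inner_add_right cis_mult)
    also have "\<dots> = (LINT x|lborel. J x *\<^sub>R cis (\<xi> \<bullet> x)) * cis (\<xi> \<bullet> y)"
      by (rule integral_mult_left_zero)
    finally show ?thesis by (simp add: J_fourier)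
  qed
  then have "(LINT x|lborel. conv J g x *\<^sub>R cis (\<xi> \<bullet> x)) = (LINT y|lborel. a \<xi> * (g y *\<^sub>R cis (\<xi> \<bullet> y)))"
    by (subst conv_duality(2)[OF assms m, where C=1]) (auto simp: mult_scaleR_right)
  also have "\<dots> = a \<xi> * (LINT x|lborel. g x *\<^sub>R cis (\<xi> \<bullet> x))"
    by (rule integral_mult_right_zero)
  finally show ?thesis .
qed

lemma p_fourier:
  assumes "n \<ge> 1" shows "(LINT x|lborel. p n x *\<^sub>R cis (\<xi> \<bullet> x)) = complex_of_real (a \<xi> ^ n)"
  using assms by (induction n rule: dec_induct) (auto simp: J_fourier p_Suc conv_fourier tame_p)

text \<open>Regularised Fourier inversion: the Gaussian factor makes the double integral absolutely
  convergent before any integrability of \<open>a ^ n\<close> is known.\<close>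

lemma p_gaussian_average:
  assumes "n \<ge> 1" "s > 0"
  shows integrable_p_gaussian: "integrable lborel (\<lambda>\<xi>. a \<xi> ^ n * cos (\<xi> \<bullet> x) * exp (- s * (norm \<xi>)\<^sup>2))"
    and "(LINT \<xi>|lborel. a \<xi> ^ n * cos (\<xi> \<bullet> x) * exp (- s * (norm \<xi>)\<^sup>2)) =
      (LINT y|lborel. p n y * (pi / s * exp (- (norm (y - x))\<^sup>2 / (4 * s))))"
proof -
  note [measurable] = p_measurable[of n]
  let ?e = "\<lambda>\<xi>::plane. exp (- s * (norm \<xi>)\<^sup>2)"
  let ?F = "\<lambda>(y, \<xi>). p n y *\<^sub>R (cis (\<xi> \<bullet> (y - x)) * ?e \<xi>)"
  have m: "?F \<in> borel_measurable (lborel \<Otimes>\<^sub>M lborel)"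
    unfolding cis_conv_exp by measurable
  note G = gaussian_fourier[OF assms(2), where 'a=plane]
  have I: "integrable (lborel \<Otimes>\<^sub>M lborel) ?F"
  proof (rule lborel_pair.Fubini_integrable[OF m])
    show "AE y in lborel. integrable lborel (\<lambda>\<xi>. ?F (y, \<xi>))"
      using G(1) by (auto intro!: AE_I2)
    have "(LINT \<xi>|lborel. norm (?F (y, \<xi>))) = p n y * (LINT \<xi>|lborel. ?e \<xi>)" for y
      using p_nonneg[of n y] by (simp add: norm_mult)
    then show "integrable lborel (\<lambda>y. LINT \<xi>|lborel. norm (?F (y, \<xi>)))"
      using tame_integrable[OF tame_p, of n] by simp
  qed
  have e1: "(LINT y|lborel. ?F (y, \<xi>)) = (a \<xi> ^ n * ?e \<xi>) *\<^sub>R cis (- (\<xi> \<bullet> x))" for \<xi>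
  proof -
    have "(LINT y|lborel. ?F (y, \<xi>)) = (LINT y|lborel. (p n y *\<^sub>R cis (\<xi> \<bullet> y)) * (cis (- (\<xi> \<bullet> x)) * ?e \<xi>))"
      by (intro Bochner_Integration.integral_cong) (auto simp: inner_diff_right cis_mult)
    also have "\<dots> = (LINT y|lborel. p n y *\<^sub>R cis (\<xi> \<bullet> y)) * (cis (- (\<xi> \<bullet> x)) * ?e \<xi>)"
      by (rule integral_mult_left_zero)
    also have "\<dots> = (a \<xi> ^ n) * (cis (- (\<xi> \<bullet> x)) * ?e \<xi>)"
      unfolding p_fourier[OF assms(1), of \<xi>] ..
    finally show ?thesis by (simp add: scaleR_conv_of_real mult_ac)
  qed
  have e2: "(LINT \<xi>|lborel. ?F (y, \<xi>)) = complex_of_real (p n y * (pi / s * exp (- (norm (y - x))\<^sup>2 / (4 * s))))" for y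
    using G(2)[of "y - x"] assms(2) by (simp add: scaleR_conv_of_real)
  have J: "integrable lborel (\<lambda>\<xi>. (a \<xi> ^ n * ?e \<xi>) *\<^sub>R cis (- (\<xi> \<bullet> x)))"
    using lborel_pair.integrable_snd[OF I] by (simp only: e1 split_conv e1[unfolded split_conv])
  show "integrable lborel (\<lambda>\<xi>. a \<xi> ^ n * cos (\<xi> \<bullet> x) * ?e \<xi>)"
    using integrable_Re[OF J] by (simp add: mult_ac)
  have "(LINT \<xi>|lborel. (LINT y|lborel. ?F (y, \<xi>))) = (LINT y|lborel. (LINT \<xi>|lborel. ?F (y, \<xi>)))"
    using I by (intro lborel_pair.Fubini_integral) simp
  then have "(LINT \<xi>|lborel. (a \<xi> ^ n * ?e \<xi>) *\<^sub>R cis (- (\<xi> \<bullet> x))) =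
      complex_of_real (LINT y|lborel. p n y * (pi / s * exp (- (norm (y - x))\<^sup>2 / (4 * s))))"
    unfolding e1 e2 by (simp only: integral_complex_of_real)
  from arg_cong[OF this, of Re]
  show "(LINT \<xi>|lborel. a \<xi> ^ n * cos (\<xi> \<bullet> x) * ?e \<xi>) =
      (LINT y|lborel. p n y * (pi / s * exp (- (norm (y - x))\<^sup>2 / (4 * s))))"
    by (subst (asm) integral_Re[OF J, symmetric]) (simp add: mult_ac)
qed

text \<open>Continuity makes the inversion formula valid at every point rather than almost
  everywhere.\<close>

lemma p_continuous: "continuous (at x) (p n)"
proof -
  have *: "continuous (at x) (conv J g)" if g: "tame g" for g
    unfolding continuous_at_sequentially comp_def
  proof safe
    fix X assume X: "X \<longlonglongrightarrow> x"
    note [measurable] = tame_measurable[OF g]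
    obtain C where C: "C > 0" "\<And>x. J x \<le> C" using J_bounded by blast
    show "(\<lambda>k. conv J g (X k)) \<longlonglongrightarrow> conv J g x"
      unfolding conv_def
    proof (rule integral_dominated_convergence)
      show "integrable lborel (\<lambda>y. C * g y)" using tame_integrable[OF g] by simp
      show "AE y in lborel. (\<lambda>k. J (X k - y) * g y) \<longlonglongrightarrow> J (x - y) * g y"
      proof (rule AE_I2)
        fix y
        have "(\<lambda>k. X k - y) \<longlonglongrightarrow> x - y" by (intro tendsto_intros X)
        then have "(\<lambda>k. J (X k - y)) \<longlonglongrightarrow> J (x - y)"
          using J_cont by (intro isCont_tendsto_compose[of "x - y" J]) (auto simp: continuous_on_eq_continuous_at)
        then show "(\<lambda>k. J (X k - y) * g y) \<longlonglongrightarrow> J (x - y) * g y" by (intro tendsto_intros)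
      qed
      show "AE y in lborel. norm (J (X k - y) * g y) \<le> C * g y" for k
        using J_nonneg tame_nonneg[OF g] C by (auto simp: abs_mult intro!: mult_right_mono)
    qed measurable
  qed
  show ?thesis
  proof (cases "n - 1")
    case 0
    then show ?thesis using J_cont by (auto simp: p_def continuous_on_eq_continuous_at)
  next
    case (Suc m)
    then show ?thesis by (auto simp: p_def intro!: * tame_funpow tame_J)
  qed
qed

text \<open>Plancherel's inequality: at the origin the regularised integral of \<open>a\<^sup>2\<close> is a Gaussian average
  of the bounded function \<open>p 2\<close>.\<close>

lemma a2_integrable: "integrable lborel (\<lambda>\<xi>. (a \<xi>)\<^sup>2)"
proof -
  obtain C where C: "C \<ge> 0" "\<And>x. p 2 x \<le> C" using tame_bounded[OF tame_p] by blast
  define e where "e k = (\<lambda>\<xi>::plane. (a \<xi>)\<^sup>2 * exp (- inverse (real (Suc k)) * (norm \<xi>)\<^sup>2))" for k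
  have [measurable]: "e k \<in> borel_measurable borel" for k unfolding e_def by measurable
  have bd: "(\<integral>\<^sup>+\<xi>. e k \<xi> \<partial>lborel) \<le> C * (4 * pi\<^sup>2)" for k
  proof -
    let ?s = "inverse (real (Suc k))"
    have s: "?s > 0" by simp
    have I: "integrable lborel (e k)" and eq: "(LINT \<xi>|lborel. e k \<xi>) = (LINT y|lborel. p 2 y * (pi / ?s * exp (- (norm y)\<^sup>2 / (4 * ?s))))"
      using p_gaussian_average[of 2 ?s 0] by (simp_all add: e_def)
    have G: "integrable lborel (\<lambda>y::plane. exp (- (norm y)\<^sup>2 / (4 * ?s)))"
      "(LINT y::plane|lborel. exp (- (norm y)\<^sup>2 / (4 * ?s))) = pi * (4 * ?s)"
      using integrable_gaussian[of "1 / (4 * ?s)", where 'a=plane] gaussian_integral(2)[of "1 / (4 * ?s)", where 'a=plane] s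
      by simp_all
    have "(LINT y|lborel. p 2 y * (pi / ?s * exp (- (norm y)\<^sup>2 / (4 * ?s)))) \<le>
        (LINT y|lborel. (C * (pi / ?s)) * exp (- (norm (y::plane))\<^sup>2 / (4 * ?s)))"
    proof (rule integral_mono_AE')
      show "integrable lborel (\<lambda>y::plane. (C * (pi / ?s)) * exp (- (norm y)\<^sup>2 / (4 * ?s)))"
        using G(1) by (rule integrable_mult_right)
      show "AE y in lborel. p 2 y * (pi / ?s * exp (- (norm y)\<^sup>2 / (4 * ?s))) \<le> C * (pi / ?s) * exp (- (norm y)\<^sup>2 / (4 * ?s))"
      proof (rule AE_I2)
        fix y :: plane
        show "p 2 y * (pi / ?s * exp (- (norm y)\<^sup>2 / (4 * ?s))) \<le> C * (pi / ?s) * exp (- (norm y)\<^sup>2 / (4 * ?s))"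
          unfolding mult.assoc by (intro mult_right_mono C) simp
      qed
      show "AE y in lborel. 0 \<le> C * (pi / ?s) * exp (- (norm (y::plane))\<^sup>2 / (4 * ?s))"
        using C(1) by (intro AE_I2) simp
    qed
    also have "\<dots> = C * (4 * pi\<^sup>2)"
      using G(2) s by (simp add: power2_eq_square)
    finally have "(LINT \<xi>|lborel. e k \<xi>) \<le> C * (4 * pi\<^sup>2)" using eq by simp
    then show ?thesis
      by (subst nn_integral_eq_integral[OF I]) (auto simp: e_def intro!: ennreal_leI)
  qed
  have lim: "(\<lambda>k. ennreal (e k \<xi>)) \<longlonglongrightarrow> ennreal ((a \<xi>)\<^sup>2)" for \<xi>
  proof -
    have "(\<lambda>k. e k \<xi>) \<longlonglongrightarrow> (a \<xi>)\<^sup>2 * exp (- 0 * (norm \<xi>)\<^sup>2)"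
      unfolding e_def by (intro tendsto_intros LIMSEQ_inverse_real_of_nat)
    then show ?thesis by (intro tendsto_ennrealI) simp
  qed
  have "(\<integral>\<^sup>+\<xi>. ennreal ((a \<xi>)\<^sup>2) \<partial>lborel) = (\<integral>\<^sup>+\<xi>. liminf (\<lambda>k. ennreal (e k \<xi>)) \<partial>lborel)"
    using lim by (intro nn_integral_cong) (metis lim_imp_Liminf sequentially_bot)
  also have "\<dots> \<le> liminf (\<lambda>k. \<integral>\<^sup>+\<xi>. ennreal (e k \<xi>) \<partial>lborel)"
    by (rule nn_integral_liminf) measurable
  also have "\<dots> \<le> limsup (\<lambda>k. \<integral>\<^sup>+\<xi>. ennreal (e k \<xi>) \<partial>lborel)"
    by (rule Liminf_le_Limsup) simp
  also have "\<dots> \<le> ennreal (C * (4 * pi\<^sup>2))"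
    by (rule Limsup_bounded) (auto intro!: bd always_eventually)
  finally have "(\<integral>\<^sup>+\<xi>. ennreal ((a \<xi>)\<^sup>2) \<partial>lborel) < \<infinity>"
    by (rule le_less_trans) simp
  then show ?thesis
    by (intro integrableI_nonneg) auto
qed

lemma a_power_le:
  assumes "n \<ge> 2" shows "\<bar>a \<xi> ^ n\<bar> \<le> (a \<xi>)\<^sup>2"
  using power_decreasing[OF assms, of "\<bar>a \<xi>\<bar>"] abs_a_le_1[of \<xi>] by (simp add: power_abs)

lemma a_power_integrable:
  assumes "n \<ge> 2" shows "integrable lborel (\<lambda>\<xi>. a \<xi> ^ n)"
  by (rule Bochner_Integration.integrable_bound[OF a2_integrable]) (use a_power_le[OF assms] in auto)

text \<open>The regularisation is removed by letting \<open>s\<close> tend to 0: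
  \<open>|a ^ n|\<close> dominates on the Fourier side, and on the other side the Gaussian averages
  converge to \<open>p n x\<close>. The restriction \<open>n \<ge> 2\<close> comes from
  \<open>a_power_integrable\<close>, which rests on the integrability of the square of
  \<open>a\<close>.\<close>

lemma p_inversion:
  assumes "n \<ge> 2"
  shows p_inversion_integrable: "integrable lborel (\<lambda>\<xi>. a \<xi> ^ n * cos (\<xi> \<bullet> x))"
    and "4 * pi\<^sup>2 * p n x = (LINT \<xi>|lborel. a \<xi> ^ n * cos (\<xi> \<bullet> x))"
proof -
  define s where "s k = inverse (real (Suc k))" for k
  have s: "s k > 0" "s \<longlonglongrightarrow> 0" for k
    using LIMSEQ_inverse_real_of_nat unfolding s_def[abs_def] by simp_all
  obtain C where C: "C \<ge> 0" "\<And>x. p n x \<le> C" using tame_bounded[OF tame_p] by blast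
  show "integrable lborel (\<lambda>\<xi>. a \<xi> ^ n * cos (\<xi> \<bullet> x))"
    by (rule Bochner_Integration.integrable_bound[OF a_power_integrable[OF assms]]) (auto simp: abs_mult mult_left_le)
  have "(\<lambda>k. LINT \<xi>|lborel. a \<xi> ^ n * cos (\<xi> \<bullet> x) * exp (- s k * (norm \<xi>)\<^sup>2)) \<longlonglongrightarrow> (LINT \<xi>|lborel. a \<xi> ^ n * cos (\<xi> \<bullet> x))"
  proof (rule integral_dominated_convergence[where w = "\<lambda>\<xi>. \<bar>a \<xi> ^ n\<bar>"])
    show "integrable lborel (\<lambda>\<xi>. \<bar>a \<xi> ^ n\<bar>)" using a_power_integrable[OF assms] by (rule integrable_abs)
    show "AE \<xi> in lborel. (\<lambda>k. a \<xi> ^ n * cos (\<xi> \<bullet> x) * exp (- s k * (norm \<xi>)\<^sup>2)) \<longlonglongrightarrow> a \<xi> ^ n * cos (\<xi> \<bullet> x)"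
    proof (rule AE_I2)
      fix \<xi> :: plane
      have "(\<lambda>k. a \<xi> ^ n * cos (\<xi> \<bullet> x) * exp (- s k * (norm \<xi>)\<^sup>2)) \<longlonglongrightarrow> a \<xi> ^ n * cos (\<xi> \<bullet> x) * exp (- 0 * (norm \<xi>)\<^sup>2)"
        by (intro tendsto_intros s)
      then show "(\<lambda>k. a \<xi> ^ n * cos (\<xi> \<bullet> x) * exp (- s k * (norm \<xi>)\<^sup>2)) \<longlonglongrightarrow> a \<xi> ^ n * cos (\<xi> \<bullet> x)" by simp
    qed
    show "AE \<xi> in lborel. norm (a \<xi> ^ n * cos (\<xi> \<bullet> x) * exp (- s k * (norm \<xi>)\<^sup>2)) \<le> \<bar>a \<xi> ^ n\<bar>" for k
      using s(1)[of k] by (intro AE_I2) (auto simp: abs_mult mult.assoc intro!: mult_left_le mult_le_one)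
  qed measurable
  moreover have "(\<lambda>k. LINT y|lborel. p n y * (pi / s k * exp (- (norm (y - x))\<^sup>2 / (4 * s k)))) \<longlonglongrightarrow> 4 * pi\<^sup>2 * p n x"
    using s C p_nonneg by (intro tendsto_gaussian_average p_continuous) (auto simp: abs_le_iff intro: order_trans[OF _ p_nonneg])
  ultimately show "4 * pi\<^sup>2 * p n x = (LINT \<xi>|lborel. a \<xi> ^ n * cos (\<xi> \<bullet> x))"
    using assms by (intro LIMSEQ_unique) (simp_all only: p_gaussian_average(2)[OF _ s(1)])
qed

end

subsection \<open>The Fourier transform of the kernel\<close>

text \<open>\<open>sin v / v\<close> is the transform of the uniform law on an interval; its
  distance from 1 is quadratic near 0 and bounded below away from 0. The constant 10 comes from
  \<open>1/6 - 8/120 = 1/10\<close> for \<open>v \<le> 2\<close>, and it also suffices beyond 2,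
  where \<open>2 * 9/10 \<ge> 1\<close>.\<close>

lemma abs_sin_le: "\<bar>sin v\<bar> \<le> \<bar>v\<bar> * (1 - min 1 (v\<^sup>2) / 10)" for v :: real
proof -
  have *: "\<bar>sin v\<bar> \<le> v * (1 - min 1 (v\<^sup>2) / 10)" if "v \<ge> 0" for v :: real
  proof (cases "v \<le> 2")
    case True
    have "sin v \<ge> 0" using True that pi_gt3 by (intro sin_ge_zero) auto
    have "\<bar>sin v - (\<Sum>m<5. sin_coeff m * v ^ m)\<bar> \<le> inverse (fact 5) * \<bar>v\<bar> ^ 5"
      by (rule Maclaurin_sin_bound)
    moreover have "(\<Sum>m<5. sin_coeff m * v ^ m) = v - v ^ 3 / 6"
      by (simp add: lessThan_nat_numeral lessThan_Suc sin_coeff_def fact_numeral)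
    ultimately have "\<bar>sin v - (v - v ^ 3 / 6)\<bar> \<le> v ^ 5 / 120"
      using that by (simp add: fact_numeral)
    then have "sin v \<le> v - v ^ 3 / 6 + v ^ 5 / 120" by linarith
    also have "v - v ^ 3 / 6 + v ^ 5 / 120 \<le> v * (1 - v\<^sup>2 / 10)"
    proof -
      have "v\<^sup>2 \<le> 2\<^sup>2" using True that by (intro power_mono) auto
      \<comment> \<open>The factor 8 is cruder than the available 4 but makes the Taylor
        coefficients add up to exactly \<open>1/10\<close>.\<close>
      then have "v ^ 3 * v\<^sup>2 \<le> v ^ 3 * 8" using that by (intro mult_left_mono) auto
      then show ?thesis by (simp add: algebra_simps eval_nat_numeral)
    qed
    also have "\<dots> \<le> v * (1 - min 1 (v\<^sup>2) / 10)" using that by (intro mult_left_mono) auto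
    finally show ?thesis using \<open>sin v \<ge> 0\<close> by simp
  next
    case False
    have "\<bar>sin v\<bar> \<le> 1" by simp
    also have "1 \<le> v * (1 - 1 / 10)" using False by simp
    also have "\<dots> \<le> v * (1 - min 1 (v\<^sup>2) / 10)" using that by (intro mult_left_mono) auto
    finally show ?thesis .
  qed
  show ?thesis using *[of v] *[of "- v"] by (cases "v \<ge> 0") auto
qed

lemma norm_interval_fourier_le:
  fixes u r :: real
  assumes "r > 0"
  shows integrable_interval_fourier: "integrable lborel (\<lambda>t. indicator {-r..r} t *\<^sub>R cis (u * t))"
    and "cmod (LINT t|lborel. indicator {-r..r} t *\<^sub>R cis (u * t)) \<le> 2 * r * (1 - min 1 ((r * u)\<^sup>2) / 10)"
proof -
  have c: "continuous_on S (\<lambda>t. cis (u * t))" for S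
    unfolding cis_conv_exp by (intro continuous_intros)
  show "integrable lborel (\<lambda>t. indicator {-r..r} t *\<^sub>R cis (u * t))"
    using borel_integrable_atLeastAtMost'[OF c, of "-r" r] by (simp add: set_integrable_def)
  show "cmod (LINT t|lborel. indicator {-r..r} t *\<^sub>R cis (u * t)) \<le> 2 * r * (1 - min 1 ((r * u)\<^sup>2) / 10)"
  proof (cases "u = 0")
    case True
    then show ?thesis using assms by simp
  next
    case False
    have "(LINT t|lborel. indicator {-r..r} t *\<^sub>R cis (u * t)) = cis (u * r) / (\<i> * u) - cis (u * (- r)) / (\<i> * u)"
    proof (rule integral_FTC_Icc)
      show "((\<lambda>t. cis (u * t) / (\<i> * complex_of_real u)) has_vector_derivative cis (u * x)) (at x within {- r..r})" for x
        unfolding cis_conv_exp using False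
        by (auto intro!: derivative_eq_intros has_vector_derivative_real_field simp: divide_simps complex_eq_iff)
    qed (use assms c in auto)
    also have "\<dots> = complex_of_real (2 * sin (r * u) / u)"
      using False by (simp add: complex_eq_iff Re_divide Im_divide field_simps power2_eq_square)
    finally have "cmod (LINT t|lborel. indicator {-r..r} t *\<^sub>R cis (u * t)) = 2 * \<bar>sin (r * u)\<bar> / \<bar>u\<bar>"
      by (simp add: norm_divide norm_mult)
    also have "\<dots> \<le> 2 * (\<bar>r * u\<bar> * (1 - min 1 ((r * u)\<^sup>2) / 10)) / \<bar>u\<bar>"
      by (intro divide_right_mono mult_left_mono abs_sin_le) auto
    also have "\<dots> = 2 * r * (1 - min 1 ((r * u)\<^sup>2) / 10)"
      using assms False by (simp add: abs_mult)
    finally show ?thesis .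
  qed
qed

text \<open>The transform of a cube factorises over the coordinates: the factor in direction
  \<open>b\<close> supplies the gap, the others are bounded by their value \<open>2 * r\<close> at
  frequency 0.\<close>

lemma cube_fourier:
  fixes \<xi> :: "'a::euclidean_space"
  assumes "r > 0"
  defines "Q \<equiv> cbox (- (r *\<^sub>R One)) (r *\<^sub>R One) :: 'a set"
  shows integrable_cube_fourier: "integrable lborel (\<lambda>x. indicator Q x *\<^sub>R cis (\<xi> \<bullet> x))"
    and norm_cube_fourier_le: "b \<in> Basis \<Longrightarrow>
      cmod (LINT x|lborel. indicator Q x *\<^sub>R cis (\<xi> \<bullet> x)) \<le> (2 * r) ^ DIM('a) * (1 - min 1 ((r * (\<xi> \<bullet> b))\<^sup>2) / 10)"
proof -
  let ?f = "\<lambda>b t. indicator {-r..r} t *\<^sub>R cis ((\<xi> \<bullet> b) * t)"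
  have eq: "indicator Q x *\<^sub>R cis (\<xi> \<bullet> x) = (\<Prod>b\<in>Basis. ?f b (x \<bullet> b))" for x :: 'a
  proof -
    have "(\<Prod>b\<in>Basis. indicator {-r..r} (x \<bullet> b) :: real) = indicator Q x"
      by (auto simp: Q_def indicator_def mem_box inner_sum_left_Basis prod_eq_1_iff)
    moreover have "(\<Prod>b\<in>Basis. cis ((\<xi> \<bullet> b) * (x \<bullet> b))) = cis (\<xi> \<bullet> x)"
      by (simp add: euclidean_inner[of \<xi> x] cis_conv_exp sum_distrib_left flip: exp_sum)
    ultimately show ?thesis by (simp add: scaleR_conv_of_real prod.distrib flip: of_real_prod)
  qed
  note F = norm_interval_fourier_le[OF assms(1)]
  show "integrable lborel (\<lambda>x. indicator Q x *\<^sub>R cis (\<xi> \<bullet> x))"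
    unfolding eq by (rule integrable_lborel_prod) (rule F(1))
  assume b: "b \<in> Basis"
  have le: "cmod (LINT t|lborel. ?f b t) \<le> 2 * r" for b
    by (rule order_trans[OF F(2)]) (use assms(1) in \<open>simp add: mult_le_cancel_left1\<close>)
  have "cmod (LINT x|lborel. indicator Q x *\<^sub>R cis (\<xi> \<bullet> x)) = (\<Prod>b\<in>Basis. cmod (LINT t|lborel. ?f b t))"
    unfolding eq by (subst integral_lborel_prod(2)) (use F in \<open>auto simp: prod_norm\<close>)
  also have "\<dots> = cmod (LINT t|lborel. ?f b t) * (\<Prod>b\<in>Basis - {b}. cmod (LINT t|lborel. ?f b t))"
    using b by (subst prod.remove[of _ b]) auto
  also have "\<dots> \<le> (2 * r * (1 - min 1 ((r * (\<xi> \<bullet> b))\<^sup>2) / 10)) * (\<Prod>b\<in>Basis - {b}. 2 * r)"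
    using assms(1) by (intro mult_mono F(2) prod_mono) (auto intro!: prod_nonneg le)
  also have "\<dots> = (2 * r) ^ DIM('a) * (1 - min 1 ((r * (\<xi> \<bullet> b))\<^sup>2) / 10)"
    using b by (simp add: card_Diff_singleton power_eq_if)
  finally show "cmod (LINT x|lborel. indicator Q x *\<^sub>R cis (\<xi> \<bullet> x)) \<le> (2 * r) ^ DIM('a) * (1 - min 1 ((r * (\<xi> \<bullet> b))\<^sup>2) / 10)" .
qed

lemma sum_Basis_plane: "(\<Sum>b\<in>Basis. f b) = f (axis 1 1) + f (axis 2 (1::real))" for f :: "plane \<Rightarrow> 'b::comm_monoid_add"
  by (simp add: Basis_vec_def UNIV_2 axis_eq_axis add.commute)

lemma prod_Basis_plane: "(\<Prod>b\<in>Basis. f b) = f (axis 1 1) * f (axis 2 (1::real))" for f :: "plane \<Rightarrow> 'b::comm_monoid_mult"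
  by (simp add: Basis_vec_def UNIV_2 axis_eq_axis mult.commute)

lemma inner_plane: "x \<bullet> y = x $ 1 * y $ 1 + x $ 2 * y $ 2" for x y :: plane
  by (simp add: inner_vec_def sum_2)

lemma norm2_plane: "(norm x)\<^sup>2 = (x $ 1)\<^sup>2 + (x $ 2)\<^sup>2" for x :: plane
  unfolding power2_norm_eq_inner by (simp add: inner_plane power2_eq_square)

lemma square_volume:
  fixes r :: real
  assumes "r \<ge> 0"
  defines "Q \<equiv> cbox (- (r *\<^sub>R One)) (r *\<^sub>R One) :: plane set"
  shows integrable_square: "integrable lborel (\<lambda>x. indicator Q x :: real)"
    and "(LINT x|lborel. indicator Q x :: real) = (2 * r)\<^sup>2"
proof -
  show "integrable lborel (\<lambda>x. indicator Q x :: real)"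
    unfolding Q_def by (rule integrable_real_indicator[OF _ emeasure_lborel_cbox_finite]) simp
  have "(LINT x|lborel. indicator Q x :: real) = measure lborel Q"
    by (simp add: Q_def)
  also have "\<dots> = (\<Prod>b\<in>Basis. (r *\<^sub>R One - - (r *\<^sub>R One)) \<bullet> (b :: plane))"
    using assms(1) unfolding Q_def by (subst measure_lborel_cbox_eq) (auto simp: inner_sum_left_Basis)
  also have "\<dots> = (\<Prod>b\<in>(Basis :: plane set). 2 * r)"
    by (intro prod.cong refl) (simp only: inner_diff_left inner_minus_left, simp add: inner_sum_left_Basis)
  also have "\<dots> = (2 * r)\<^sup>2" by simp
  finally show "(LINT x|lborel. indicator Q x :: real) = (2 * r)\<^sup>2" .
qed

text \<open>The quarter turn. Invariance of \<open>J\<close> under this single rotation already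
  makes its second moments isotropic.\<close>

definition rot :: "plane \<Rightarrow> plane" where "rot x = (\<chi> i. if i = 1 then - (x $ 2) else x $ 1)"

lemma rot_nth[simp]: "rot x $ 1 = - (x $ 2)" "rot x $ 2 = x $ 1"
  by (simp_all add: rot_def)

lemma norm_rot[simp]: "norm (rot x) = norm x"
proof -
  have "(norm (rot x))\<^sup>2 = (norm x)\<^sup>2" by (simp add: norm2_plane)
  then show ?thesis by simp
qed

lemma rot_measurable[measurable]: "rot \<in> borel_measurable borel"
  unfolding rot_def[abs_def] by (intro borel_measurable_continuous_onI continuous_on_vec_lambda)
   (rename_tac i, case_tac "i = 1", auto intro!: continuous_intros)

text \<open>A quarter turn maps boxes to boxes, and Lebesgue measure is determined by its values on
  boxes.\<close>

lemma distr_lborel_rot: "distr lborel borel rot = lborel"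
proof (rule lborel_eqI[symmetric])
  fix l u :: plane
  assume le: "\<And>b. b \<in> Basis \<Longrightarrow> l \<bullet> b \<le> u \<bullet> b"
  then have le': "l $ 1 \<le> u $ 1" "l $ 2 \<le> u $ 2"
    by (auto simp: Basis_vec_def inner_axis dest!: spec) (metis axis_in_Basis_iff inner_axis inner_real_def mult.right_neutral insert_iff Basis_real_def)+
  let ?l = "(\<chi> i. if i = 1 then l $ 2 else - (u $ 1)) :: plane"
  let ?u = "(\<chi> i. if i = 1 then u $ 2 else - (l $ 1)) :: plane"
  have "rot -` box l u \<inter> space lborel = box ?l ?u"
    by (auto simp: mem_box_cart forall_2)
  then have "emeasure (distr lborel borel rot) (box l u) = emeasure lborel (box ?l ?u)"
    by (subst emeasure_distr) auto
  also have "\<dots> = (\<Prod>b\<in>Basis. (?u - ?l) \<bullet> b)"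
    using le' by (intro emeasure_lborel_box) (auto simp: Basis_vec_def inner_axis split: if_splits)
  also have "\<dots> = ennreal (\<Prod>b\<in>Basis. (u - l) \<bullet> b)"
    by (simp add: prod_Basis_plane inner_axis algebra_simps)
  finally show "emeasure (distr lborel borel rot) (box l u) = (\<Prod>b\<in>Basis. (u - l) \<bullet> b)" .
qed simp

lemma exp_minus_taylor: fixes y :: real assumes "y \<ge> 0" shows "\<bar>exp (- y) - 1 + y\<bar> \<le> y\<^sup>2"
proof -
  have "exp (- y) \<ge> 1 - y" using exp_ge_add_one_self[of "- y"] by simp
  moreover have "exp (- y) \<le> 1 / (1 + y)"
    using exp_ge_add_one_self[of y] assms by (simp add: exp_minus field_simps)
  moreover have "1 / (1 + y) \<le> 1 - y + y\<^sup>2"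
    using assms by (simp add: field_simps power2_eq_square)
  ultimately show ?thesis by simp
qed

lemma cos_taylor: "\<bar>cos y - 1 + y\<^sup>2 / 2\<bar> \<le> \<bar>y\<bar> ^ 3 / 6" for y :: real
proof -
  have "cmod (iexp y - (\<Sum>k\<le>2. (\<i> * y) ^ k / fact k)) \<le> \<bar>y\<bar> ^ (Suc 2) / fact (Suc 2)"
    by (rule iexp_approx1)
  then have "cmod (cis y - (1 + \<i> * y - complex_of_real (y\<^sup>2 / 2))) \<le> \<bar>y\<bar> ^ 3 / 6"
    by (simp add: eval_nat_numeral cis_conv_exp fact_numeral algebra_simps power2_eq_square)
  then have "\<bar>Re (cis y - (1 + \<i> * y - complex_of_real (y\<^sup>2 / 2)))\<bar> \<le> \<bar>y\<bar> ^ 3 / 6"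
    using abs_Re_le_cmod order_trans by blast
  moreover have "Re (cis y - (1 + \<i> * y - complex_of_real (y\<^sup>2 / 2))) = cos y - 1 + y\<^sup>2 / 2"
    by simp
  ultimately show ?thesis by metis
qed

context radial_kernel begin

text \<open>\<open>J\<close> exceeds a positive multiple \<kappa> of the indicator of a cube, and
  \<open>1 - \<sigma> * cos\<close> is nonnegative for both signs \<sigma>. Hence
  \<open>1 - |a|\<close> is at least \<kappa> times the corresponding gap for the cube, which is
  explicit. The absolute value matters: powers of \<open>a\<close> would also fail to decay where
  \<open>a\<close> is close to -1.\<close>

lemma a_le:
  obtains c where "c > 0" "\<And>\<xi>. \<bar>a \<xi>\<bar> \<le> 1 - c * min 1 ((norm \<xi>)\<^sup>2)"
proof -
  \<comment> \<open>The half-diagonal of the cube of half-side \<open>d / 2\<close> is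
    \<open>d / sqrt 2 < d\<close>, so \<open>J\<close> is positive on the whole cube.\<close>
  define r where "r = d / 2"
  have r: "r > 0" using d_pos by (simp add: r_def)
  define Q where "Q = (cbox (- (r *\<^sub>R One)) (r *\<^sub>R One) :: plane set)"
  have Qd: "norm x < d" if "x \<in> Q" for x
  proof -
    have "\<bar>x $ 1\<bar> \<le> r" "\<bar>x $ 2\<bar> \<le> r"
      using that by (auto simp: Q_def mem_box_cart forall_2 sum_Basis_plane axis_def)
    then have "(x $ 1)\<^sup>2 \<le> r\<^sup>2" "(x $ 2)\<^sup>2 \<le> r\<^sup>2"
      using r by (simp_all add: abs_le_square_iff[symmetric])
    then have "(norm x)\<^sup>2 \<le> 2 * r\<^sup>2" by (simp add: norm2_plane)
    also have "\<dots> < d\<^sup>2" using d_pos by (simp add: r_def power_divide)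
    finally show ?thesis using d_pos by (simp add: power2_less_imp_less)
  qed
  have "0 \<in> Q" using r by (auto simp: Q_def mem_box)
  moreover have "compact Q" "continuous_on Q J"
    using J_cont by (auto simp: Q_def intro: continuous_on_subset)
  ultimately obtain x0 where x0: "x0 \<in> Q" "\<And>x. x \<in> Q \<Longrightarrow> J x0 \<le> J x"
    using continuous_attains_inf[of Q J] by blast
  define \<kappa> where "\<kappa> = J x0"
  have \<kappa>: "\<kappa> > 0" using J_pos Qd x0 by (simp add: \<kappa>_def)
  have JQ: "\<kappa> * indicator Q x \<le> J x" for x
    using x0 J_nonneg by (auto simp: indicator_def \<kappa>_def)
  note F = integrable_cube_fourier[OF r, where 'a=plane, folded Q_def] norm_cube_fourier_le[OF r, where 'a=plane, folded Q_def]
  note vol = square_volume[OF less_imp_le[OF r], folded Q_def]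
  define c where "c = \<kappa> * (2 * r)\<^sup>2 * (1 / 10) * min 1 (r\<^sup>2 / 2)"
  have c: "c > 0" using \<kappa> r by (simp add: c_def)
  have "\<bar>a \<xi>\<bar> \<le> 1 - c * min 1 ((norm \<xi>)\<^sup>2)" for \<xi>
  proof -
    \<comment> \<open>The larger of the two coordinates carries at least half of the squared
      norm.\<close>
    obtain b :: plane where b: "b \<in> Basis" "(norm \<xi>)\<^sup>2 / 2 \<le> (\<xi> \<bullet> b)\<^sup>2"
    proof (cases "\<bar>\<xi> $ 1\<bar> \<le> \<bar>\<xi> $ 2\<bar>")
      case True
      then have "(\<xi> $ 1)\<^sup>2 \<le> (\<xi> $ 2)\<^sup>2" by (simp add: abs_le_square_iff)
      then show ?thesis using that[of "axis 2 1"] by (simp add: norm2_plane inner_axis)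
    next
      case False
      then have "(\<xi> $ 2)\<^sup>2 \<le> (\<xi> $ 1)\<^sup>2" by (simp add: abs_le_square_iff[symmetric])
      then show ?thesis using that[of "axis 1 1"] by (simp add: norm2_plane inner_axis)
    qed
    define m where "m = min 1 ((r * (\<xi> \<bullet> b))\<^sup>2)"
    have Z: "cmod (LINT x|lborel. indicator Q x *\<^sub>R cis (\<xi> \<bullet> x)) \<le> (2 * r)\<^sup>2 * (1 - m / 10)"
      using F(2)[OF b(1), of \<xi>] by (simp add: m_def)
    have I: "integrable lborel (\<lambda>x. indicator Q x * cos (\<xi> \<bullet> x))"
      using integrable_Re[OF F(1)[of \<xi>]] by simp
    have "\<bar>LINT x|lborel. indicator Q x * cos (\<xi> \<bullet> x)\<bar> \<le> (2 * r)\<^sup>2 * (1 - m / 10)"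
      using order_trans[OF abs_Re_le_cmod Z] by (subst (asm) integral_Re[OF F(1), symmetric]) simp
    \<comment> \<open>Integrating \<open>1 - \<sigma> * cos \<ge> 0\<close> against \<open>J\<close>
      and against its minorant on the cube treats \<open>a\<close> and \<open>- a\<close>
      together.\<close>
    moreover have main: "\<sigma> * a \<xi> \<le> 1 - \<kappa> * ((2 * r)\<^sup>2 - \<sigma> * (LINT x|lborel. indicator Q x * cos (\<xi> \<bullet> x)))"
      if \<sigma>: "\<bar>\<sigma>\<bar> = 1" for \<sigma> :: real
    proof -
      have iJ: "integrable lborel (\<lambda>x. J x * cos (\<xi> \<bullet> x))"
        by (rule J_moment_integrable[where C=1]) auto
      have "\<kappa> * ((2 * r)\<^sup>2 - \<sigma> * (LINT x|lborel. indicator Q x * cos (\<xi> \<bullet> x))) =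
        (LINT x|lborel. \<kappa> * (indicator Q x - \<sigma> * (indicator Q x * cos (\<xi> \<bullet> x))))"
        using I vol by simp
      also have "\<dots> \<le> (LINT x|lborel. J x - \<sigma> * (J x * cos (\<xi> \<bullet> x)))"
      proof (rule integral_mono)
        fix x
        have "\<bar>\<sigma> * cos (\<xi> \<bullet> x)\<bar> \<le> 1" using \<sigma> by (simp add: abs_mult)
        then have "0 \<le> 1 - \<sigma> * cos (\<xi> \<bullet> x)" by simp
        from mult_right_mono[OF JQ[of x] this]
        show "\<kappa> * (indicator Q x - \<sigma> * (indicator Q x * cos (\<xi> \<bullet> x))) \<le> J x - \<sigma> * (J x * cos (\<xi> \<bullet> x))"
          by (simp add: algebra_simps)
      qed (use I vol iJ J_integrable in auto)
      also have "\<dots> = 1 - \<sigma> * a \<xi>" using iJ J_integrable by (simp add: J_int a_def)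
      finally show ?thesis by simp
    qed
    ultimately have "\<bar>a \<xi>\<bar> \<le> 1 - \<kappa> * ((2 * r)\<^sup>2 - (2 * r)\<^sup>2 * (1 - m / 10))"
    proof -
      assume A: "\<bar>LINT x|lborel. indicator Q x * cos (\<xi> \<bullet> x)\<bar> \<le> (2 * r)\<^sup>2 * (1 - m / 10)" (is "\<bar>?I\<bar> \<le> ?B")
      have "\<kappa> * ((2 * r)\<^sup>2 - ?B) \<le> \<kappa> * ((2 * r)\<^sup>2 - ?I)" "\<kappa> * ((2 * r)\<^sup>2 - ?B) \<le> \<kappa> * ((2 * r)\<^sup>2 + ?I)"
        using A \<kappa> by (intro mult_left_mono; simp)+
      then show ?thesis using main[of 1] main[of "-1"] by (simp add: abs_le_iff)
    qed
    also have "\<dots> = 1 - \<kappa> * (2 * r)\<^sup>2 * (1 / 10) * m" by (simp add: algebra_simps)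
    also have "\<dots> \<le> 1 - c * min 1 ((norm \<xi>)\<^sup>2)"
    proof -
      have "min 1 (r\<^sup>2 / 2) * min 1 ((norm \<xi>)\<^sup>2) \<le> 1 * 1" by (intro mult_mono) auto
      moreover have "min 1 (r\<^sup>2 / 2) * min 1 ((norm \<xi>)\<^sup>2) \<le> r\<^sup>2 / 2 * (norm \<xi>)\<^sup>2" by (intro mult_mono) auto
      moreover have "r\<^sup>2 / 2 * (norm \<xi>)\<^sup>2 \<le> (r * (\<xi> \<bullet> b))\<^sup>2"
        using mult_left_mono[OF b(2), of "r\<^sup>2"] by (simp add: power_mult_distrib)
      ultimately have "min 1 (r\<^sup>2 / 2) * min 1 ((norm \<xi>)\<^sup>2) \<le> m" by (simp add: m_def)
      then have "\<kappa> * (2 * r)\<^sup>2 * (1 / 10) * (min 1 (r\<^sup>2 / 2) * min 1 ((norm \<xi>)\<^sup>2)) \<le> \<kappa> * (2 * r)\<^sup>2 * (1 / 10) * m"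
        using \<kappa> by (intro mult_left_mono) auto
      then show ?thesis by (simp add: c_def mult_ac)
    qed
    finally show ?thesis .
  qed
  then show ?thesis using that c by blast
qed

lemma J_rot: "J (rot x) = J x"
  using J_radial[unfolded radially_symmetric_def, rule_format, of "rot x" x] by simp

text \<open>The quarter turn equates the two diagonal moments and changes the sign of the mixed one.
  So the mixed moment is 0 and each diagonal one is half of \<open>4 * q\<close>.\<close>

lemma J_second_moment: "(LINT x|lborel. J x * (\<xi> \<bullet> x)\<^sup>2) = 2 * q * (norm \<xi>)\<^sup>2"
proof -
  have rot: "(LINT x|lborel. J x * w x) = (LINT x|lborel. J x * w (rot x))"
    if [measurable]: "w \<in> borel_measurable borel" for w :: "plane \<Rightarrow> real"
    by (subst distr_lborel_rot[symmetric], subst integral_distr) (auto simp: J_rot)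
  have b: "\<bar>x $ i\<bar> \<le> d" if "norm x \<le> d" for x :: plane and i
    using component_le_norm_cart[of x i] that by linarith
  have I: "integrable lborel (\<lambda>x. J x * (x $ i * x $ j))" for i j
    by (rule J_moment_integrable[where C = "d * d"]) (use b d_pos in \<open>auto simp: abs_mult intro!: mult_mono\<close>)
  let ?A = "\<lambda>i j. LINT x|lborel. J x * (x $ i * x $ j)"
  have "?A 1 1 = ?A 2 2" using rot[of "\<lambda>x. x $ 1 * x $ 1"] by simp
  moreover have "?A 1 2 = 0" using rot[of "\<lambda>x. x $ 1 * x $ 2"] by (simp add: mult.commute)
  moreover have "?A 1 1 + ?A 2 2 = 4 * q"
    using q_eq I[of 1 1] I[of 2 2] unfolding norm2_plane by (simp add: distrib_left power2_eq_square)
  moreover have "(LINT x|lborel. J x * (\<xi> \<bullet> x)\<^sup>2) =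
     (LINT x|lborel. (\<xi> $ 1)\<^sup>2 * (J x * (x $ 1 * x $ 1)) + (\<xi> $ 2)\<^sup>2 * (J x * (x $ 2 * x $ 2)) +
       (2 * \<xi> $ 1 * \<xi> $ 2) * (J x * (x $ 1 * x $ 2)))"
    by (intro Bochner_Integration.integral_cong) (auto simp: inner_plane power2_eq_square algebra_simps)
  moreover have "\<dots> = (\<xi> $ 1)\<^sup>2 * ?A 1 1 + (\<xi> $ 2)\<^sup>2 * ?A 2 2 + (2 * \<xi> $ 1 * \<xi> $ 2) * ?A 1 2"
    using I by simp
  ultimately show ?thesis by (simp add: norm2_plane algebra_simps)
qed

text \<open>Both functions agree with \<open>1 - q * |xi|^2\<close> to third order:
  \<open>d ^ 3 / 6\<close> is the cubic remainder of the cosine on the support of \<open>J\<close>,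
  and the square of \<open>q\<close> is the remainder of the exponential, of order
  \<open>|xi|^4 \<le> |xi|^3\<close> in the unit ball.\<close>

lemma a_near_gaussian:
  obtains T where "T > 0" "\<And>\<xi>. norm \<xi> \<le> 1 \<Longrightarrow> \<bar>a \<xi> - exp (- q * (norm \<xi>)\<^sup>2)\<bar> \<le> T * norm \<xi> ^ 3"
proof
  show "d ^ 3 / 6 + q\<^sup>2 > 0" using d_pos by (simp add: add_pos_nonneg)
  fix \<xi> :: plane assume \<xi>: "norm \<xi> \<le> 1"
  have sc: "\<bar>\<xi> \<bullet> x\<bar> \<le> norm \<xi> * d" if "norm x \<le> d" for x
    using Cauchy_Schwarz_ineq2[of \<xi> x] mult_left_mono[OF that, of "norm \<xi>"] by simp
  have iC: "integrable lborel (\<lambda>x. J x * cos (\<xi> \<bullet> x))"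
    by (rule J_moment_integrable[where C=1]) auto
  have i2: "integrable lborel (\<lambda>x. J x * (\<xi> \<bullet> x)\<^sup>2)"
    by (rule J_moment_integrable[where C="(norm \<xi> * d)\<^sup>2"]) (use sc d_pos in \<open>auto simp: abs_le_square_iff[symmetric] abs_mult\<close>)
  have "a \<xi> - 1 + q * (norm \<xi>)\<^sup>2 = (LINT x|lborel. J x * (cos (\<xi> \<bullet> x) - 1 + (\<xi> \<bullet> x)\<^sup>2 / 2))"
    using iC i2 J_integrable by (simp add: algebra_simps a_def J_int J_second_moment)
  also have "\<bar>\<dots>\<bar> \<le> (LINT x|lborel. (norm \<xi> * d) ^ 3 / 6 * J x)"
  proof (rule integral_abs_bound_integral)
    show "integrable lborel (\<lambda>x. J x * (cos (\<xi> \<bullet> x) - 1 + (\<xi> \<bullet> x)\<^sup>2 / 2))"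
      using iC i2 J_integrable by (simp add: distrib_left right_diff_distrib)
    show "\<bar>J x * (cos (\<xi> \<bullet> x) - 1 + (\<xi> \<bullet> x)\<^sup>2 / 2)\<bar> \<le> (norm \<xi> * d) ^ 3 / 6 * J x" for x
    proof (cases "norm x \<le> d")
      case True
      have "\<bar>cos (\<xi> \<bullet> x) - 1 + (\<xi> \<bullet> x)\<^sup>2 / 2\<bar> \<le> (norm \<xi> * d) ^ 3 / 6"
        using cos_taylor[of "\<xi> \<bullet> x"] power_mono[OF sc[OF True], of 3] by simp
      from mult_right_mono[OF this J_nonneg[of x]] show ?thesis
        using J_nonneg[of x] by (simp add: abs_mult mult.commute)
    qed (use J_zero[of x] in auto)
  qed (use J_integrable in simp)
  also have "\<dots> = d ^ 3 / 6 * norm \<xi> ^ 3" by (simp add: J_int power_mult_distrib)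
  finally have A: "\<bar>a \<xi> - 1 + q * (norm \<xi>)\<^sup>2\<bar> \<le> d ^ 3 / 6 * norm \<xi> ^ 3" .
  have "\<bar>exp (- (q * (norm \<xi>)\<^sup>2)) - 1 + q * (norm \<xi>)\<^sup>2\<bar> \<le> (q * (norm \<xi>)\<^sup>2)\<^sup>2"
    using q_pos by (intro exp_minus_taylor) auto
  also have "\<dots> = q\<^sup>2 * norm \<xi> ^ 4" by (simp add: power_mult_distrib)
  also have "\<dots> \<le> q\<^sup>2 * norm \<xi> ^ 3"
    using \<xi> by (intro mult_left_mono power_decreasing) auto
  finally show "\<bar>a \<xi> - exp (- q * (norm \<xi>)\<^sup>2)\<bar> \<le> (d ^ 3 / 6 + q\<^sup>2) * norm \<xi> ^ 3"
    using A unfolding distrib_right mult_minus_left by linarith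
qed

end

subsection \<open>Estimates for the convolution powers\<close>

text \<open>With \<open>t = sqrt N * y\<close>, half of the exponent is given up to absorb the
  polynomial factor: a power \<open>y ^ k\<close> under a Gaussian of width
  \<open>1 / sqrt N\<close> is worth \<open>N powr (- k / 2)\<close>.\<close>

lemma power_exp_bound:
  fixes c :: real
  assumes "c > 0"
  obtains C where "C > 0" "\<And>N y. N > 0 \<Longrightarrow> y \<ge> 0 \<Longrightarrow> y * exp (- c * N * y\<^sup>2) \<le> C / sqrt N * exp (- (c / 2) * N * y\<^sup>2)"
    "\<And>N y. N > 0 \<Longrightarrow> y \<ge> 0 \<Longrightarrow> y ^ 3 * exp (- c * N * y\<^sup>2) \<le> C / (N * sqrt N) * exp (- (c / 2) * N * y\<^sup>2)"
proof -
  \<comment> \<open>Chosen so that \<open>1 + t^2 \<le> K * (1 + c / 4 * t^2) \<le> K * exp (c / 4 *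
    t^2)\<close>; squaring this covers both \<open>t\<close> and \<open>t ^ 3\<close>, since each is
    at most \<open>(1 + t^2)^2\<close>.\<close>
  define K where "K = 1 + 4 / c"
  have K: "K \<ge> 1" using assms by (simp add: K_def)
  have sq: "(1 + t\<^sup>2)\<^sup>2 \<le> K\<^sup>2 * exp (c / 2 * t\<^sup>2)" for t :: real
  proof -
    have "1 + t\<^sup>2 \<le> K * (1 + c / 4 * t\<^sup>2)"
      using assms by (simp add: K_def field_simps)
    also have "\<dots> \<le> K * exp (c / 4 * t\<^sup>2)"
      using K exp_ge_add_one_self[of "c / 4 * t\<^sup>2"] by (intro mult_left_mono) auto
    finally have "(1 + t\<^sup>2)\<^sup>2 \<le> (K * exp (c / 4 * t\<^sup>2))\<^sup>2" by (intro power_mono) auto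
    then show ?thesis by (simp add: power_mult_distrib exp_double[symmetric])
  qed
  have t1: "t \<le> (1 + t\<^sup>2)\<^sup>2" if "t \<ge> 0" for t :: real
  proof -
    have "0 \<le> (t - 1)\<^sup>2" by simp
    then have "2 * t \<le> 1 + t\<^sup>2" by (simp add: power2_eq_square algebra_simps)
    moreover have "1 + t\<^sup>2 \<le> (1 + t\<^sup>2)\<^sup>2" by (rule self_le_power) auto
    ultimately show ?thesis using that by linarith
  qed
  have t3: "t ^ 3 \<le> (1 + t\<^sup>2)\<^sup>2" if "t \<ge> 0" for t :: real
  proof -
    have "0 \<le> (t - 1)\<^sup>2" by simp
    then have "t \<le> 1 + t\<^sup>2" using that by (simp add: power2_eq_square algebra_simps)
    then have "t\<^sup>2 * t \<le> (1 + t\<^sup>2) * (1 + t\<^sup>2)" using that by (intro mult_mono) auto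
    then show ?thesis by (simp add: power2_eq_square power3_eq_cube)
  qed
  have e: "exp (- c * N * y\<^sup>2) = exp (- (c / 2 * (sqrt N * y)\<^sup>2)) * exp (- (c / 2) * N * y\<^sup>2)" if "N > 0" for N y :: real
    using that by (simp add: power_mult_distrib flip: exp_add)
  have b: "s * exp (- (c / 2 * t\<^sup>2)) \<le> K\<^sup>2" if "s \<le> (1 + t\<^sup>2)\<^sup>2" for s t :: real
    using order_trans[OF that sq[of t]] by (simp add: exp_minus field_simps)
  show ?thesis
  proof (rule that[of "K\<^sup>2"])
    fix N y :: real assume N: "N > 0" and y: "y \<ge> 0"
    have "sqrt N * y * exp (- (c / 2 * (sqrt N * y)\<^sup>2)) \<le> K\<^sup>2"
      using N y by (intro b t1) auto
    then have "y * exp (- (c / 2 * (sqrt N * y)\<^sup>2)) \<le> K\<^sup>2 / sqrt N"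
      using N by (simp add: field_simps)
    then show "y * exp (- c * N * y\<^sup>2) \<le> K\<^sup>2 / sqrt N * exp (- (c / 2) * N * y\<^sup>2)"
      unfolding e[OF N] mult.assoc[symmetric] by (intro mult_right_mono) auto
    have "(sqrt N * y) ^ 3 * exp (- (c / 2 * (sqrt N * y)\<^sup>2)) \<le> K\<^sup>2"
      using N y by (intro b t3) auto
    moreover have "(sqrt N * y) ^ 3 = N * sqrt N * y ^ 3"
      using N by (simp add: power_mult_distrib power3_eq_cube)
    ultimately have "y ^ 3 * exp (- (c / 2 * (sqrt N * y)\<^sup>2)) * (N * sqrt N) \<le> K\<^sup>2"
      by (simp only: mult_ac)
    then have "y ^ 3 * exp (- (c / 2 * (sqrt N * y)\<^sup>2)) \<le> K\<^sup>2 / (N * sqrt N)"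
      using N by (subst pos_le_divide_eq) auto
    then show "y ^ 3 * exp (- c * N * y\<^sup>2) \<le> K\<^sup>2 / (N * sqrt N) * exp (- (c / 2) * N * y\<^sup>2)"
      unfolding e[OF N] mult.assoc[symmetric] by (intro mult_right_mono) auto
  qed (use K in auto)
qed

text \<open>For high frequencies, where \<open>|a| \<le> 1 - c\<close>. The exponent is
  \<open>n - 2\<close> because two factors of \<open>a\<close> are reserved for
  integrability.\<close>

lemma geometric_le_inverse_square:
  fixes c :: real
  assumes "0 < c" "c \<le> 1"
  obtains K where "K > 0" "\<And>n::nat. n \<ge> 2 \<Longrightarrow> (1 - c) ^ (n - 2) \<le> K / (real n)\<^sup>2"
proof (rule that[of "(2 + 2 / c)\<^sup>2"])
  have "2 + 2 / c > 0" using assms by (simp add: add_pos_pos)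
  then show "(2 + 2 / c)\<^sup>2 > 0" by simp
  fix n :: nat assume n: "n \<ge> 2"
  define m where "m = n - 2"
  have nm: "real n = real m + 2" using n by (simp add: m_def)
  have "(1 - c) ^ m \<le> exp (- c) ^ m"
    using exp_ge_add_one_self[of "- c"] assms by (intro power_mono) auto
  also have "\<dots> = 1 / (exp (c * m / 2))\<^sup>2"
    by (simp add: exp_minus power2_eq_square field_simps flip: exp_add exp_of_nat_mult)
  also have "\<dots> \<le> (2 + 2 / c)\<^sup>2 / (real n)\<^sup>2"
  proof -
    have "real n \<le> (2 + 2 / c) * (1 + c * m / 2)"
      using assms unfolding nm by (simp add: field_simps)
    also have "\<dots> \<le> (2 + 2 / c) * exp (c * m / 2)"
      using assms exp_ge_add_one_self[of "c * m / 2"] by (intro mult_left_mono) auto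
    finally have "(real n)\<^sup>2 \<le> ((2 + 2 / c) * exp (c * m / 2))\<^sup>2" by (intro power_mono) auto
    then have "(real n)\<^sup>2 \<le> (2 + 2 / c)\<^sup>2 * (exp (c * m / 2))\<^sup>2" by (simp only: power_mult_distrib)
    moreover have "1 / X \<le> Y / Z" if "Z > 0" "X > 0" "Z \<le> Y * X" for X Y Z :: real
      using that by (simp add: field_simps)
    ultimately show ?thesis using n by simp
  qed
  finally show "(1 - c) ^ (n - 2) \<le> (2 + 2 / c)\<^sup>2 / (real n)\<^sup>2" by (simp add: m_def)
qed

lemma power_diff_le:
  fixes x y r :: real
  assumes "\<bar>x\<bar> \<le> r" "\<bar>y\<bar> \<le> r"
  shows "\<bar>x ^ n - y ^ n\<bar> \<le> n * r ^ (n - 1) * \<bar>x - y\<bar>"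
proof (induction n)
  case (Suc n)
  have r: "r \<ge> 0" using assms by linarith
  have "x ^ Suc n - y ^ Suc n = x * (x ^ n - y ^ n) + (x - y) * y ^ n" by (simp add: algebra_simps)
  then have "\<bar>x ^ Suc n - y ^ Suc n\<bar> \<le> \<bar>x\<bar> * \<bar>x ^ n - y ^ n\<bar> + \<bar>x - y\<bar> * \<bar>y\<bar> ^ n"
    by (metis abs_mult abs_triangle_ineq power_abs)
  also have "\<dots> \<le> r * (n * r ^ (n - 1) * \<bar>x - y\<bar>) + \<bar>x - y\<bar> * r ^ n"
    using assms r Suc by (intro add_mono mult_mono power_mono) auto
  also have "\<dots> = Suc n * r ^ (Suc n - 1) * \<bar>x - y\<bar>"
    by (cases n) (auto simp: algebra_simps)
  finally show ?case .
qed simp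

lemma abs_cos_diff_le: "\<bar>cos s - cos t\<bar> \<le> \<bar>s - t\<bar>" for s t :: real
proof -
  have "\<bar>cos s - cos t\<bar> = 2 * \<bar>sin ((s + t) / 2)\<bar> * \<bar>sin ((t - s) / 2)\<bar>"
    by (simp add: cos_diff_cos abs_mult)
  also have "\<dots> \<le> 2 * 1 * \<bar>(t - s) / 2\<bar>"
    by (intro mult_mono abs_sin_x_le_abs_x) auto
  finally show ?thesis by simp
qed

lemma gaussian_plane:
  assumes "s > 0"
  shows "integrable lborel (\<lambda>\<xi>::plane. exp (- s * (norm \<xi>)\<^sup>2))"
    and "(LINT \<xi>::plane|lborel. exp (- s * (norm \<xi>)\<^sup>2)) = pi / s"
  using integrable_gaussian[OF assms, where 'a=plane] gaussian_integral(2)[OF assms, where 'a=plane] assms by auto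

lemma le_4_pi_squared_mult:
  fixes y :: real
  assumes "0 \<le> y" shows "y \<le> 4 * pi\<^sup>2 * y"
proof -
  have "1 \<le> 4 * pi\<^sup>2" using pi_gt3 power_mono[of 3 pi 2] by simp
  from mult_right_mono[OF this assms] show ?thesis by simp
qed

lemma heat_kernel_fourier:
  assumes "q > 0" "t > 0"
  shows "integrable lborel (\<lambda>\<xi>. exp (- q * t * (norm \<xi>)\<^sup>2) * cos (\<xi> \<bullet> x))"
    and "4 * pi\<^sup>2 * heat_kernel2 q x t = (LINT \<xi>|lborel. exp (- q * t * (norm \<xi>)\<^sup>2) * cos (\<xi> \<bullet> x))"
proof -
  have qt: "q * t > 0" using assms by simp
  note G = gaussian_fourier[OF qt, of x]
  show "integrable lborel (\<lambda>\<xi>. exp (- q * t * (norm \<xi>)\<^sup>2) * cos (\<xi> \<bullet> x))"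
    using integrable_Re[OF G(1)] by (simp add: mult_ac)
  have "(LINT \<xi>|lborel. exp (- q * t * (norm \<xi>)\<^sup>2) * cos (\<xi> \<bullet> x)) =
      Re (LINT \<xi>|lborel. cis (\<xi> \<bullet> x) * exp (- (q * t) * (norm \<xi>)\<^sup>2))"
    by (subst integral_Re[OF G(1), symmetric]) (simp add: mult_ac)
  also have "\<dots> = pi / (q * t) * exp (- (norm x)\<^sup>2 / (4 * (q * t)))"
    unfolding G(2) using qt by (simp add: power2_eq_square flip: of_real_mult of_real_power)
  also have "\<dots> = 4 * pi\<^sup>2 * heat_kernel2 q x t"
    using assms by (simp add: heat_kernel2_def power2_eq_square field_simps)
  finally show "4 * pi\<^sup>2 * heat_kernel2 q x t = (LINT \<xi>|lborel. exp (- q * t * (norm \<xi>)\<^sup>2) * cos (\<xi> \<bullet> x))" ..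
qed

context radial_kernel begin

text \<open>Inside the unit ball \<open>a\<close> lies below a Gaussian; outside it
  \<open>n - 2\<close> factors decay geometrically and the remaining two keep the bound integrable.
  A rate of \<open>1/n^2\<close> for the outer part is negligible in all later estimates.\<close>

lemma a_power_bound:
  obtains c K where "c > 0" "K > 0" "\<And>\<xi>. norm \<xi> \<le> 1 \<Longrightarrow> \<bar>a \<xi>\<bar> \<le> exp (- c * (norm \<xi>)\<^sup>2)"
    "\<And>n \<xi>. n \<ge> 2 \<Longrightarrow> norm \<xi> > 1 \<Longrightarrow> \<bar>a \<xi> ^ n\<bar> \<le> K / (real n)\<^sup>2 * (a \<xi>)\<^sup>2"
    "\<And>n \<xi>. n \<ge> 2 \<Longrightarrow> \<bar>a \<xi> ^ n\<bar> \<le> exp (- c * real n * (norm \<xi>)\<^sup>2) + K / (real n)\<^sup>2 * (a \<xi>)\<^sup>2"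
proof -
  obtain c where c: "c > 0" "\<And>\<xi>. \<bar>a \<xi>\<bar> \<le> 1 - c * min 1 ((norm \<xi>)\<^sup>2)" using a_le by blast
  \<comment> \<open>Evaluated at a unit vector, where the bound reads
    \<open>0 \<le> |a| \<le> 1 - c\<close>.\<close>
  have c1: "c \<le> 1"
    using order_trans[OF abs_ge_zero c(2)[of "axis 1 1"]] by simp
  obtain K where K: "K > 0" "\<And>n::nat. n \<ge> 2 \<Longrightarrow> (1 - c) ^ (n - 2) \<le> K / (real n)\<^sup>2"
    using geometric_le_inverse_square[OF c(1) c1] by blast
  have small: "\<bar>a \<xi>\<bar> \<le> exp (- c * (norm \<xi>)\<^sup>2)" if "norm \<xi> \<le> 1" for \<xi>
  proof -
    have "(norm \<xi>)\<^sup>2 \<le> 1" using that by (simp add: power_le_one)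
    then have "\<bar>a \<xi>\<bar> \<le> 1 - c * (norm \<xi>)\<^sup>2" using c(2)[of \<xi>] by simp
    also have "\<dots> \<le> exp (- c * (norm \<xi>)\<^sup>2)" using exp_ge_add_one_self[of "- c * (norm \<xi>)\<^sup>2"] by simp
    finally show ?thesis .
  qed
  have large: "\<bar>a \<xi> ^ n\<bar> \<le> K / (real n)\<^sup>2 * (a \<xi>)\<^sup>2" if n: "n \<ge> 2" and "norm \<xi> > 1" for n \<xi>
  proof -
    have "(norm \<xi>)\<^sup>2 \<ge> 1" using that by (simp add: one_le_power)
    then have "\<bar>a \<xi>\<bar> \<le> 1 - c" using c(2)[of \<xi>] by simp
    then have "\<bar>a \<xi>\<bar> ^ (n - 2) \<le> (1 - c) ^ (n - 2)" by (intro power_mono) auto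
    also have "\<dots> \<le> K / (real n)\<^sup>2" using K n by simp
    finally have "\<bar>a \<xi>\<bar> ^ (n - 2) * \<bar>a \<xi>\<bar>\<^sup>2 \<le> K / (real n)\<^sup>2 * \<bar>a \<xi>\<bar>\<^sup>2" by (intro mult_right_mono) auto
    moreover have n2: "n - 2 + 2 = n" using n by simp
    have "\<bar>a \<xi> ^ n\<bar> = \<bar>a \<xi>\<bar> ^ (n - 2 + 2)" unfolding n2 by (rule power_abs)
    then have "\<bar>a \<xi> ^ n\<bar> = \<bar>a \<xi>\<bar> ^ (n - 2) * \<bar>a \<xi>\<bar>\<^sup>2" by (simp only: power_add)
    ultimately show ?thesis by simp
  qed
  have "\<bar>a \<xi> ^ n\<bar> \<le> exp (- c * real n * (norm \<xi>)\<^sup>2) + K / (real n)\<^sup>2 * (a \<xi>)\<^sup>2" if n: "n \<ge> 2" for n \<xi>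
  proof (cases "norm \<xi> \<le> 1")
    case True
    have "\<bar>a \<xi> ^ n\<bar> \<le> exp (- c * (norm \<xi>)\<^sup>2) ^ n"
      unfolding power_abs using small[OF True] by (intro power_mono) auto
    also have "\<dots> = exp (- c * real n * (norm \<xi>)\<^sup>2)" by (simp flip: exp_of_nat_mult add: mult_ac)
    finally show ?thesis using K by (simp add: add_increasing2)
  next
    case False
    then have "norm \<xi> > 1" by simp
    from large[OF n this] show ?thesis using exp_ge_zero[of "- c * real n * (norm \<xi>)\<^sup>2"] by linarith
  qed
  then show ?thesis using that small large c(1) K(1) by blast
qed

text \<open>A Gaussian of width \<open>1 / sqrt n\<close> in the frequency plane has integral of
  order \<open>1/n\<close>. The case \<open>n = 1\<close> is separate because inversion starts at
  \<open>n = 2\<close>.\<close>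

lemma p_le:
  obtains C where "C > 0" "\<And>n x. n \<ge> 1 \<Longrightarrow> p n x \<le> C / real n"
proof -
  obtain c K where cK: "c > 0" "K > 0"
    "\<And>n \<xi>. n \<ge> 2 \<Longrightarrow> \<bar>a \<xi> ^ n\<bar> \<le> exp (- c * real n * (norm \<xi>)\<^sup>2) + K / (real n)\<^sup>2 * (a \<xi>)\<^sup>2"
    using a_power_bound by metis
  obtain B where B: "B > 0" "\<And>x. J x \<le> B" using J_bounded by blast
  define A where "A = (LINT \<xi>|lborel. (a \<xi>)\<^sup>2)"
  have A: "A \<ge> 0" unfolding A_def by (intro Bochner_Integration.integral_nonneg) auto
  define C where "C = B + (pi / c + K * A)"
  have C: "C > 0" "B \<le> C" "pi / c + K * A \<le> C" using B A cK by (auto simp: C_def add_pos_nonneg)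
  have "p n x \<le> C / real n" if n: "n \<ge> 1" for n x
  proof (cases "n = 1")
    case True
    then show ?thesis using B(2)[of x] C by simp
  next
    case False
    then have n2: "n \<ge> 2" using n by simp
    have "c * real n > 0" using cK n by simp
    note G = gaussian_plane[OF this]
    have "4 * pi\<^sup>2 * p n x \<le> \<bar>LINT \<xi>|lborel. a \<xi> ^ n * cos (\<xi> \<bullet> x)\<bar>"
      unfolding p_inversion(2)[OF n2] by simp
    also have "\<dots> \<le> (LINT \<xi>|lborel. exp (- (c * real n) * (norm \<xi>)\<^sup>2) + K / (real n)\<^sup>2 * (a \<xi>)\<^sup>2)"
    proof (rule integral_abs_bound_integral[OF p_inversion(1)[OF n2]])
      show "integrable lborel (\<lambda>\<xi>::plane. exp (- (c * real n) * (norm \<xi>)\<^sup>2) + K / (real n)\<^sup>2 * (a \<xi>)\<^sup>2)"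
        using a2_integrable G(1) by simp
      fix \<xi>
      have "\<bar>a \<xi> ^ n * cos (\<xi> \<bullet> x)\<bar> \<le> \<bar>a \<xi> ^ n\<bar> * 1" unfolding abs_mult by (intro mult_left_mono) auto
      then show "\<bar>a \<xi> ^ n * cos (\<xi> \<bullet> x)\<bar> \<le> exp (- (c * real n) * (norm \<xi>)\<^sup>2) + K / (real n)\<^sup>2 * (a \<xi>)\<^sup>2"
        using cK(3)[OF n2, of \<xi>] by simp
    qed
    also have "\<dots> = pi / (c * real n) + K / (real n)\<^sup>2 * A"
      using a2_integrable G by (simp add: A_def)
    also have "\<dots> \<le> pi / (c * real n) + K / real n * A"
      using n cK A by (intro add_left_mono mult_right_mono divide_left_mono) (auto simp: power2_eq_square)
    also have "\<dots> = (pi / c + K * A) / real n" using cK n by (simp add: field_simps)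
    also have "\<dots> \<le> C / real n" using C by (intro divide_right_mono) auto
    finally have "4 * pi\<^sup>2 * p n x \<le> C / real n" .
    moreover have "p n x \<le> 4 * pi\<^sup>2 * p n x"
      by (rule le_4_pi_squared_mult[OF p_nonneg])
    ultimately show ?thesis by simp
  qed
  then show ?thesis using that C by blast
qed

text \<open>A difference of cosines gains \<open>|xi| * |x - y|\<close>, worth
  \<open>1 / sqrt n\<close> under the Gaussian. At high frequencies it is only bounded by 2, whence
  the term \<open>1/n^2\<close> independent of \<open>x - y\<close>.\<close>

lemma p_diff_le:
  obtains C where "C > 0"
    "\<And>n x y. n \<ge> 2 \<Longrightarrow> \<bar>p n x - p n y\<bar> \<le> C * (norm (x - y) / (real n * sqrt (real n)) + 1 / (real n)\<^sup>2)"
proof -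
  obtain c K where cK: "c > 0" "K > 0"
    "\<And>n \<xi>. n \<ge> 2 \<Longrightarrow> \<bar>a \<xi> ^ n\<bar> \<le> exp (- c * real n * (norm \<xi>)\<^sup>2) + K / (real n)\<^sup>2 * (a \<xi>)\<^sup>2"
    using a_power_bound by metis
  obtain B where B: "B > 0" "\<And>N y. N > 0 \<Longrightarrow> y \<ge> 0 \<Longrightarrow> y * exp (- c * N * y\<^sup>2) \<le> B / sqrt N * exp (- (c / 2) * N * y\<^sup>2)"
    using power_exp_bound[OF cK(1)] by metis
  define A where "A = (LINT \<xi>|lborel. (a \<xi>)\<^sup>2)"
  have A: "A \<ge> 0" unfolding A_def by (intro Bochner_Integration.integral_nonneg) auto
  define C where "C = B * (2 * pi / c) + 2 * K * A"
  have C: "C > 0" "B * (2 * pi / c) \<le> C" "2 * K * A \<le> C" using B A cK by (auto simp: C_def add_pos_nonneg)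
  have "\<bar>p n x - p n y\<bar> \<le> C * (norm (x - y) / (real n * sqrt (real n)) + 1 / (real n)\<^sup>2)" if n: "n \<ge> 2" for n x y
  proof -
    define h where "h = norm (x - y)"
    have n0: "real n > 0" using n by simp
    have "c / 2 * real n > 0" using cK n by simp
    note G = gaussian_plane[OF this]
    have eq: "4 * pi\<^sup>2 * p n x - 4 * pi\<^sup>2 * p n y = (LINT \<xi>|lborel. a \<xi> ^ n * cos (\<xi> \<bullet> x) - a \<xi> ^ n * cos (\<xi> \<bullet> y))"
      using p_inversion[OF n] by simp
    have "\<bar>4 * pi\<^sup>2 * p n x - 4 * pi\<^sup>2 * p n y\<bar> \<le> (LINT \<xi>|lborel. h * (B / sqrt n) * exp (- (c / 2 * real n) * (norm \<xi>)\<^sup>2) + 2 * (K / (real n)\<^sup>2) * (a \<xi>)\<^sup>2)"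
    unfolding eq
    proof (rule integral_abs_bound_integral)
      show "integrable lborel (\<lambda>\<xi>. a \<xi> ^ n * cos (\<xi> \<bullet> x) - a \<xi> ^ n * cos (\<xi> \<bullet> y))"
        using p_inversion(1)[OF n] by simp
      show "integrable lborel (\<lambda>\<xi>::plane. h * (B / sqrt n) * exp (- (c / 2 * real n) * (norm \<xi>)\<^sup>2) + 2 * (K / (real n)\<^sup>2) * (a \<xi>)\<^sup>2)"
        using a2_integrable G(1) by simp
      fix \<xi> :: plane
      have d1: "\<bar>cos (\<xi> \<bullet> x) - cos (\<xi> \<bullet> y)\<bar> \<le> norm \<xi> * h"
        using abs_cos_diff_le[of "\<xi> \<bullet> x" "\<xi> \<bullet> y"] Cauchy_Schwarz_ineq2[of \<xi> "x - y"] by (simp add: inner_diff_right h_def)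
      have d2: "\<bar>cos (\<xi> \<bullet> x) - cos (\<xi> \<bullet> y)\<bar> \<le> 2"
        using abs_cos_le_one[of "\<xi> \<bullet> x"] abs_cos_le_one[of "\<xi> \<bullet> y"] by linarith
      have "\<bar>a \<xi> ^ n * cos (\<xi> \<bullet> x) - a \<xi> ^ n * cos (\<xi> \<bullet> y)\<bar> = \<bar>a \<xi> ^ n\<bar> * \<bar>cos (\<xi> \<bullet> x) - cos (\<xi> \<bullet> y)\<bar>"
        by (simp add: right_diff_distrib flip: abs_mult)
      also have "\<dots> \<le> (exp (- c * real n * (norm \<xi>)\<^sup>2) + K / (real n)\<^sup>2 * (a \<xi>)\<^sup>2) * \<bar>cos (\<xi> \<bullet> x) - cos (\<xi> \<bullet> y)\<bar>"
        using cK(3)[OF n] by (intro mult_right_mono) auto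
      also have "\<dots> = exp (- c * real n * (norm \<xi>)\<^sup>2) * \<bar>cos (\<xi> \<bullet> x) - cos (\<xi> \<bullet> y)\<bar> + K / (real n)\<^sup>2 * (a \<xi>)\<^sup>2 * \<bar>cos (\<xi> \<bullet> x) - cos (\<xi> \<bullet> y)\<bar>"
        by (rule distrib_right)
      also have "\<dots> \<le> exp (- c * real n * (norm \<xi>)\<^sup>2) * (norm \<xi> * h) + K / (real n)\<^sup>2 * (a \<xi>)\<^sup>2 * 2"
        using cK d1 d2 by (intro add_mono mult_left_mono) auto
      also have "exp (- c * real n * (norm \<xi>)\<^sup>2) * (norm \<xi> * h) = h * (norm \<xi> * exp (- c * real n * (norm \<xi>)\<^sup>2))" by simp
      also have "\<dots> \<le> h * (B / sqrt n * exp (- (c / 2) * n * (norm \<xi>)\<^sup>2))"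
        using B(2)[OF n0, of "norm \<xi>"] by (intro mult_left_mono) (auto simp: h_def)
      finally show "\<bar>a \<xi> ^ n * cos (\<xi> \<bullet> x) - a \<xi> ^ n * cos (\<xi> \<bullet> y)\<bar> \<le>
          h * (B / sqrt n) * exp (- (c / 2 * real n) * (norm \<xi>)\<^sup>2) + 2 * (K / (real n)\<^sup>2) * (a \<xi>)\<^sup>2"
        by (simp add: mult_ac)
    qed
    also have "\<dots> = h * (B / sqrt n) * (pi / (c / 2 * real n)) + 2 * (K / (real n)\<^sup>2) * A"
      unfolding A_def G(2)[symmetric] using a2_integrable G(1)
      by (subst Bochner_Integration.integral_add) (simp_all only: integral_mult_right_zero integrable_mult_right)
    also have "\<dots> = B * (2 * pi / c) * (h / (real n * sqrt n)) + 2 * K * A * (1 / (real n)\<^sup>2)"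
      using n0 cK by (simp add: field_simps)
    also have "\<dots> \<le> C * (h / (real n * sqrt n)) + C * (1 / (real n)\<^sup>2)"
      using C by (intro add_mono mult_right_mono) (auto simp: h_def)
    finally have "\<bar>4 * pi\<^sup>2 * p n x - 4 * pi\<^sup>2 * p n y\<bar> \<le> C * (h / (real n * sqrt n)) + C * (1 / (real n)\<^sup>2)" .
    moreover have "\<bar>p n x - p n y\<bar> \<le> \<bar>4 * pi\<^sup>2 * p n x - 4 * pi\<^sup>2 * p n y\<bar>"
      using le_4_pi_squared_mult[OF abs_ge_zero[of "p n x - p n y"]]
      by (simp add: abs_mult flip: right_diff_distrib)
    ultimately show ?thesis by (simp add: h_def distrib_left)
  qed
  then show ?thesis using that C by blast
qed

text \<open>Near 0 both \<open>a\<close> and the Gaussian lie below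
  \<open>r = exp (- 2 * e * |xi|^2)\<close>, so their \<open>n\<close>-th powers differ by at most
  \<open>n * r ^ (n - 1) * T * |xi|^3\<close>. The cube is worth \<open>n powr (-3/2)\<close> and
  the planar integral \<open>1/n\<close>, in total \<open>n powr (-3/2)\<close>.\<close>

lemma local_limit:
  obtains C where "C > 0"
    "\<And>n x. n \<ge> 2 \<Longrightarrow> \<bar>p n x - heat_kernel2 q x (real n)\<bar> \<le> C / (real n * sqrt (real n))"
proof -
  obtain c K where cK: "c > 0" "K > 0"
    and a_small: "\<And>\<xi>. norm \<xi> \<le> 1 \<Longrightarrow> \<bar>a \<xi>\<bar> \<le> exp (- c * (norm \<xi>)\<^sup>2)"
    and a_large: "\<And>n \<xi>. n \<ge> 2 \<Longrightarrow> norm \<xi> > 1 \<Longrightarrow> \<bar>a \<xi> ^ n\<bar> \<le> K / (real n)\<^sup>2 * (a \<xi>)\<^sup>2"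
    using a_power_bound by metis
  obtain T where T: "T > 0" "\<And>\<xi>. norm \<xi> \<le> 1 \<Longrightarrow> \<bar>a \<xi> - exp (- q * (norm \<xi>)\<^sup>2)\<bar> \<le> T * norm \<xi> ^ 3"
    using a_near_gaussian by blast
  \<comment> \<open>Half of the common rate, so that \<open>r ^ (n - 1)\<close> with exponent rate
    \<open>2 * e * (n - 1) \<ge> e * n\<close> still decays like an \<open>n\<close>-th power; this
    uses \<open>n \<ge> 2\<close>.\<close>
  define e where "e = min c q / 2"
  have e: "e > 0" "2 * e \<le> c" "2 * e \<le> q" using cK q_pos by (auto simp: e_def)
  obtain B where B: "B > 0" "\<And>N y. N > 0 \<Longrightarrow> y \<ge> 0 \<Longrightarrow> y ^ 3 * exp (- e * N * y\<^sup>2) \<le> B / (N * sqrt N) * exp (- (e / 2) * N * y\<^sup>2)"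
    using power_exp_bound[OF e(1)] by metis
  define A where "A = (LINT \<xi>|lborel. (a \<xi>)\<^sup>2)"
  have A: "A \<ge> 0" unfolding A_def by (intro Bochner_Integration.integral_nonneg) auto
  define C where "C = (T + 1) * B * (2 * pi / e) + K * A"
  have C: "C > 0" using B A cK e T by (auto simp: C_def intro!: add_pos_nonneg)
  have "\<bar>p n x - heat_kernel2 q x (real n)\<bar> \<le> C / (real n * sqrt (real n))" if n: "n \<ge> 2" for n x
  proof -
    have n0: "real n > 0" using n by simp
    have e2: "e / 2 * real n > 0" using e n by simp
    note G = gaussian_plane[OF e2]
    note H = heat_kernel_fourier[OF q_pos n0, of x]
    have pw: "\<bar>a \<xi> ^ n - exp (- q * n * (norm \<xi>)\<^sup>2)\<bar> \<le>
      (T + 1) * B / sqrt n * exp (- (e / 2 * real n) * (norm \<xi>)\<^sup>2) + K / (real n)\<^sup>2 * (a \<xi>)\<^sup>2" for \<xi>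
    proof -
      let ?y = "norm \<xi>"
      have "?y ^ 3 * exp (- e * n * ?y\<^sup>2) \<le> B / (n * sqrt n) * exp (- (e / 2) * n * ?y\<^sup>2)"
        using B(2)[OF n0, of ?y] by simp
      then have "n * (T + 1) * (?y ^ 3 * exp (- e * n * ?y\<^sup>2)) \<le> n * (T + 1) * (B / (n * sqrt n) * exp (- (e / 2) * n * ?y\<^sup>2))"
        using n0 T by (intro mult_left_mono) auto
      also have "\<dots> = (T + 1) * B / sqrt n * exp (- (e / 2 * real n) * ?y\<^sup>2)" using n0 by simp
      finally have b: "n * (T + 1) * (?y ^ 3 * exp (- e * n * ?y\<^sup>2)) \<le> (T + 1) * B / sqrt n * exp (- (e / 2 * real n) * ?y\<^sup>2)" .
      have K0: "K / (real n)\<^sup>2 * (a \<xi>)\<^sup>2 \<ge> 0" using cK by simp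
      show ?thesis
      proof (cases "?y \<le> 1")
        case True
        let ?r = "exp (- (2 * e) * ?y\<^sup>2)"
        have r: "exp (- c * ?y\<^sup>2) \<le> ?r" "exp (- q * ?y\<^sup>2) \<le> ?r" using e by (simp_all add: mult_right_mono)
        have "exp (- q * n * ?y\<^sup>2) = exp (- q * ?y\<^sup>2) ^ n"
          by (simp flip: exp_of_nat_mult add: mult_ac)
        then have "\<bar>a \<xi> ^ n - exp (- q * n * ?y\<^sup>2)\<bar> = \<bar>a \<xi> ^ n - exp (- q * ?y\<^sup>2) ^ n\<bar>" by simp
        also have "\<dots> \<le> n * ?r ^ (n - 1) * \<bar>a \<xi> - exp (- q * ?y\<^sup>2)\<bar>"
          using order_trans[OF a_small[OF True] r(1)] r(2) by (intro power_diff_le) (simp_all only: abs_exp_cancel)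
        also have "\<dots> \<le> n * exp (- e * n * ?y\<^sup>2) * (T * ?y ^ 3)"
        proof (intro mult_mono T True mult_left_mono)
          have "?r ^ (n - 1) = exp (- (2 * e * real (n - 1)) * ?y\<^sup>2)"
            by (simp flip: exp_of_nat_mult add: mult_ac)
          also have "\<dots> \<le> exp (- (e * n) * ?y\<^sup>2)"
          proof -
            have "n \<le> 2 * (n - 1)" using n by simp
            then have "real n \<le> 2 * real (n - 1)" using of_nat_mono[of n "2 * (n - 1)", where 'a=real] by simp
            from mult_left_mono[OF this, of e] have "e * n \<le> 2 * e * real (n - 1)" using e by simp
            then show ?thesis by (simp add: mult_right_mono)
          qed
          finally show "?r ^ (n - 1) \<le> exp (- e * n * ?y\<^sup>2)" by simp
        qed (use T in auto)
        also have "\<dots> = n * T * (?y ^ 3 * exp (- e * n * ?y\<^sup>2))" by (simp add: mult_ac)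
        also have "\<dots> \<le> n * (T + 1) * (?y ^ 3 * exp (- e * n * ?y\<^sup>2))"
          by (intro mult_right_mono mult_left_mono) auto
        finally show ?thesis using b K0 by linarith
      next
        case False
        have "\<bar>a \<xi> ^ n\<bar> \<le> K / (real n)\<^sup>2 * (a \<xi>)\<^sup>2" using a_large[OF n] False by simp
        \<comment> \<open>Beyond the unit ball \<open>n * (T + 1) * |xi|^3 \<ge> 1\<close>, so the
          Gaussian fits into the same majorant; for this reason the constant is \<open>T + 1\<close>
          and not \<open>T\<close>.\<close>
        moreover have "exp (- q * n * ?y\<^sup>2) \<le> n * (T + 1) * (?y ^ 3 * exp (- e * n * ?y\<^sup>2))"
        proof -
          have "e \<le> q" using e by linarith
          then have "exp (- q * n * ?y\<^sup>2) \<le> 1 * exp (- e * n * ?y\<^sup>2)" by (simp add: mult_right_mono)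
          also have "\<dots> \<le> (n * (T + 1) * ?y ^ 3) * exp (- e * n * ?y\<^sup>2)"
          proof (rule mult_right_mono)
            have "1 * 1 * 1 \<le> n * (T + 1) * ?y ^ 3"
              using n T False by (intro mult_mono) (auto simp: one_le_power)
            then show "1 \<le> n * (T + 1) * ?y ^ 3" by simp
          qed simp
          finally show ?thesis by (simp add: mult_ac)
        qed
        ultimately show ?thesis using b exp_ge_zero[of "- q * n * ?y\<^sup>2"] by linarith
      qed
    qed
    have eq: "4 * pi\<^sup>2 * p n x - 4 * pi\<^sup>2 * heat_kernel2 q x n = (LINT \<xi>|lborel. a \<xi> ^ n * cos (\<xi> \<bullet> x) - exp (- q * n * (norm \<xi>)\<^sup>2) * cos (\<xi> \<bullet> x))"
      unfolding p_inversion(2)[OF n] H(2) using p_inversion(1)[OF n] H(1) by simp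
    have "\<bar>4 * pi\<^sup>2 * p n x - 4 * pi\<^sup>2 * heat_kernel2 q x n\<bar> \<le> (LINT \<xi>|lborel. (T + 1) * B / sqrt n * exp (- (e / 2 * real n) * (norm \<xi>)\<^sup>2) + K / (real n)\<^sup>2 * (a \<xi>)\<^sup>2)"
    unfolding eq
    proof (rule integral_abs_bound_integral)
      show "integrable lborel (\<lambda>\<xi>. a \<xi> ^ n * cos (\<xi> \<bullet> x) - exp (- q * n * (norm \<xi>)\<^sup>2) * cos (\<xi> \<bullet> x))"
        using p_inversion(1)[OF n] H(1) by simp
      show "integrable lborel (\<lambda>\<xi>::plane. (T + 1) * B / sqrt n * exp (- (e / 2 * real n) * (norm \<xi>)\<^sup>2) + K / (real n)\<^sup>2 * (a \<xi>)\<^sup>2)"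
        using a2_integrable G(1) by simp
      fix \<xi> :: plane
      have "\<bar>a \<xi> ^ n * cos (\<xi> \<bullet> x) - exp (- q * n * (norm \<xi>)\<^sup>2) * cos (\<xi> \<bullet> x)\<bar> = \<bar>a \<xi> ^ n - exp (- q * n * (norm \<xi>)\<^sup>2)\<bar> * \<bar>cos (\<xi> \<bullet> x)\<bar>"
        by (simp add: left_diff_distrib flip: abs_mult)
      also have "\<dots> \<le> \<bar>a \<xi> ^ n - exp (- q * n * (norm \<xi>)\<^sup>2)\<bar>" by (intro mult_left_le) auto
      finally show "\<bar>a \<xi> ^ n * cos (\<xi> \<bullet> x) - exp (- q * n * (norm \<xi>)\<^sup>2) * cos (\<xi> \<bullet> x)\<bar> \<le>
        (T + 1) * B / sqrt n * exp (- (e / 2 * real n) * (norm \<xi>)\<^sup>2) + K / (real n)\<^sup>2 * (a \<xi>)\<^sup>2"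
        using pw[of \<xi>] by linarith
    qed
    also have "\<dots> = (T + 1) * B / sqrt n * (pi / (e / 2 * real n)) + K / (real n)\<^sup>2 * A"
      unfolding A_def G(2)[symmetric] using a2_integrable G(1)
      by (subst Bochner_Integration.integral_add) (simp_all only: integral_mult_right_zero integrable_mult_right)
    also have "\<dots> \<le> (T + 1) * B / sqrt n * (pi / (e / 2 * real n)) + K / (real n * sqrt n) * A"
    proof -
      have "sqrt n \<le> n" using n by (intro real_le_lsqrt) (auto simp: power2_eq_square)
      then show ?thesis using n cK A by (intro add_left_mono mult_right_mono divide_left_mono) (auto simp: power2_eq_square)
    qed
    also have "\<dots> = C / (real n * sqrt n)"
      using n0 e by (simp add: C_def field_simps)
    finally have "\<bar>4 * pi\<^sup>2 * p n x - 4 * pi\<^sup>2 * heat_kernel2 q x n\<bar> \<le> C / (real n * sqrt n)" .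
    moreover have "\<bar>p n x - heat_kernel2 q x n\<bar> \<le> \<bar>4 * pi\<^sup>2 * p n x - 4 * pi\<^sup>2 * heat_kernel2 q x n\<bar>"
      using le_4_pi_squared_mult[OF abs_ge_zero[of "p n x - heat_kernel2 q x n"]]
      by (simp add: abs_mult flip: right_diff_distrib)
    ultimately show ?thesis by simp
  qed
  then show ?thesis using that C by blast
qed

text \<open>To reach \<open>x\<close>, one of the two halves of the walk must travel at least
  \<open>|x| / 2\<close>. The other half is bounded by its supremum O(1/n), the travelling one by
  its second moment O(n), and the powers of \<open>n\<close> cancel. The absence of \<open>n\<close>
  in the bound allows mass to be absorbed arbitrarily late.\<close>

lemma p_offdiagonal:
  obtains C where "C > 0" "\<And>n x. n \<ge> 1 \<Longrightarrow> p n x * (norm x)\<^sup>2 \<le> C"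
proof -
  obtain B where B: "B > 0" "\<And>n x. n \<ge> 1 \<Longrightarrow> p n x \<le> B / real n" using p_le by blast
  define C where "C = B * d\<^sup>2 + 96 * B * q"
  have C: "C > 0" "B * d\<^sup>2 \<le> C" "96 * B * q \<le> C" using B q_pos d_pos by (auto simp: C_def add_pos_pos)
  have "p n x * (norm x)\<^sup>2 \<le> C" if n: "n \<ge> 1" for n x
  proof (cases "n = 1")
    case True
    show ?thesis
    proof (cases "norm x \<le> d")
      case True
      have "J x * (norm x)\<^sup>2 \<le> B * d\<^sup>2"
        using B(2)[of 1 x] B(1) J_nonneg[of x] True by (intro mult_mono power_mono) auto
      then show ?thesis using \<open>n = 1\<close> C by simp
    qed (use True J_zero C in auto)
  next
    case False
    define m k where "m = n div 2" and "k = n - n div 2"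
    \<comment> \<open>The factor 3 accounts for rounding: \<open>n = 3\<close> gives
      \<open>m = 1\<close>.\<close>
    have mk: "m \<ge> 1" "k \<ge> 1" "m + k = n" "3 * m \<ge> n" "2 * k \<ge> n" "m \<le> n" "k \<le> n"
      using n False by (auto simp: m_def k_def)
    have bd: "p i z \<le> 3 * B / n" if "i = m \<or> i = k" for i z
    proof -
      have "i \<ge> 1" "n \<le> 3 * i" using that mk by auto
      then have "p i z \<le> B / i" using B(2) by simp
      also have "\<dots> \<le> 3 * B / n"
        using \<open>i \<ge> 1\<close> \<open>n \<le> 3 * i\<close> n B(1) of_nat_mono[of n "3 * i", where 'a=real] by (simp add: field_simps)
      finally show ?thesis .
    qed
    \<comment> \<open>The constant 12 is 3 from the supremum of the resting half times 4 from
      \<open>|x|^2 \<le> 4 * |z|^2\<close>, with \<open>z\<close> the displacement of the travelling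
      half.\<close>
    have pt: "p m (x - y) * p k y * (norm x)\<^sup>2 \<le> 12 * B / n * (p k y * (norm y)\<^sup>2) + 12 * B / n * (p m (x - y) * (norm (x - y))\<^sup>2)" for y
    proof -
      have nx: "(norm x)\<^sup>2 \<le> (2 * norm z)\<^sup>2" if "norm x \<le> 2 * norm z" for z :: plane
        using that by (intro power_mono) auto
      show ?thesis
      proof (cases "norm x \<le> 2 * norm y")
        case True
        have "p m (x - y) * (p k y * (norm x)\<^sup>2) \<le> (3 * B / n) * (p k y * (2 * norm y)\<^sup>2)"
          using B bd nx[OF True] by (intro mult_mono mult_left_mono) (simp_all add: p_nonneg)
        then have "p m (x - y) * p k y * (norm x)\<^sup>2 \<le> 12 * B / n * (p k y * (norm y)\<^sup>2)"
          by (simp add: power_mult_distrib mult_ac)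
        moreover have "12 * B / n * (p m (x - y) * (norm (x - y))\<^sup>2) \<ge> 0" using B p_nonneg by simp
        ultimately show ?thesis by linarith
      next
        case False
        then have *: "norm x \<le> 2 * norm (x - y)" using norm_triangle_ineq2[of x y] by linarith
        have "p k y * (p m (x - y) * (norm x)\<^sup>2) \<le> (3 * B / n) * (p m (x - y) * (2 * norm (x - y))\<^sup>2)"
          using B bd nx[OF *] by (intro mult_mono mult_left_mono) (simp_all add: p_nonneg)
        then have "p m (x - y) * p k y * (norm x)\<^sup>2 \<le> 12 * B / n * (p m (x - y) * (norm (x - y))\<^sup>2)"
          by (simp add: power_mult_distrib mult_ac)
        moreover have "12 * B / n * (p k y * (norm y)\<^sup>2) \<ge> 0" using B p_nonneg by simp
        ultimately show ?thesis by linarith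
      qed
    qed
    have I: "integrable lborel (\<lambda>y. p k y * (norm y)\<^sup>2)" "integrable lborel (\<lambda>y. p m (x - y) * (norm (x - y))\<^sup>2)"
      using tame_integrable_norm2[OF tame_p] integrable_lborel_diff(1)[of "\<lambda>y. p m y * (norm y)\<^sup>2" x] by auto
    have "p n x * (norm x)\<^sup>2 = (LINT y|lborel. p m (x - y) * p k y * (norm x)\<^sup>2)"
      unfolding mk(3)[symmetric] p_add[OF mk(1,2)] conv_def by simp
    also have "\<dots> \<le> (LINT y|lborel. 12 * B / n * (p k y * (norm y)\<^sup>2) + 12 * B / n * (p m (x - y) * (norm (x - y))\<^sup>2))"
      using conv_integrable[OF tame_p tame_p, of m x k] I pt by (intro integral_mono) auto
    also have "\<dots> = 12 * B / n * (4 * q * k) + 12 * B / n * (LINT y|lborel. p m (x - y) * (norm (x - y))\<^sup>2)"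
      using I p_norm2[OF mk(2)] by simp
    also have "(LINT y|lborel. p m (x - y) * (norm (x - y))\<^sup>2) = 4 * q * m"
      using integral_lborel_diff(1)[of "\<lambda>y. p m y * (norm y)\<^sup>2" x] p_norm2[OF mk(1)] by simp
    also have "12 * B / n * (4 * q * k) + 12 * B / n * (4 * q * m) = 48 * B * q * ((real m + real k) / n)"
      using n by (simp add: field_simps)
    also have "\<dots> = 48 * B * q" using mk n by (simp flip: of_nat_add)
    also have "\<dots> \<le> 96 * B * q" using B q_pos by simp
    also note C(3)
    finally show ?thesis .
  qed
  then show ?thesis using that C by blast
qed

end

subsection \<open>The killed walk and its mass\<close>

text \<open>\<open>\<phi>\<close> and \<open>v0\<close> stand for Borel representatives of the
  stationary solution and of the initial datum. They can be modified on null sets so that the other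
  clauses hold pointwise, but harmonicity then survives only almost everywhere.\<close>

locale exterior_walk = radial_kernel +
  fixes H :: "plane set" and R B :: real and \<phi> v0 :: "plane \<Rightarrow> real"
  assumes H_open: "open H" and H_ball: "ball 0 2 \<subseteq> H" and H_bounded: "H \<subseteq> ball 0 R"
    and \<phi>_measurable[measurable]: "\<phi> \<in> borel_measurable borel"
    and \<phi>_H: "x \<in> H \<Longrightarrow> \<phi> x = 0"
    and \<phi>_harmonic: "AE x in lborel. x \<notin> H \<longrightarrow> conv J \<phi> x = \<phi> x"
    and \<phi>_log: "x \<notin> H \<Longrightarrow> \<bar>\<phi> x - ln (norm x)\<bar> \<le> B"
    and tame_v0: "tame v0" and v0_H: "x \<in> H \<Longrightarrow> v0 x = 0"
begin

lemma H_borel[measurable]: "H \<in> sets borel" using H_open by simp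

lemma norm_ge_2: "x \<notin> H \<Longrightarrow> 2 \<le> norm x"
  using H_ball by (auto simp: subset_iff) (meson not_le)

lemma R_pos: "R > 0"
proof -
  have "(0::plane) \<in> ball 0 R" using H_ball H_bounded by (metis centre_in_ball subset_eq zero_less_numeral)
  then show ?thesis by simp
qed

fun v :: "nat \<Rightarrow> plane \<Rightarrow> real" where
  "v 0 = v0"
| "v (Suc n) = (\<lambda>x. indicator (- H) x * conv J (v n) x)"

lemma tame_v: "tame (v n)"
  by (induction n) (auto intro!: tame_v0 tame_indicator tame_conv)

lemmas v_measurable[measurable] = tame_measurable[OF tame_v]
lemmas v_nonneg = tame_nonneg[OF tame_v]
lemmas v_integrable = tame_integrable[OF tame_v]

lemma v_H: "x \<in> H \<Longrightarrow> v n x = 0"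
  by (cases n) (auto simp: v0_H)

definition M :: "nat \<Rightarrow> real" where "M n = (LINT x|lborel. v n x)"
definition E :: "nat \<Rightarrow> real" where "E n = (LINT x|lborel. v n x * (norm x)\<^sup>2)"
text \<open>The constant \<open>M\<close> of the theorem; here \<open>M\<close> denotes the mass of
  the killed walk.\<close>

definition Ms :: real where "Ms = (LINT x|lborel. v0 x * \<phi> x)"

lemma M_nonneg: "0 \<le> M n"
  unfolding M_def by (intro Bochner_Integration.integral_nonneg v_nonneg)

lemma E_nonneg: "0 \<le> E n"
  unfolding E_def by (intro Bochner_Integration.integral_nonneg mult_nonneg_nonneg v_nonneg) simp

lemma v_Suc_le: "v (Suc n) x \<le> conv J (v n) x"
  using tame_nonneg[OF tame_conv[OF tame_v], of n x] by (auto simp: indicator_def)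

lemma M_Suc: "M (Suc n) \<le> M n"
proof -
  have "M (Suc n) \<le> (LINT x|lborel. conv J (v n) x)"
    unfolding M_def by (rule integral_mono[OF v_integrable tame_integrable[OF tame_conv[OF tame_v]] v_Suc_le])
  then show ?thesis by (simp add: conv_mass[OF tame_v] M_def)
qed

lemma M_decseq: "decseq M"
  using M_Suc by (rule decseq_SucI)

lemma M_antimono: "m \<le> n \<Longrightarrow> M n \<le> M m"
  using M_decseq by (rule decseqD)

lemma E_Suc: "E (Suc n) \<le> E n + 4 * q * M n"
proof -
  have "E (Suc n) \<le> (LINT x|lborel. conv J (v n) x * (norm x)\<^sup>2)"
    unfolding E_def
    by (rule integral_mono[OF tame_integrable_norm2[OF tame_v] tame_integrable_norm2[OF tame_conv[OF tame_v]]])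
       (rule mult_right_mono[OF v_Suc_le], simp)
  then show ?thesis by (simp add: conv_norm2[OF tame_v] M_def E_def)
qed

lemma E_le_sum: "E n \<le> E 0 + 4 * q * (\<Sum>k<n. M k)"
proof (induction n)
  case (Suc n)
  then show ?case using E_Suc[of n] by (simp add: distrib_left)
qed simp

text \<open>Crude, but enough for \<open>M_asymptotic\<close>; the decay of the mass found there
  improves it in \<open>E_log_bound\<close>.\<close>

lemma E_le: "E n \<le> E 0 + 4 * q * M 0 * n"
proof -
  have "(\<Sum>k<n. M k) \<le> (\<Sum>k<n. M 0)" by (intro sum_mono M_antimono) simp
  then have "4 * q * (\<Sum>k<n. M k) \<le> 4 * q * (n * M 0)" using q_pos by (intro mult_left_mono) auto
  then show ?thesis using E_le_sum[of n] by (simp add: mult_ac)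
qed

lemma conv_mono:
  assumes "tame f" "tame g" "\<And>x. f x \<le> g x"
  shows "conv J f x \<le> conv J g x"
  unfolding conv_def using assms J_nonneg
  by (intro integral_mono conv_integrable tame_J mult_left_mono) auto

lemma v_le_funpow: "v n x \<le> (conv J ^^ n) v0 x"
proof (induction n arbitrary: x)
  case (Suc n)
  have "v (Suc n) x \<le> conv J (v n) x" by (rule v_Suc_le)
  also have "\<dots> \<le> conv J ((conv J ^^ n) v0) x"
    by (intro conv_mono tame_v tame_funpow tame_v0 Suc)
  finally show ?case by simp
qed simp

text \<open>The killed walk is dominated by the free one. The denominator \<open>real n + 1\<close>
  admits \<open>n = 0\<close> and is the weight that \<open>poisson_shifted_variance\<close> can
  sum.\<close>

lemma v_le:
  obtains C where "C > 0" "\<And>n x. v n x \<le> C / (real n + 1)"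
proof -
  obtain C0 where C0: "C0 \<ge> 0" "\<And>x. v0 x \<le> C0" using tame_bounded[OF tame_v0] by blast
  obtain C1 where C1: "C1 > 0" "\<And>n x. n \<ge> 1 \<Longrightarrow> p n x \<le> C1 / real n" using p_le by blast
  define C where "C = C0 + 2 * C1 * M 0 + 1"
  have "v n x \<le> C / (real n + 1)" for n x
  proof (cases "n = 0")
    case True
    then show ?thesis using C0(2)[of x] C1(1) M_nonneg[of 0] by (simp add: C_def add_increasing2)
  next
    case False
    then have n: "n \<ge> 1" by simp
    have "v n x \<le> conv (p n) v0 x" using v_le_funpow[of n x] funpow_conv[OF tame_v0 n] by simp
    also have "\<dots> \<le> (LINT y|lborel. C1 / real n * v0 y)"
      unfolding conv_def using tame_integrable[OF tame_v0]
      by (intro integral_mono[OF conv_integrable[OF tame_p tame_v0]] mult_right_mono C1(2)[OF n] tame_nonneg[OF tame_v0]) simp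
    also have "\<dots> = C1 * M 0 / real n" by (simp add: M_def)
    also have "\<dots> \<le> 2 * C1 * M 0 / (real n + 1)"
    proof -
      have "C1 * M 0 * (real n + 1) \<le> C1 * M 0 * (2 * real n)"
        using n C1(1) M_nonneg[of 0] by (intro mult_left_mono) auto
      then show ?thesis using n by (simp add: field_simps)
    qed
    also have "\<dots> \<le> C / (real n + 1)" using C0 by (intro divide_right_mono) (auto simp: C_def)
    finally show ?thesis .
  qed
  moreover have "C > 0" using C0 C1 M_nonneg[of 0] by (auto simp: C_def add_nonneg_pos)
  ultimately show ?thesis using that by blast
qed

lemma B_nonneg: "0 \<le> B"
proof -
  have "norm (R *\<^sub>R axis 1 1 :: plane) = R" using R_pos by (simp add: norm_axis_1)
  then have "(R *\<^sub>R axis 1 1 :: plane) \<notin> H" using H_bounded by (auto simp: subset_iff)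
  from \<phi>_log[OF this] show ?thesis by linarith
qed

lemma ln_norm_bounds:
  assumes "x \<notin> H" shows "0 \<le> ln (norm x)" "ln (norm x) \<le> 1 + (norm x)\<^sup>2"
proof -
  have n: "norm x \<ge> 2" using assms by (rule norm_ge_2)
  then show "0 \<le> ln (norm x)" by simp
  have "norm x > 0" using n by linarith
  then have "ln (norm x) \<le> norm x" by (rule ln_bound)
  also have "\<dots> \<le> (norm x)\<^sup>2" using n by (intro self_le_power) auto
  finally show "ln (norm x) \<le> 1 + (norm x)\<^sup>2" by simp
qed

lemma \<phi>_growth: "\<bar>\<phi> x\<bar> \<le> (B + 1) * (1 + (norm x)\<^sup>2)"
proof (cases "x \<in> H")
  case True
  then show ?thesis using \<phi>_H B_nonneg by simp
next
  case False
  have "\<bar>\<phi> x\<bar> \<le> B + (1 + (norm x)\<^sup>2)" using \<phi>_log[OF False] ln_norm_bounds[OF False] by linarith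
  also have "\<dots> \<le> (B + 1) * (1 + (norm x)\<^sup>2)" using B_nonneg by (simp add: algebra_simps)
  finally show ?thesis .
qed

lemma v_\<phi>_integrable: "integrable lborel (\<lambda>x. v n x * \<phi> x)"
  using tame_integrable_le[OF tame_v \<phi>_measurable, where C = "B + 1"] \<phi>_growth by simp

text \<open>Conservation law: \<open>\<phi>\<close> vanishes in the hole, so killing there does not change the pairing,
  and \<open>v n\<close> only sees \<open>J * \<phi>\<close> off the hole, where it equals \<open>\<phi>\<close>.\<close>

lemma v_\<phi>_conserved: "(LINT x|lborel. v n x * \<phi> x) = Ms"
proof (induction n)
  case (Suc n)
  have "v (Suc n) x * \<phi> x = conv J (v n) x *\<^sub>R \<phi> x" for x
    by (auto simp: indicator_def \<phi>_H)
  then have "(LINT x|lborel. v (Suc n) x * \<phi> x) = (LINT x|lborel. conv J (v n) x *\<^sub>R \<phi> x)"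
    by (simp only:)
  also have "\<dots> = (LINT y|lborel. v n y *\<^sub>R (LINT x|lborel. J (x - y) *\<^sub>R \<phi> x))"
    using \<phi>_growth by (intro conv_duality(2)[OF tame_v, where C = "B + 1"]) auto
  also have "\<dots> = (LINT y|lborel. v n y * conv J \<phi> y)"
    by (simp add: conv_def J_diff_commute[of _ "_ :: plane"] mult_ac)
  also have "\<dots> = (LINT y|lborel. v n y * \<phi> y)"
  proof (rule integral_cong_AE)
    show "AE y in lborel. v n y * conv J \<phi> y = v n y * \<phi> y"
      using \<phi>_harmonic by eventually_elim (metis v_H mult_zero_left)
  qed measurable
  finally show ?case using Suc by simp
qed (simp add: Ms_def)

text \<open>A lower bound on the mass. Since \<open>ln |x| \<le> ln s + (|x| / s)^2\<close>, the
  part of the pairing with \<phi> beyond radius \<open>s\<close> is paid for by the second moment.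
  The radius will be slightly above \<open>sqrt n\<close>.\<close>

lemma Ms_le:
  assumes "s > 0" shows "Ms \<le> (ln s + B) * M n + E n / s\<^sup>2"
proof -
  have pw: "v n x * \<phi> x \<le> (ln s + B) * v n x + (1 / s\<^sup>2) * (v n x * (norm x)\<^sup>2)" for x
  proof (cases "x \<in> H")
    case True
    then show ?thesis by (simp add: v_H)
  next
    case False
    have n: "norm x > 0" using norm_ge_2[OF False] by linarith
    have "0 \<le> (norm x / s - 1/2)\<^sup>2 + 3/4" by simp
    then have "norm x / s - 1 \<le> (norm x / s)\<^sup>2" by (simp add: power2_eq_square algebra_simps)
    moreover have "ln (norm x / s) \<le> norm x / s - 1" using n assms by (intro ln_le_minus_one) auto
    ultimately have "ln (norm x) \<le> ln s + (norm x / s)\<^sup>2" using n assms by (simp add: ln_div)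
    then have "\<phi> x \<le> ln s + B + (norm x / s)\<^sup>2" using \<phi>_log[OF False] by linarith
    from mult_left_mono[OF this v_nonneg[of n x]] show ?thesis
      by (simp add: power_divide algebra_simps)
  qed
  have "Ms = (LINT x|lborel. v n x * \<phi> x)" by (simp add: v_\<phi>_conserved)
  also have "\<dots> \<le> (LINT x|lborel. (ln s + B) * v n x + (1 / s\<^sup>2) * (v n x * (norm x)\<^sup>2))"
    using v_\<phi>_integrable v_integrable tame_integrable_norm2[OF tame_v] pw by (intro integral_mono) auto
  also have "\<dots> = (ln s + B) * M n + E n / s\<^sup>2"
    using v_integrable tame_integrable_norm2[OF tame_v] by (simp add: M_def E_def)
  finally show ?thesis .
qed

text \<open>An upper bound on the mass. Outside the square of half-side \<open>s\<close> the
  logarithm is at least \<open>ln s\<close>, and the square itself holds mass at most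
  \<open>C * (2 * s)^2\<close>. The half-side will be slightly below \<open>sqrt n\<close>.\<close>

lemma Ms_ge:
  assumes s: "s \<ge> 1" and C: "\<And>x. v n x \<le> C"
  shows "ln s * (M n - C * (4 * s\<^sup>2)) - B * M n \<le> Ms"
proof -
  let ?Q = "cbox (- (s *\<^sub>R One)) (s *\<^sub>R One) :: plane set"
  have C0: "C \<ge> 0" using order_trans[OF v_nonneg C] .
  have "s \<ge> 0" using s by simp
  note Q = square_volume[OF this]
  have pw: "ln s * (v n x - C * indicator ?Q x) - B * v n x \<le> v n x * \<phi> x" for x
  proof (cases "x \<in> H")
    case True
    then show ?thesis using s C0 by (simp add: v_H)
  next
    case False
    have "ln s * (v n x - C * indicator ?Q x) \<le> v n x * ln (norm x)"
    proof (cases "x \<in> ?Q")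
      case True
      have "ln s * (v n x - C) \<le> 0" using s C[of x] by (intro mult_nonneg_nonpos) auto
      moreover have "0 \<le> v n x * ln (norm x)" using v_nonneg ln_norm_bounds[OF False] by simp
      ultimately show ?thesis using True by simp
    next
      case Q: False
      have "s \<le> norm x"
      proof (rule ccontr)
        assume "\<not> s \<le> norm x"
        then have "\<bar>x \<bullet> b\<bar> \<le> s" if "b \<in> Basis" for b
          using Basis_le_norm[OF that, of x] by linarith
        then have "x \<in> ?Q" by (auto simp: mem_box inner_sum_left_Basis abs_le_iff) (metis minus_le_iff)
        with Q show False by simp
      qed
      then have "ln s \<le> ln (norm x)" using s by (subst ln_le_cancel_iff) linarith+
      then show ?thesis using Q v_nonneg[of n x] by (simp add: mult.commute mult_right_mono)
    qed
    moreover have "v n x * ln (norm x) - B * v n x \<le> v n x * \<phi> x"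
    proof -
      have "ln (norm x) - B \<le> \<phi> x" using \<phi>_log[OF False] by linarith
      from mult_left_mono[OF this v_nonneg[of n x]] show ?thesis by (simp add: algebra_simps)
    qed
    ultimately show ?thesis by linarith
  qed
  have "ln s * (M n - C * (4 * s\<^sup>2)) - B * M n = (LINT x|lborel. ln s * (v n x - C * indicator ?Q x) - B * v n x)"
    using Q v_integrable by (simp add: M_def power_mult_distrib)
  also have "\<dots> \<le> (LINT x|lborel. v n x * \<phi> x)"
    using Q(1) v_integrable v_\<phi>_integrable pw by (intro integral_mono) auto
  finally show ?thesis by (simp add: v_\<phi>_conserved)
qed

text \<open>The scales \<open>sqrt n * ln n\<close> and \<open>sqrt n / ln n\<close> both have
  logarithm asymptotic to \<open>(ln n) / 2\<close>, and their logarithmic distance from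
  \<open>sqrt n\<close> makes the moment term of \<open>Ms_le\<close> and the central term of
  \<open>Ms_ge\<close> vanish in the limit.\<close>

lemma M_asymptotic: "(\<lambda>n. M n * ln (real n)) \<longlonglongrightarrow> 2 * Ms"
proof -
  obtain C where C: "C > 0" "\<And>n x. v n x \<le> C / (real n + 1)" using v_le by blast
  define A where "A = E 0 + 4 * q * M 0"
  let ?L = "\<lambda>n. ln (real n)"
  let ?D = "\<lambda>n. ?L n / 2 + ln (?L n) + B"
  let ?D' = "\<lambda>n. ?L n / 2 - ln (?L n) - B"
  show ?thesis
  proof (rule tendsto_sandwich)
    have ev: "eventually (\<lambda>n. ?L n > 0 \<and> ?D n > 0 \<and> ?D' n > 0 \<and> real n \<ge> 1 \<and> sqrt (real n) / ?L n \<ge> 1) sequentially"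
      by (intro eventually_conj) real_asymp+
    show "eventually (\<lambda>n. (Ms - A / (?L n)\<^sup>2) * (?L n / ?D n) \<le> M n * ?L n) sequentially"
      using ev
    proof eventually_elim
      case (elim n)
      then have L: "?L n > 0" and D: "?D n > 0" and n: "real n \<ge> 1" by auto
      define s where "s = sqrt (real n) * ?L n"
      have s: "s > 0" using L n by (simp add: s_def)
      have lns: "ln s = ?L n / 2 + ln (?L n)" using L n by (simp add: s_def ln_mult ln_sqrt)
      have "E n / s\<^sup>2 \<le> A * real n / s\<^sup>2"
        using E_le[of n] n mult_left_mono[OF n E_nonneg[of 0]] by (intro divide_right_mono) (auto simp: A_def algebra_simps)
      also have "\<dots> = A / (?L n)\<^sup>2" using n by (simp add: s_def power_mult_distrib)
      finally have "Ms - A / (?L n)\<^sup>2 \<le> ?D n * M n" using Ms_le[OF s, of n] unfolding lns by linarith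
      then have "(Ms - A / (?L n)\<^sup>2) / ?D n \<le> M n" using D by (simp add: pos_divide_le_eq mult.commute)
      from mult_right_mono[OF this less_imp_le[OF L]] show ?case by simp
    qed
    show "eventually (\<lambda>n. M n * ?L n \<le> (Ms + (?L n / 2 - ln (?L n)) * (4 * C / (?L n)\<^sup>2)) * (?L n / ?D' n)) sequentially"
      using ev
    proof eventually_elim
      case (elim n)
      then have L: "?L n > 0" and D: "?D' n > 0" and n: "real n \<ge> 1" and s1: "sqrt (real n) / ?L n \<ge> 1" by auto
      define s where "s = sqrt (real n) / ?L n"
      have lns: "ln s = ?L n / 2 - ln (?L n)" using L n by (simp add: s_def ln_div ln_sqrt)
      have lns0: "ln s \<ge> 0" using s1 by (simp add: s_def)
      have "v n x \<le> C / real n" for x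
        using order_trans[OF C(2)[of n x], of "C / real n"] C(1) n by (simp add: divide_left_mono)
      note ge = Ms_ge[OF s1[folded s_def] this]
      have eq: "C / real n * (4 * s\<^sup>2) = 4 * C / (?L n)\<^sup>2" using n by (simp add: s_def power_divide)
      from ge have "?D' n * M n \<le> Ms + (?L n / 2 - ln (?L n)) * (4 * C / (?L n)\<^sup>2)"
        unfolding lns eq by (simp add: algebra_simps)
      then have "M n \<le> (Ms + (?L n / 2 - ln (?L n)) * (4 * C / (?L n)\<^sup>2)) / ?D' n"
        using D by (simp add: pos_le_divide_eq mult.commute)
      from mult_right_mono[OF this less_imp_le[OF L]] show ?case by simp
    qed
    have l1: "(\<lambda>n. ?L n / ?D n) \<longlonglongrightarrow> 2" "(\<lambda>n. ?L n / ?D' n) \<longlonglongrightarrow> 2" by real_asymp+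
    have l2: "(\<lambda>n. 1 / (?L n)\<^sup>2) \<longlonglongrightarrow> 0" "(\<lambda>n. (?L n / 2 - ln (?L n)) * (1 / (?L n)\<^sup>2)) \<longlonglongrightarrow> 0" by real_asymp+
    have "(\<lambda>n. (Ms - A * (1 / (?L n)\<^sup>2)) * (?L n / ?D n)) \<longlonglongrightarrow> (Ms - A * 0) * 2"
      by (intro tendsto_intros l1 l2)
    then show "(\<lambda>n. (Ms - A / (?L n)\<^sup>2) * (?L n / ?D n)) \<longlonglongrightarrow> 2 * Ms" by (simp add: mult.commute)
    have "(\<lambda>n. (Ms + 4 * C * ((?L n / 2 - ln (?L n)) * (1 / (?L n)\<^sup>2))) * (?L n / ?D' n)) \<longlonglongrightarrow> (Ms + 4 * C * 0) * 2"
      by (intro tendsto_intros l1 l2)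
    then show "(\<lambda>n. (Ms + (?L n / 2 - ln (?L n)) * (4 * C / (?L n)\<^sup>2)) * (?L n / ?D' n)) \<longlonglongrightarrow> 2 * Ms"
      by (simp add: mult_ac)
  qed
qed

lemma M_log_bound:
  obtains C where "C > 0" "\<And>n. n \<ge> 2 \<Longrightarrow> M n \<le> C / ln (real n)"
proof -
  have "Bseq (\<lambda>n. M n * ln (real n))"
    using M_asymptotic convergent_imp_Bseq convergentI by blast
  then obtain C where C: "C > 0" "\<And>n. norm (M n * ln (real n)) \<le> C" unfolding Bseq_def by blast
  have "M n \<le> C / ln (real n)" if "n \<ge> 2" for n
    using C(2)[of n] that M_nonneg[of n] by (simp add: pos_le_divide_eq)
  then show ?thesis using that C by blast
qed

text \<open>Each step adds only \<open>4 * q * M k\<close> to the second moment, and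
  \<open>M k = O(1 / ln k)\<close> sums to O(n / ln n). The gained logarithm is what makes the
  spreading error in \<open>far_field\<close> negligible.\<close>

lemma E_log_bound:
  obtains C where "C > 0" "\<And>n. n \<ge> 2 \<Longrightarrow> E n \<le> C * real n / ln (real n)"
proof -
  obtain C1 where C1: "C1 > 0" "\<And>n. n \<ge> 2 \<Longrightarrow> M n \<le> C1 / ln (real n)" using M_log_bound by blast
  have sum: "(\<Sum>k<n. M k) \<le> (M 0 * 3 * sqrt n) + 2 * C1 * real n / ln (real n)" if n: "n \<ge> 2" for n
  proof -
    have L: "ln (real n) > 0" using n by simp
    \<comment> \<open>Indices up to \<open>sqrt n\<close> are few and bounded by \<open>M 0\<close>;
      beyond them \<open>ln k \<ge> (ln n) / 2\<close>. The indices 0 and 1 are included because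
      \<open>M_log_bound\<close> starts at 2.\<close>
    define S where "S = {k. k < n \<and> (k < 2 \<or> real k \<le> sqrt n)}"
    have pw: "M k \<le> M 0 * indicator S k + 2 * C1 / ln (real n)" if "k < n" for k
    proof (cases "k \<in> S")
      case True
      have "0 \<le> 2 * C1 / ln (real n)" using C1 L by simp
      then show ?thesis using True M_antimono[of 0 k] by simp
    next
      case False
      then have k: "k \<ge> 2" "real k \<ge> sqrt n" using that by (auto simp: S_def)
      have "ln (real n) / 2 = ln (sqrt n)" using n by (simp add: ln_sqrt)
      also have "\<dots> \<le> ln (real k)" using k n by (subst ln_le_cancel_iff) auto
      finally have "C1 / ln (real k) \<le> C1 / (ln (real n) / 2)" using C1 L by (intro divide_left_mono) auto
      then show ?thesis using C1(2)[OF k(1)] False by (simp add: mult.commute)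
    qed
    have "S \<subseteq> {..nat \<lfloor>sqrt n\<rfloor>} \<union> {..1}"
      by (auto simp: S_def le_nat_floor)
    then have "card S \<le> card ({..nat \<lfloor>sqrt n\<rfloor>} \<union> {..1})" by (intro card_mono) auto
    also have "{..nat \<lfloor>sqrt n\<rfloor>} \<union> {..1} = {..nat \<lfloor>sqrt n\<rfloor>}"
    proof -
      have "1 \<le> sqrt n" using n by simp
      then have "1 \<le> nat \<lfloor>sqrt n\<rfloor>" by (simp add: le_nat_iff le_floor_iff)
      then show ?thesis by auto
    qed
    finally have "card S \<le> nat \<lfloor>sqrt n\<rfloor> + 1" by simp
    then have "real (card S) \<le> real (nat \<lfloor>sqrt n\<rfloor> + 1)" by (rule of_nat_mono)
    also have "\<dots> \<le> 3 * sqrt n"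
    proof -
      have "real (nat \<lfloor>sqrt n\<rfloor>) \<le> sqrt n" by (simp add: of_nat_floor)
      moreover have "1 \<le> sqrt n" using n by simp
      ultimately show ?thesis unfolding of_nat_add of_nat_1 by linarith
    qed
    finally have cS: "real (card S) \<le> 3 * sqrt n" .
    have "(\<Sum>k<n. M k) \<le> (\<Sum>k<n. M 0 * indicator S k + 2 * C1 / ln (real n))" by (intro sum_mono pw) simp
    also have "\<dots> = M 0 * (\<Sum>k<n. indicator S k) + real n * (2 * C1 / ln (real n))"
      by (simp add: sum.distrib sum_distrib_left)
    also have "(\<Sum>k<n. indicator S k :: real) = real (card S)"
    proof -
      have "{..<n} \<inter> S = S" by (auto simp: S_def)
      then show ?thesis unfolding indicator_def by (simp add: sum.If_cases)
    qed
    also have "M 0 * real (card S) \<le> M 0 * (3 * sqrt n)" using cS M_nonneg[of 0] by (intro mult_left_mono)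
    finally show ?thesis by (simp add: mult_ac)
  qed
  define C where "C = 2 * E 0 + 4 * q * (M 0 * 6 + 2 * C1)"
  have "E n \<le> C * real n / ln (real n)" if n: "n \<ge> 2" for n
  proof -
    have L: "ln (real n) > 0" using n by simp
    have sq: "sqrt n \<le> 2 * real n / ln (real n)"
    proof -
      have "ln (real n) = 2 * ln (sqrt n)" using n by (simp add: ln_sqrt)
      also have "\<dots> \<le> 2 * sqrt n" using n ln_bound[of "sqrt n"] by simp
      finally have "ln (real n) * sqrt n \<le> 2 * sqrt n * sqrt n" by (intro mult_right_mono) auto
      also have "2 * sqrt n * sqrt n = 2 * real n" by simp
      finally show ?thesis using L by (simp add: pos_le_divide_eq mult.commute)
    qed
    have "1 \<le> sqrt n" using n by simp
    then have one: "1 \<le> 2 * real n / ln (real n)" using sq by linarith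
    have "E n \<le> E 0 * 1 + 4 * q * ((M 0 * 3) * sqrt n + 2 * C1 * real n / ln (real n))"
    proof -
      have "4 * q * (\<Sum>k<n. M k) \<le> 4 * q * (M 0 * 3 * sqrt n + 2 * C1 * real n / ln (real n))"
        using q_pos by (intro mult_left_mono sum[OF n]) simp
      then show ?thesis using E_le_sum[of n] unfolding mult_1_right by linarith
    qed
    also have "\<dots> \<le> E 0 * (2 * real n / ln (real n)) + 4 * q * ((M 0 * 3) * (2 * real n / ln (real n)) + 2 * C1 * real n / ln (real n))"
      using one sq q_pos M_nonneg[of 0] E_nonneg[of 0] by (intro add_mono mult_left_mono) auto
    also have "\<dots> = C * real n / ln (real n)" by (simp add: C_def algebra_simps add_divide_distrib)
    finally show ?thesis .
  qed
  moreover have "C > 0" using E_nonneg[of 0] M_nonneg[of 0] C1 q_pos by (auto simp: C_def intro!: add_nonneg_pos mult_pos_pos)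
  ultimately show ?thesis using that by blast
qed

end

subsection \<open>Absorption and spreading\<close>

text \<open>Mean value inequality in time. The dependence on \<open>x\<close> enters the derivative
  only through \<open>y * exp (- y) \<le> 1\<close> with \<open>y = b / r\<close>, so the rate
  O(1/r^2) is uniform in \<open>x\<close>.\<close>

lemma heat_kernel_time_diff:
  assumes "q > 0" "0 < m" "m \<le> s" "m \<le> t"
  shows "\<bar>heat_kernel2 q x s - heat_kernel2 q x t\<bar> \<le> 1 / (2 * pi * q) * \<bar>s - t\<bar> / m\<^sup>2"
proof -
  define b where "b = (norm x)\<^sup>2 / (4 * q)"
  have b: "b \<ge> 0" using assms by (simp add: b_def)
  let ?f = "\<lambda>r. 1 / (4 * pi * q * r) * exp (- b / r)"
  let ?f' = "\<lambda>r. 1 / (4 * pi * q) * (- (1 / r\<^sup>2) + b / r ^ 3) * exp (- b / r)"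
  have f: "heat_kernel2 q x r = ?f r" for r using assms by (simp add: heat_kernel2_def b_def)
  have deriv: "(?f has_real_derivative ?f' r) (at r within {m..})" if "r \<in> {m..}" for r
    using that assms
    by (auto intro!: derivative_eq_intros simp: field_simps power2_eq_square power3_eq_cube)
  have bound: "norm (?f' r) \<le> 1 / (2 * pi * q) / m\<^sup>2" if "r \<in> {m..}" for r
  proof -
    have r: "r \<ge> m" "r > 0" using that assms by auto
    have "b / r * exp (- b / r) \<le> 1"
    proof -
      have "b / r \<le> exp (b / r)" using exp_ge_add_one_self[of "b / r"] by linarith
      then have "b / r * exp (- b / r) \<le> exp (b / r) * exp (- b / r)" by (intro mult_right_mono) auto
      then show ?thesis by (simp flip: exp_add)
    qed
    moreover have "exp (- b / r) \<le> 1" using b r by simp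
    moreover have "0 \<le> b / r * exp (- b / r)" using b r by simp
    ultimately have "\<bar>- exp (- b / r) + b / r * exp (- b / r)\<bar> \<le> 2" using exp_gt_zero[of "- b / r"] by linarith
    moreover have "?f' r = 1 / (4 * pi * q) * (1 / r\<^sup>2) * (- exp (- b / r) + b / r * exp (- b / r))"
      using r assms by (simp add: field_simps power2_eq_square power3_eq_cube)
    ultimately have "\<bar>?f' r\<bar> \<le> 1 / (4 * pi * q) * (1 / r\<^sup>2) * 2"
      using assms by (simp only: abs_mult) (intro mult_mono, auto)
    also have "\<dots> \<le> 1 / (4 * pi * q) * (1 / m\<^sup>2) * 2"
      using r assms by (intro mult_right_mono mult_left_mono divide_left_mono power_mono) auto
    finally show ?thesis by simp
  qed
  have "norm (?f s - ?f t) \<le> 1 / (2 * pi * q) / m\<^sup>2 * norm (s - t)"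
    by (rule field_differentiable_bound[of "{m..}" ?f ?f']) (use deriv bound assms in auto)
  then show ?thesis unfolding f by simp
qed

lemma heat_kernel_bounds:
  assumes "q > 0" "t > 0"
  shows heat_kernel_nonneg: "0 \<le> heat_kernel2 q x t" and heat_kernel_le: "heat_kernel2 q x t \<le> 1 / (4 * pi * q) / t"
proof -
  show "0 \<le> heat_kernel2 q x t" using assms by (simp add: heat_kernel2_def)
  have "exp (- (norm x)\<^sup>2 / (4 * q * t)) \<le> 1" using assms by simp
  then have "1 / (4 * pi * q * t) * exp (- (norm x)\<^sup>2 / (4 * q * t)) \<le> 1 / (4 * pi * q * t) * 1"
    using assms by (intro mult_left_mono) auto
  then show "heat_kernel2 q x t \<le> 1 / (4 * pi * q) / t" by (simp add: heat_kernel2_def)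
qed

context radial_kernel begin

lemma tame_add: assumes "tame f" "tame g" shows "tame (\<lambda>x. f x + g x)"
proof -
  obtain C D where "\<And>x. f x \<le> C" "\<And>x. g x \<le> D" using tame_bounded assms by metis
  then have "\<And>x. f x + g x \<le> C + D" by (simp add: add_mono)
  then show ?thesis
    using assms unfolding tame_def by (auto simp: distrib_right)
qed

lemma tame_sum: "finite I \<Longrightarrow> (\<And>i. i \<in> I \<Longrightarrow> tame (g i)) \<Longrightarrow> tame (\<lambda>x. \<Sum>i\<in>I. g i x)"
proof (induction I rule: finite_induct)
  case empty
  then show ?case by (auto simp: tame_def)
next
  case (insert i I)
  then show ?case by (simp add: tame_add)
qed

lemma conv_add:
  assumes "tame f" "tame g" shows "conv J (\<lambda>x. f x + g x) x = conv J f x + conv J g x"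
  using conv_integrable[OF tame_J assms(1)] conv_integrable[OF tame_J assms(2)]
  by (simp add: conv_def distrib_left)

lemma conv_sum:
  assumes "\<And>i. i \<in> I \<Longrightarrow> tame (g i)"
  shows "conv J (\<lambda>x. \<Sum>i\<in>I. g i x) x = (\<Sum>i\<in>I. conv J (g i) x)"
  unfolding conv_def sum_distrib_left using assms
  by (intro Bochner_Integration.integral_sum conv_integrable tame_J)

end

context exterior_walk begin

text \<open>Density of the mass absorbed in step \<open>n + 1\<close>.\<close>

definition f :: "nat \<Rightarrow> plane \<Rightarrow> real" where "f n = (\<lambda>x. indicator H x * conv J (v n) x)"

lemma tame_f: "tame (f n)"
  unfolding f_def by (intro tame_indicator tame_conv tame_v) simp

lemma conv_v: "conv J (v n) x = v (Suc n) x + f n x"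
  by (auto simp: f_def indicator_def)

lemma f_mass: "(LINT x|lborel. f n x) = M n - M (Suc n)"
proof -
  have "M n = (LINT x|lborel. v (Suc n) x + f n x)"
    unfolding conv_v[symmetric] by (simp add: conv_mass[OF tame_v] M_def)
  also have "\<dots> = M (Suc n) + (LINT x|lborel. f n x)"
    unfolding M_def by (rule Bochner_Integration.integral_add[OF v_integrable tame_integrable[OF tame_f]])
  finally show ?thesis by simp
qed

text \<open>A discrete Duhamel formula: the free walk from time \<open>m\<close> is the killed walk
  plus all absorbed portions, each released at its step of absorption and continued freely. The
  portion from step \<open>m + i + 1\<close> has \<open>j - Suc i\<close> steps left.\<close>

lemma duhamel: "(conv J ^^ j) (v m) x = v (m + j) x + (\<Sum>i<j. (conv J ^^ (j - Suc i)) (f (m + i)) x)"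
proof (induction j arbitrary: x)
  case (Suc j)
  let ?g = "\<lambda>i. (conv J ^^ (j - Suc i)) (f (m + i))"
  have t: "tame (\<lambda>x. \<Sum>i<j. ?g i x)" by (intro tame_sum tame_funpow tame_f) simp
  have "(conv J ^^ Suc j) (v m) x = conv J (\<lambda>x. v (m + j) x + (\<Sum>i<j. ?g i x)) x"
    by (simp add: Suc.IH[abs_def])
  also have "\<dots> = v (m + Suc j) x + f (m + j) x + (\<Sum>i<j. conv J (?g i) x)"
    by (simp only: conv_add[OF tame_v t] conv_sum tame_funpow tame_f conv_v add_Suc_right)
  also have "(\<Sum>i<j. conv J (?g i) x) = (\<Sum>i<j. (conv J ^^ (Suc j - Suc i)) (f (m + i)) x)"
  proof (intro sum.cong refl)
    fix i assume "i \<in> {..<j}"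
    then have "Suc j - Suc i = Suc (j - Suc i)" by simp
    then show "conv J (?g i) x = (conv J ^^ (Suc j - Suc i)) (f (m + i)) x" by simp
  qed
  also have "v (m + Suc j) x + f (m + j) x + (\<Sum>i<j. (conv J ^^ (Suc j - Suc i)) (f (m + i)) x) =
    v (m + Suc j) x + (\<Sum>i<Suc j. (conv J ^^ (Suc j - Suc i)) (f (m + i)) x)" by simp
  finally show ?case .
qed simp

text \<open>Absorbed mass restarts from the hole, at distance at least \<open>|x| / 2\<close> from
  \<open>x\<close>. By \<open>p_offdiagonal\<close> every portion contributes at most
  \<open>4 * C / |x|^2\<close> times its mass, whatever time is left to it, and the masses
  telescope.\<close>

lemma absorbed_far:
  obtains C where "C > 0" "\<And>m j x. j \<ge> 1 \<Longrightarrow> norm x \<ge> 2 * R \<Longrightarrow>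
    \<bar>conv (p j) (v m) x - v (m + j) x\<bar> \<le> C / (norm x)\<^sup>2 * (M m - M (m + j))"
proof -
  obtain C where C: "C > 0" "\<And>n x. n \<ge> 1 \<Longrightarrow> p n x * (norm x)\<^sup>2 \<le> C" using p_offdiagonal by blast
  have "\<bar>conv (p j) (v m) x - v (m + j) x\<bar> \<le> 4 * C / (norm x)\<^sup>2 * (M m - M (m + j))"
    if j: "j \<ge> 1" and x: "norm x \<ge> 2 * R" for m j x
  proof -
    have xH: "x \<notin> H" using x H_bounded R_pos by auto
    have nx: "norm x > 0" using x R_pos by linarith
    have summand: "(conv J ^^ (j - Suc i)) (f (m + i)) x \<le> 4 * C / (norm x)\<^sup>2 * (M (m + i) - M (Suc (m + i)))"
      if "i < j" for i
    proof (cases "j - Suc i")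
      \<comment> \<open>With no step left the summand is the absorbed density itself, which vanishes
        off the hole; \<open>p\<close> has no valid value at 0 to represent this case.\<close>
      case 0
      have "0 \<le> 4 * C / (norm x)\<^sup>2 * (M (m + i) - M (Suc (m + i)))" using C M_Suc[of "m + i"] by simp
      then show ?thesis using xH 0 by (simp add: f_def)
    next
      case (Suc l)
      have "conv (p (Suc l)) (f (m + i)) x \<le> (LINT y|lborel. 4 * C / (norm x)\<^sup>2 * f (m + i) y)"
        unfolding conv_def
      proof (rule integral_mono[OF conv_integrable[OF tame_p tame_f]])
        show "integrable lborel (\<lambda>y. 4 * C / (norm x)\<^sup>2 * f (m + i) y)" using tame_integrable[OF tame_f] by simp
        fix y
        show "p (Suc l) (x - y) * f (m + i) y \<le> 4 * C / (norm x)\<^sup>2 * f (m + i) y"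
        proof (cases "y \<in> H")
          case True
          then have "norm y < R" using H_bounded by auto
          then have "norm x \<le> 2 * norm (x - y)" using norm_triangle_ineq2[of x y] x by linarith
          then have "(norm x)\<^sup>2 \<le> 4 * (norm (x - y))\<^sup>2" using power_mono[of "norm x" "2 * norm (x - y)" 2] by (simp add: power_mult_distrib)
          then have "p (Suc l) (x - y) * (norm x)\<^sup>2 \<le> p (Suc l) (x - y) * (4 * (norm (x - y))\<^sup>2)"
            by (intro mult_left_mono p_nonneg)
          also have "\<dots> \<le> 4 * C" using C(2)[of "Suc l" "x - y"] by simp
          finally have "p (Suc l) (x - y) \<le> 4 * C / (norm x)\<^sup>2" using nx by (simp add: pos_le_divide_eq)
          then show ?thesis by (intro mult_right_mono tame_nonneg[OF tame_f])
        qed (simp add: f_def)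
      qed
      then show ?thesis using Suc funpow_conv[OF tame_f, of "Suc l" "m + i"] by (simp add: f_mass)
    qed
    have "conv (p j) (v m) x - v (m + j) x = (\<Sum>i<j. (conv J ^^ (j - Suc i)) (f (m + i)) x)"
      using duhamel[of j m x] funpow_conv[OF tame_v j, of m] by simp
    moreover have "0 \<le> (\<Sum>i<j. (conv J ^^ (j - Suc i)) (f (m + i)) x)"
      by (intro sum_nonneg tame_nonneg tame_funpow tame_f)
    moreover have "(\<Sum>i<j. (conv J ^^ (j - Suc i)) (f (m + i)) x) \<le> (\<Sum>i<j. 4 * C / (norm x)\<^sup>2 * (M (m + i) - M (Suc (m + i))))"
      by (intro sum_mono summand) simp
    moreover have "(\<Sum>i<j. 4 * C / (norm x)\<^sup>2 * (M (m + i) - M (Suc (m + i)))) = 4 * C / (norm x)\<^sup>2 * (M m - M (m + j))"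
      unfolding sum_distrib_left[symmetric] using sum_lessThan_telescope'[of "\<lambda>i. M (m + i)" j] by simp
    ultimately show ?thesis by linarith
  qed
  then show ?thesis using that[of "4 * C"] C by auto
qed

text \<open>From \<open>|y| \<le> |y|^2 / s + s\<close>. The choice \<open>s = sqrt m\<close> in
  \<open>free_spreading\<close> makes both terms O(sqrt m / ln m).\<close>

lemma v_first_moment:
  assumes "s > 0"
  shows "integrable lborel (\<lambda>y. v m y * norm y)" "(LINT y|lborel. v m y * norm y) \<le> E m / s + s * M m"
proof -
  have ab: "norm y \<le> (norm y)\<^sup>2 / s + s" for y :: plane
  proof -
    have "0 \<le> (norm y - s / 2)\<^sup>2 + 3 / 4 * s\<^sup>2" by simp
    then have "norm y * s \<le> (norm y)\<^sup>2 + s * s" by (simp add: power2_eq_square algebra_simps)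
    then show ?thesis using assms by (simp add: field_simps)
  qed
  have "norm y \<le> 1 * (1 + (norm y)\<^sup>2)" for y :: plane
  proof -
    have "0 \<le> (norm y - 1)\<^sup>2" by simp
    then have "2 * norm y \<le> 1 * (1 + (norm y)\<^sup>2)" by (simp add: power2_eq_square algebra_simps)
    then show ?thesis using norm_ge_zero[of y] by linarith
  qed
  then show I: "integrable lborel (\<lambda>y. v m y * norm y)"
    using tame_integrable_le[OF tame_v, of norm 1 m] by simp
  have I2: "integrable lborel (\<lambda>y. (1 / s) * (v m y * (norm y)\<^sup>2) + s * v m y)"
    using v_integrable tame_integrable_norm2[OF tame_v] by simp
  have "(LINT y|lborel. v m y * norm y) \<le> (LINT y|lborel. (1 / s) * (v m y * (norm y)\<^sup>2) + s * v m y)"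
    using mult_left_mono[OF ab v_nonneg] by (intro integral_mono[OF I I2]) (simp add: algebra_simps)
  also have "\<dots> = E m / s + s * M m"
    using v_integrable tame_integrable_norm2[OF tame_v] by (simp add: E_def M_def)
  finally show "(LINT y|lborel. v m y * norm y) \<le> E m / s + s * M m" .
qed

text \<open>Replacing \<open>p j (x - y)\<close> by \<open>p j x\<close> costs the first moment of
  \<open>v m\<close> times the spatial Lipschitz rate \<open>j powr (-3/2)\<close>, plus the
  high-frequency remainder of \<open>p_diff_le\<close>.\<close>

lemma free_spreading:
  obtains C where "C > 0" "\<And>m j x. m \<ge> 2 \<Longrightarrow> j \<ge> 2 \<Longrightarrow>
    \<bar>conv (p j) (v m) x - M m * p j x\<bar> \<le> C * (sqrt (real m) / (ln (real m) * (real j * sqrt (real j))) + 1 / (real j)\<^sup>2)"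
proof -
  obtain Cp where Cp: "Cp > 0"
    "\<And>n x y. n \<ge> 2 \<Longrightarrow> \<bar>p n x - p n y\<bar> \<le> Cp * (norm (x - y) / (real n * sqrt (real n)) + 1 / (real n)\<^sup>2)"
    using p_diff_le by blast
  obtain CM where CM: "CM > 0" "\<And>n. n \<ge> 2 \<Longrightarrow> M n \<le> CM / ln (real n)" using M_log_bound by blast
  obtain CE where CE: "CE > 0" "\<And>n. n \<ge> 2 \<Longrightarrow> E n \<le> CE * real n / ln (real n)" using E_log_bound by blast
  define C where "C = Cp * (CE + CM) + Cp * M 0"
  have "\<bar>conv (p j) (v m) x - M m * p j x\<bar> \<le> C * (sqrt (real m) / (ln (real m) * (real j * sqrt (real j))) + 1 / (real j)\<^sup>2)"
    if m: "m \<ge> 2" and j: "j \<ge> 2" for m j x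
  proof -
    have L: "ln (real m) > 0" using m by simp
    have sm: "sqrt (real m) > 0" using m by simp
    have fm: "(LINT y|lborel. v m y * norm y) \<le> (CE + CM) * sqrt m / ln m"
    proof -
      have "(LINT y|lborel. v m y * norm y) \<le> E m / sqrt m + sqrt m * M m" by (rule v_first_moment(2)[OF sm])
      also have "\<dots> \<le> CE * m / ln m / sqrt m + sqrt m * (CM / ln m)"
        using CE(2)[OF m] CM(2)[OF m] sm by (intro add_mono divide_right_mono mult_left_mono) auto
      also have "CE * m / ln m / sqrt m = CE * sqrt m / ln m"
        using L m by (simp add: field_simps)
      finally show ?thesis by (simp add: algebra_simps add_divide_distrib)
    qed
    have "conv (p j) (v m) x - p j x * M m = (LINT y|lborel. (p j (x - y) - p j x) * v m y)"
      using conv_integrable[OF tame_p tame_v, of j x m] v_integrable[of m]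
      by (simp add: conv_def M_def left_diff_distrib)
    then have "\<bar>conv (p j) (v m) x - M m * p j x\<bar> \<le> (LINT y|lborel. \<bar>(p j (x - y) - p j x) * v m y\<bar>)"
      using integral_abs_bound[of lborel "\<lambda>y. (p j (x - y) - p j x) * v m y"] by (simp add: mult.commute)
    also have "\<dots> \<le> (LINT y|lborel. Cp / (real j * sqrt j) * (v m y * norm y) + Cp / (real j)\<^sup>2 * v m y)"
    proof (rule integral_mono)
      have "integrable lborel (\<lambda>y. (p j (x - y) - p j x) * v m y)"
        using conv_integrable[OF tame_p tame_v, of j x m] v_integrable[of m] by (simp add: left_diff_distrib)
      then show "integrable lborel (\<lambda>y. \<bar>(p j (x - y) - p j x) * v m y\<bar>)" by (rule integrable_abs)
      show "integrable lborel (\<lambda>y. Cp / (real j * sqrt j) * (v m y * norm y) + Cp / (real j)\<^sup>2 * v m y)"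
        using v_first_moment(1)[OF sm] v_integrable by simp
      fix y
      have "\<bar>p j (x - y) - p j x\<bar> * v m y \<le> Cp * (norm (x - y - x) / (real j * sqrt j) + 1 / (real j)\<^sup>2) * v m y"
        by (intro mult_right_mono Cp(2)[OF j] v_nonneg)
      then show "\<bar>(p j (x - y) - p j x) * v m y\<bar> \<le> Cp / (real j * sqrt j) * (v m y * norm y) + Cp / (real j)\<^sup>2 * v m y"
        unfolding abs_mult abs_of_nonneg[OF v_nonneg] by (simp add: algebra_simps)
    qed
    also have "\<dots> = Cp / (real j * sqrt j) * (LINT y|lborel. v m y * norm y) + Cp / (real j)\<^sup>2 * M m"
      using v_first_moment(1)[OF sm] v_integrable by (simp add: M_def)
    also have "\<dots> \<le> Cp / (real j * sqrt j) * ((CE + CM) * sqrt m / ln m) + Cp / (real j)\<^sup>2 * M 0"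
      using fm Cp M_antimono[of 0 m] by (intro add_mono mult_left_mono) auto
    also have "\<dots> = Cp * (CE + CM) * (sqrt m / (ln m * (real j * sqrt j))) + Cp * M 0 * (1 / (real j)\<^sup>2)"
      using L j by (simp add: field_simps)
    also have "\<dots> \<le> C * (sqrt m / (ln m * (real j * sqrt j))) + C * (1 / (real j)\<^sup>2)"
      using L Cp CM CE M_nonneg[of 0] by (intro add_mono mult_right_mono) (auto simp: C_def)
    finally show ?thesis by (simp add: distrib_left)
  qed
  moreover have "C > 0" using Cp CE CM M_nonneg[of 0] by (auto simp: C_def intro!: add_pos_nonneg mult_pos_pos)
  ultimately show ?thesis using that by blast
qed

end

subsection \<open>Far field of the killed walk\<close>

context exterior_walk begin

text \<open>Split at time \<open>m \<approx> n / ln n\<close>: then \<open>ln m \<sim> ln n\<close>, so almost no mass is absorbed between \<open>m\<close>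
  and \<open>n\<close>, while at time \<open>m\<close> the mass sits at distance \<open>sqrt m = o(sqrt n)\<close> from the origin.\<close>

lemma far_field:
  assumes \<delta>: "\<delta> > 0" and \<epsilon>: "\<epsilon> > 0"
  shows "eventually (\<lambda>n. \<forall>x. norm x \<ge> \<delta> * sqrt (real n) \<longrightarrow>
    \<bar>v n x - 2 * Ms * (heat_kernel2 q x (real n) / ln (real n))\<bar> \<le> \<epsilon> / (real n * ln (real n))) sequentially"
proof -
  obtain CA where CA: "CA > 0" "\<And>m j x. j \<ge> 1 \<Longrightarrow> norm x \<ge> 2 * R \<Longrightarrow>
    \<bar>conv (p j) (v m) x - v (m + j) x\<bar> \<le> CA / (norm x)\<^sup>2 * (M m - M (m + j))"
    using absorbed_far by blast
  obtain CS where CS: "CS > 0" "\<And>m j x. m \<ge> 2 \<Longrightarrow> j \<ge> 2 \<Longrightarrow>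
    \<bar>conv (p j) (v m) x - M m * p j x\<bar> \<le> CS * (sqrt (real m) / (ln (real m) * (real j * sqrt (real j))) + 1 / (real j)\<^sup>2)"
    using free_spreading by blast
  obtain CL where CL: "CL > 0"
    "\<And>n x. n \<ge> 2 \<Longrightarrow> \<bar>p n x - heat_kernel2 q x (real n)\<bar> \<le> CL / (real n * sqrt (real n))"
    using local_limit by blast
  define CG where "CG = 1 / (2 * pi * q)"
  define G0 where "G0 = 1 / (4 * pi * q)"
  have CG: "CG > 0" "G0 > 0" using q_pos by (simp_all add: CG_def G0_def)
  define m where "m n = nat \<lfloor>real n / ln (real n)\<rfloor>" for n :: nat
  let ?L = "\<lambda>n::nat. ln (real n)"
  \<comment> \<open>The five errors multiplied by \<open>n * ln n\<close>: absorption between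
    \<open>m\<close> and \<open>n\<close>, spreading of \<open>v m\<close>, local limit theorem,
    time shift of the heat kernel from \<open>n - m\<close> to \<open>n\<close>, and the limit of
    the mass. Each summand tends to 0.\<close>
  define err where "err n = CA / \<delta>\<^sup>2 * (M (m n) * ?L n - M n * ?L n)
     + CS * (4 * (sqrt (real (m n) / real n) * (?L n / ?L (m n))) + 4 * (?L n / real n))
     + 4 * M 0 * CL * (?L n / sqrt (real n)) + 4 * CG * (M (m n) * ?L n * (real (m n) / real n))
     + G0 * \<bar>M (m n) * ?L n - 2 * Ms\<bar>" for n
  have m_lim: "filterlim m at_top sequentially" unfolding m_def by real_asymp
  have m_div: "(\<lambda>n. real (m n) / real n) \<longlonglongrightarrow> 0" unfolding m_def by real_asymp
  have m_ln: "(\<lambda>n. ?L n / ?L (m n)) \<longlonglongrightarrow> 1" unfolding m_def by real_asymp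
  have Mm: "(\<lambda>n. M (m n) * ?L n) \<longlonglongrightarrow> 2 * Ms"
  proof -
    have "(\<lambda>n. M (m n) * ?L (m n) * (?L n / ?L (m n))) \<longlonglongrightarrow> 2 * Ms * 1"
      using filterlim_compose[OF M_asymptotic m_lim] by (rule tendsto_mult[OF _ m_ln])
    moreover have "eventually (\<lambda>n. m n \<ge> 2) sequentially" using m_lim by (simp add: filterlim_at_top)
    then have "eventually (\<lambda>n. M (m n) * ?L (m n) * (?L n / ?L (m n)) = M (m n) * ?L n) sequentially"
      by eventually_elim simp
    ultimately show ?thesis by (simp add: filterlim_cong)
  qed
  have sq: "(\<lambda>n. sqrt (real (m n) / real n)) \<longlonglongrightarrow> sqrt 0" by (intro tendsto_real_sqrt m_div)
  have "err \<longlonglongrightarrow> CA / \<delta>\<^sup>2 * (2 * Ms - 2 * Ms) + CS * (4 * (sqrt 0 * 1) + 4 * 0)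
     + 4 * M 0 * CL * 0 + 4 * CG * (2 * Ms * 0) + G0 * \<bar>2 * Ms - 2 * Ms\<bar>"
    unfolding err_def[abs_def]
    by (intro tendsto_intros Mm M_asymptotic sq m_ln m_div) real_asymp+
  then have "err \<longlonglongrightarrow> 0" by simp
  then have e1: "eventually (\<lambda>n. err n < \<epsilon>) sequentially" using \<epsilon> by (simp add: order_tendsto_iff)
  have e2: "eventually (\<lambda>n. m n \<ge> 2) sequentially" using m_lim by (simp add: filterlim_at_top)
  have e3: "eventually (\<lambda>n. real (m n) / real n < 1/2) sequentially" by (rule order_tendstoD(2)[OF m_div]) simp
  have e4: "eventually (\<lambda>n::nat. \<delta> * sqrt (real n) \<ge> 2 * R) sequentially" using \<delta> by real_asymp
  have e5: "eventually (\<lambda>n::nat. n \<ge> 4) sequentially" by (rule eventually_ge_at_top)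
  show ?thesis using e1 e2 e3 e4 e5
  proof eventually_elim
    case (elim n)
    define k where "k = m n"
    define j where "j = n - k"
    have n: "real n \<ge> 4" "real n > 0" using elim by auto
    have L: "?L n > 0" using elim by simp
    have k: "k \<ge> 2" "2 * real k < real n" using elim n by (auto simp: k_def field_simps)
    have jk: "k + j = n" "real j = real n - real k" using k by (auto simp: j_def)
    have j: "real j \<ge> real n / 2" "j \<ge> 2" "real j \<le> real n" "real j > 0" using jk k n by auto
    have Lk: "?L k > 0" using k by simp
    have jj: "1 / (real j)\<^sup>2 \<le> 4 / (real n)\<^sup>2"
    proof -
      have "(real n / 2)\<^sup>2 \<le> (real j)\<^sup>2" using j n by (intro power_mono) auto
      then show ?thesis using n j by (simp add: field_simps power_divide)
    qed
    have js: "1 / (real j * sqrt j) \<le> 4 / (real n * sqrt n)"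
    proof -
      have "sqrt n / 2 = sqrt (real n / 4)" by (simp add: real_sqrt_divide)
      also have "\<dots> \<le> sqrt j" using j n by (intro real_sqrt_le_mono) auto
      finally have "(real n / 2) * (sqrt n / 2) \<le> real j * sqrt j" using j n by (intro mult_mono) auto
      then show ?thesis using n j by (simp add: field_simps)
    qed
    show ?case
    proof (intro allI impI)
      fix x :: plane assume x: "norm x \<ge> \<delta> * sqrt (real n)"
      let ?G = "\<lambda>t. heat_kernel2 q x t"
      have x2: "norm x \<ge> 2 * R" using x elim by linarith
      have xn: "(norm x)\<^sup>2 \<ge> \<delta>\<^sup>2 * real n"
        using power_mono[OF x, of 2] \<delta> by (simp add: power_mult_distrib)
      have t1: "\<bar>conv (p j) (v k) x - v n x\<bar> \<le> CA / (\<delta>\<^sup>2 * real n) * (M k - M n)"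
      proof -
        have "\<bar>conv (p j) (v k) x - v n x\<bar> \<le> CA / (norm x)\<^sup>2 * (M k - M n)"
          using CA(2)[of j x k] j x2 jk by simp
        also have "\<dots> \<le> CA / (\<delta>\<^sup>2 * real n) * (M k - M n)"
        proof -
          have pos: "0 < \<delta>\<^sup>2 * real n" using \<delta> n by simp
          then have "0 < (norm x)\<^sup>2" using xn by linarith
          then show ?thesis
            using xn pos CA(1) M_antimono[of k n] k by (intro mult_right_mono divide_left_mono mult_pos_pos) auto
        qed
        finally show ?thesis .
      qed
      have t2: "\<bar>conv (p j) (v k) x - M k * p j x\<bar> \<le> CS * (sqrt k / ?L k * (4 / (real n * sqrt n)) + 4 / (real n)\<^sup>2)"
      proof -
        have "\<bar>conv (p j) (v k) x - M k * p j x\<bar> \<le> CS * (sqrt k / ?L k * (1 / (real j * sqrt j)) + 1 / (real j)\<^sup>2)"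
          using CS(2)[OF k(1) j(2), of x] by simp
        also have "\<dots> \<le> CS * (sqrt k / ?L k * (4 / (real n * sqrt n)) + 4 / (real n)\<^sup>2)"
          using jj js CS Lk by (intro mult_left_mono add_mono) auto
        finally show ?thesis .
      qed
      have t3: "\<bar>M k * p j x - M k * ?G j\<bar> \<le> M 0 * CL * (4 / (real n * sqrt n))"
      proof -
        have "\<bar>M k * p j x - M k * ?G j\<bar> = M k * \<bar>p j x - ?G j\<bar>"
          using M_nonneg[of k] by (simp add: abs_mult flip: right_diff_distrib)
        also have "\<dots> \<le> M 0 * (CL * (1 / (real j * sqrt j)))"
          using CL(2)[OF j(2), of x] M_antimono[of 0 k] M_nonneg[of k] M_nonneg[of 0] by (intro mult_mono) auto
        also have "\<dots> \<le> M 0 * (CL * (4 / (real n * sqrt n)))"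
          using js CL M_nonneg[of 0] by (intro mult_left_mono) auto
        finally show ?thesis by simp
      qed
      have t4: "\<bar>M k * ?G j - M k * ?G n\<bar> \<le> M k * (CG * (real k * (4 / (real n)\<^sup>2)))"
      proof -
        have "\<bar>?G j - ?G n\<bar> \<le> CG * \<bar>real j - real n\<bar> / (real j)\<^sup>2"
          unfolding CG_def using j q_pos by (intro heat_kernel_time_diff) auto
        also have "\<dots> = CG * (real k * (1 / (real j)\<^sup>2))" using jk by simp
        also have "\<dots> \<le> CG * (real k * (4 / (real n)\<^sup>2))" using jj CG by (intro mult_left_mono) auto
        finally have "M k * \<bar>?G j - ?G n\<bar> \<le> M k * (CG * (real k * (4 / (real n)\<^sup>2)))" using M_nonneg by (intro mult_left_mono)
        then show ?thesis using M_nonneg[of k] by (simp add: abs_mult flip: right_diff_distrib)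
      qed
      have t5: "\<bar>M k * ?G n - 2 * Ms * (?G n / ?L n)\<bar> \<le> \<bar>M k * ?L n - 2 * Ms\<bar> / ?L n * (G0 / n)"
      proof -
        have "M k * ?G n - 2 * Ms * (?G n / ?L n) = (M k * ?L n - 2 * Ms) / ?L n * ?G n"
          using L by (simp add: field_simps)
        then have "\<bar>M k * ?G n - 2 * Ms * (?G n / ?L n)\<bar> = \<bar>M k * ?L n - 2 * Ms\<bar> / ?L n * ?G n"
          using L heat_kernel_nonneg[OF q_pos n(2), of x] by (simp add: abs_mult)
        also have "\<dots> \<le> \<bar>M k * ?L n - 2 * Ms\<bar> / ?L n * (G0 / n)"
          using heat_kernel_le[OF q_pos n(2), of x] L by (intro mult_left_mono) (auto simp: G0_def)
        finally show ?thesis .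
      qed
      have s1: "\<bar>v n x - M k * p j x\<bar> \<le> CA / (\<delta>\<^sup>2 * real n) * (M k - M n)
        + CS * (sqrt k / ?L k * (4 / (real n * sqrt n)) + 4 / (real n)\<^sup>2)"
        using t1 t2 by linarith
      have s2: "\<bar>M k * p j x - M k * ?G n\<bar> \<le> M 0 * CL * (4 / (real n * sqrt n)) + M k * (CG * (real k * (4 / (real n)\<^sup>2)))"
        using t3 t4 by linarith
      have "\<bar>v n x - 2 * Ms * (?G n / ?L n)\<bar> \<le> CA / (\<delta>\<^sup>2 * real n) * (M k - M n)
        + CS * (sqrt k / ?L k * (4 / (real n * sqrt n)) + 4 / (real n)\<^sup>2) + M 0 * CL * (4 / (real n * sqrt n))
        + M k * (CG * (real k * (4 / (real n)\<^sup>2))) + \<bar>M k * ?L n - 2 * Ms\<bar> / ?L n * (G0 / n)"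
        using s1 s2 t5 by linarith
      also have "\<dots> = err n / (real n * ?L n)"
      proof -
        have a1: "CA / (\<delta>\<^sup>2 * real n) * (M k - M n) = CA / \<delta>\<^sup>2 * (M k * ?L n - M n * ?L n) / (real n * ?L n)"
          using n L \<delta> by (simp add: field_simps)
        have a2: "CS * (sqrt k / ?L k * (4 / (real n * sqrt n)) + 4 / (real n)\<^sup>2) =
          CS * (4 * (sqrt (real k / real n) * (?L n / ?L k)) + 4 * (?L n / real n)) / (real n * ?L n)"
        proof -
          have "sqrt k / ?L k * (4 / (real n * sqrt n)) = 4 * (sqrt (real k / real n) * (?L n / ?L k)) / (real n * ?L n)"
            using n L by (simp add: real_sqrt_divide mult_ac)
          moreover have "4 / (real n)\<^sup>2 = 4 * (?L n / real n) / (real n * ?L n)"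
            using n L by (simp add: power2_eq_square)
          ultimately show ?thesis by (simp only: times_divide_eq_right[symmetric] add_divide_distrib)
        qed
        have a3: "M 0 * CL * (4 / (real n * sqrt n)) = 4 * M 0 * CL * (?L n / sqrt (real n)) / (real n * ?L n)"
          using n L by (simp add: mult_ac)
        have a4: "M k * (CG * (real k * (4 / (real n)\<^sup>2))) = 4 * CG * (M k * ?L n * (real k / real n)) / (real n * ?L n)"
          using n L by (simp add: power2_eq_square)
        have a5: "\<bar>M k * ?L n - 2 * Ms\<bar> / ?L n * (G0 / n) = G0 * \<bar>M k * ?L n - 2 * Ms\<bar> / (real n * ?L n)"
          by (simp add: mult_ac)
        show ?thesis unfolding err_def k_def[symmetric] a1 a2 a3 a4 a5 by (simp only: add_divide_distrib)
      qed
      also have "\<dots> \<le> \<epsilon> / (real n * ?L n)"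
        using elim n L by (intro divide_right_mono) auto
      finally show "\<bar>v n x - 2 * Ms * (?G n / ?L n)\<bar> \<le> \<epsilon> / (real n * ?L n)" .
    qed
  qed
qed

end

subsection \<open>Poisson averaging\<close>

definition poisson :: "real \<Rightarrow> nat \<Rightarrow> real" where "poisson t n = exp (- t) * t ^ n / fact n"

lemma poisson_nonneg: "t \<ge> 0 \<Longrightarrow> 0 \<le> poisson t n"
  by (simp add: poisson_def)

lemma poisson_Suc: "real (Suc n) * poisson t (Suc n) = t * poisson t n"
  by (simp add: poisson_def field_simps del: of_nat_Suc)

lemma poisson_sums: "poisson t sums 1"
proof -
  have "(\<lambda>n. exp (- t) * (t ^ n /\<^sub>R fact n)) sums (exp (- t) * exp t)"
    by (intro sums_mult exp_converges)
  then show ?thesis by (simp add: poisson_def[abs_def] field_simps flip: exp_add)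
qed

lemma poisson_mean: "(\<lambda>n. real n * poisson t n) sums t"
proof -
  have "(\<lambda>n. real (Suc n) * poisson t (Suc n)) sums t"
    unfolding poisson_Suc using sums_mult[OF poisson_sums, of t] by simp
  then show ?thesis by (subst (asm) sums_Suc_iff) simp
qed

lemma poisson_factorial_moment: "(\<lambda>n. real n * (real n - 1) * poisson t n) sums t\<^sup>2"
proof -
  have "real (Suc n) * (real (Suc n) - 1) * poisson t (Suc n) = t * (real n * poisson t n)" for n
  proof -
    have "real (Suc n) * (real (Suc n) - 1) * poisson t (Suc n) = real n * (real (Suc n) * poisson t (Suc n))" by simp
    then show ?thesis unfolding poisson_Suc by simp
  qed
  then have "(\<lambda>n. real (Suc n) * (real (Suc n) - 1) * poisson t (Suc n)) sums t\<^sup>2"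
    using sums_mult[OF poisson_mean, of t t] by (simp only: power2_eq_square)
  then show ?thesis by (subst (asm) sums_Suc_iff) simp
qed

lemma poisson_variance: "(\<lambda>n. (real n - t)\<^sup>2 * poisson t n) sums t"
proof -
  have "(\<lambda>n. real n * (real n - 1) * poisson t n + (1 - 2 * t) * (real n * poisson t n) + t\<^sup>2 * poisson t n)
      sums (t\<^sup>2 + (1 - 2 * t) * t + t\<^sup>2 * 1)"
    by (intro sums_add sums_mult poisson_factorial_moment poisson_mean poisson_sums)
  then show ?thesis by (simp add: algebra_simps power2_eq_square)
qed

text \<open>Since \<open>poisson t n / (n + 1) = poisson t (n + 1) / t\<close>, the index shift
  turns the sum into \<open>1 / t\<close> times the second moment about \<open>t + 1\<close>,
  without its term at 0. The result is bounded, whereas the variance itself is \<open>t\<close>;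
  this pays for the weak decay of \<open>v n\<close> at small \<open>n\<close>.\<close>

lemma poisson_shifted_variance:
  assumes "t > 0"
  obtains S where "(\<lambda>n. (real n - t)\<^sup>2 / (real n + 1) * poisson t n) sums S" "S \<le> (t + 1) / t"
proof -
  have "(\<lambda>k. (real k - t)\<^sup>2 * poisson t k - 2 * (real k * poisson t k) + (1 + 2 * t) * poisson t k) sums
      (t - 2 * t + (1 + 2 * t) * 1)"
    by (intro sums_add sums_diff sums_mult poisson_variance poisson_mean poisson_sums)
  then have "(\<lambda>k. (real k - 1 - t)\<^sup>2 * poisson t k) sums (t + 1)"
    by (simp add: algebra_simps power2_eq_square)
  then have "(\<lambda>k. (real (Suc k) - 1 - t)\<^sup>2 * poisson t (Suc k)) sums (t + 1 - (1 + t)\<^sup>2 * poisson t 0)"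
    by (subst sums_Suc_iff) (simp add: power2_eq_square algebra_simps)
  from sums_divide[OF this, of t]
  have "(\<lambda>k. (real (Suc k) - 1 - t)\<^sup>2 * poisson t (Suc k) / t) sums ((t + 1 - (1 + t)\<^sup>2 * poisson t 0) / t)" .
  moreover have "(real (Suc k) - 1 - t)\<^sup>2 * poisson t (Suc k) / t = (real k - t)\<^sup>2 / (real k + 1) * poisson t k" for k
  proof -
    have "poisson t (Suc k) / t = poisson t k / (real k + 1)"
      using poisson_Suc[of k t] assms by (simp add: field_simps)
    then show ?thesis by (simp add: mult.assoc flip: times_divide_eq_right)
  qed
  ultimately have "(\<lambda>n. (real n - t)\<^sup>2 / (real n + 1) * poisson t n) sums ((t + 1 - (1 + t)\<^sup>2 * poisson t 0) / t)"
    by simp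
  moreover have "(t + 1 - (1 + t)\<^sup>2 * poisson t 0) / t \<le> (t + 1) / t"
    using assms poisson_nonneg[of t 0] by (intro divide_right_mono) auto
  ultimately show ?thesis using that by blast
qed

context exterior_walk begin

definition U :: "real \<Rightarrow> plane \<Rightarrow> real" where "U t x = (\<Sum>n. poisson t n * v n x)"

lemma U_summable:
  assumes "t \<ge> 0" shows "summable (\<lambda>n. poisson t n * v n x)"
proof -
  obtain C where C: "C > 0" "\<And>n x. v n x \<le> C / (real n + 1)" using v_le by blast
  show ?thesis
  proof (rule summable_comparison_test'[where N = 0])
    show "summable (\<lambda>n. poisson t n * C)" using poisson_sums by (intro summable_mult2) (rule sums_summable)
    fix n
    have "v n x \<le> C" using order_trans[OF C(2)[of n x], of C] C(1) by (simp add: pos_divide_le_eq mult_le_cancel_left1)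
    then show "norm (poisson t n * v n x) \<le> poisson t n * C"
      using poisson_nonneg[OF assms, of n] v_nonneg[of n x] by (simp add: abs_mult mult_left_mono)
  qed
qed

text \<open>For \<open>n\<close> within \<open>t / 2\<close> of \<open>t\<close>,
  \<open>far_field\<close> applies and the profile at time \<open>n\<close> is compared with that at
  \<open>t\<close>; the other \<open>n\<close> are controlled as in Chebyshev's inequality. Every
  bound is a combination of 1, \<open>(n - t)^2\<close> and \<open>(n - t)^2 / (n + 1)\<close>,
  whose Poisson averages are known.\<close>

lemma U_far_field:
  assumes \<delta>: "\<delta> > 0" and \<epsilon>: "\<epsilon> > 0"
  shows "eventually (\<lambda>t. \<forall>x. norm x \<ge> \<delta> * sqrt t \<longrightarrow>
    \<bar>U t x - 2 * Ms * (heat_kernel2 q x t / ln t)\<bar> \<le> \<epsilon> / (t * ln t)) at_top"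
proof -
  obtain C where C: "C > 0" "\<And>n x. v n x \<le> C / (real n + 1)" using v_le by blast
  define CG where "CG = 1 / (2 * pi * q)"
  define G0 where "G0 = 1 / (4 * pi * q)"
  have CG: "CG > 0" "G0 > 0" using q_pos by (simp_all add: CG_def G0_def)
  define K where "K = 2 * \<bar>Ms\<bar> * (4 * CG + 2 * G0)"
  define K2 where "K2 = 2 * \<bar>Ms\<bar> * G0"
  have K: "K \<ge> 0" "K2 \<ge> 0" using CG by (auto simp: K_def K2_def)
  \<comment> \<open>For \<open>n \<ge> t / 2\<close> and \<open>ln n \<ge> (ln t) / 2\<close> the
    error of \<open>far_field\<close> grows by a factor 4, so half of \<epsilon> is left for the
    fluctuations.\<close>
  define \<epsilon>' where "\<epsilon>' = \<epsilon> / 8"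
  have \<epsilon>': "\<epsilon>' > 0" using \<epsilon> by (simp add: \<epsilon>'_def)
  \<comment> \<open>Half of \<delta>, because \<open>n \<le> 2 * t\<close> gives
    \<open>sqrt n \<le> 2 * sqrt t\<close> and hence
    \<open>\<delta> * sqrt t \<ge> \<delta> / 2 * sqrt n\<close>.\<close>
  obtain N where N: "\<And>n x. n \<ge> N \<Longrightarrow> norm x \<ge> \<delta> / 2 * sqrt (real n) \<Longrightarrow>
    \<bar>v n x - 2 * Ms * (heat_kernel2 q x (real n) / ln (real n))\<bar> \<le> \<epsilon>' / (real n * ln (real n))"
    using far_field[of "\<delta> / 2" \<epsilon>'] \<delta> \<epsilon>' unfolding eventually_sequentially by auto
  have e1: "eventually (\<lambda>t. 4 * \<epsilon>' + (2 * K / sqrt t + (4 * K2 + 8 * C) / t) * ln t < \<epsilon>) at_top"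
  proof (rule order_tendstoD(2))
    have "((\<lambda>t. 4 * \<epsilon>' + (2 * K * (ln t / sqrt t) + (4 * K2 + 8 * C) * (ln t / t))) \<longlongrightarrow>
        4 * \<epsilon>' + (2 * K * 0 + (4 * K2 + 8 * C) * 0)) at_top"
      by (intro tendsto_intros) real_asymp+
    then show "((\<lambda>t. 4 * \<epsilon>' + (2 * K / sqrt t + (4 * K2 + 8 * C) / t) * ln t) \<longlongrightarrow> 4 * \<epsilon>') at_top"
      by (simp add: algebra_simps add_divide_distrib)
  qed (use \<epsilon> in \<open>simp add: \<epsilon>'_def\<close>)
  have e2: "eventually (\<lambda>t. t \<ge> 2 * real N) at_top" "eventually (\<lambda>t::real. t \<ge> 8) at_top"
    by (rule eventually_ge_at_top)+
  show ?thesis using e1 e2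
  proof eventually_elim
    case (elim t)
    have t: "t \<ge> 8" "t > 0" and tN: "t / 2 \<ge> real N" using elim by auto
    have ln1: "ln s \<ge> 1" if "s \<ge> 4" for s :: real
    proof -
      have "exp 1 \<le> s" using that e_less_272 by linarith
      then show ?thesis using that by (subst ln_ge_iff) auto
    qed
    have lt: "ln t \<ge> 1" using ln1 t by simp
    show ?case
    proof (intro allI impI)
      fix x :: plane assume x: "norm x \<ge> \<delta> * sqrt t"
      let ?G = "\<lambda>s. heat_kernel2 q x s"
      define g where "g s = 2 * Ms * (?G s / ln s)" for s
      define b where "b n = 4 * \<epsilon>' / (t * ln t) * poisson t n + K / t\<^sup>2 * sqrt t * poisson t n
        + (K / (t\<^sup>2 * sqrt t) + 4 * K2 / t ^ 3) * ((real n - t)\<^sup>2 * poisson t n)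
        + 4 * C / t\<^sup>2 * ((real n - t)\<^sup>2 / (real n + 1) * poisson t n)" for n
      have pw: "\<bar>v n x - g t\<bar> \<le> 4 * \<epsilon>' / (t * ln t) + K / t\<^sup>2 * sqrt t
        + (K / (t\<^sup>2 * sqrt t) + 4 * K2 / t ^ 3) * (real n - t)\<^sup>2 + 4 * C / t\<^sup>2 * ((real n - t)\<^sup>2 / (real n + 1))" for n
      proof (cases "\<bar>real n - t\<bar> \<le> t / 2")
        case True
        then have n: "real n \<ge> t / 2" "real n \<le> 2 * t" "real n \<ge> 4" "real n > 0"
          using t unfolding abs_le_iff by linarith+
        have nN: "n \<ge> N" using tN n by simp
        have sq: "sqrt (real n) \<le> 2 * sqrt t"
        proof -
          have "sqrt (real n) \<le> sqrt (4 * t)" using n by (intro real_sqrt_le_mono) auto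
          then show ?thesis by (simp add: real_sqrt_mult)
        qed
        have "\<delta> / 2 * sqrt (real n) \<le> \<delta> / 2 * (2 * sqrt t)" using sq \<delta> by (intro mult_left_mono) auto
        then have "\<bar>v n x - g (real n)\<bar> \<le> \<epsilon>' / (real n * ln (real n))"
          unfolding g_def using x by (intro N nN) simp
        also have "\<dots> \<le> \<epsilon>' / (t / 2 * (ln t / 2))"
        proof -
          have "ln t / 2 \<le> ln (real n)"
          proof -
            have "ln t / 2 = ln (sqrt t)" using t by (simp add: ln_sqrt)
            also have "\<dots> \<le> ln (t / 2)"
            proof -
              have "sqrt t \<le> t / 2" using t by (intro real_le_lsqrt) (auto simp: power2_eq_square)
              then show ?thesis using t by simp
            qed
            also have "\<dots> \<le> ln (real n)" using n t by simp
            finally show ?thesis .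
          qed
          then have "t / 2 * (ln t / 2) \<le> real n * ln (real n)" using n t lt by (intro mult_mono) auto
          moreover have "0 < t / 2 * (ln t / 2)" using t lt by simp
          ultimately show ?thesis using \<epsilon>' by (intro divide_left_mono) auto
        qed
        finally have A: "\<bar>v n x - g (real n)\<bar> \<le> 4 * \<epsilon>' / (t * ln t)" by (simp add: mult.commute)
        have ln_n: "ln (real n) \<ge> 1" using ln1 n by simp
        have D1: "\<bar>?G (real n) - ?G t\<bar> \<le> CG * \<bar>real n - t\<bar> / (t / 2)\<^sup>2"
          unfolding CG_def using n t q_pos by (intro heat_kernel_time_diff) auto
        have D2: "\<bar>ln (real n) - ln t\<bar> \<le> 2 * \<bar>real n - t\<bar> / t"
        proof -
          have "ln (real n) - ln t \<le> (real n - t) / t" using n t by (intro ln_diff_le) auto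
          also have "\<dots> \<le> 2 * \<bar>real n - t\<bar> / t"
          proof (rule divide_right_mono)
            have "\<bar>real n - t\<bar> \<le> 2 * \<bar>real n - t\<bar>" by simp
            then show "real n - t \<le> 2 * \<bar>real n - t\<bar>" using abs_ge_self[of "real n - t"] by (rule order_trans[rotated])
          qed (use t in simp)
          finally have 1: "ln (real n) - ln t \<le> 2 * \<bar>real n - t\<bar> / t" .
          have "ln t - ln (real n) \<le> (t - real n) / real n" using n t by (intro ln_diff_le) auto
          also have "\<dots> \<le> \<bar>real n - t\<bar> / real n"
            using abs_ge_minus_self[of "real n - t"] by (intro divide_right_mono) auto
          also have "\<dots> \<le> \<bar>real n - t\<bar> / (t / 2)" using n t by (intro divide_left_mono) auto
          finally have "ln t - ln (real n) \<le> 2 * \<bar>real n - t\<bar> / t" by (simp add: mult.commute)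
          then show ?thesis using 1 by (simp only: abs_le_iff minus_diff_eq)
        qed
        have "\<bar>g (real n) - g t\<bar> \<le> K * \<bar>real n - t\<bar> / t\<^sup>2"
        proof -
          have eq: "?G (real n) / ln (real n) - ?G t / ln t = (?G (real n) - ?G t) / ln (real n) + ?G t * ((ln t - ln (real n)) / (ln (real n) * ln t))"
            using lt ln_n by (simp add: field_simps)
          have "\<bar>(?G (real n) - ?G t) / ln (real n)\<bar> \<le> \<bar>?G (real n) - ?G t\<bar> / 1"
            using ln_n unfolding abs_divide by (intro divide_left_mono frac_le) auto
          then have 1: "\<bar>(?G (real n) - ?G t) / ln (real n)\<bar> \<le> CG * \<bar>real n - t\<bar> / (t / 2)\<^sup>2" using D1 unfolding div_by_1 by (rule order_trans)
          have "\<bar>(ln t - ln (real n)) / (ln (real n) * ln t)\<bar> \<le> \<bar>ln t - ln (real n)\<bar> / 1"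
          proof -
            have "1 * 1 \<le> ln (real n) * ln t" using ln_n lt by (intro mult_mono) auto
            then show ?thesis unfolding abs_divide by (intro frac_le) auto
          qed
          then have "\<bar>(ln t - ln (real n)) / (ln (real n) * ln t)\<bar> \<le> 2 * \<bar>real n - t\<bar> / t"
            using D2 unfolding div_by_1 abs_minus_commute[of "ln t"] by (rule order_trans)
          then have 2: "\<bar>?G t * ((ln t - ln (real n)) / (ln (real n) * ln t))\<bar> \<le> (G0 / t) * (2 * \<bar>real n - t\<bar> / t)"
            unfolding abs_mult G0_def using heat_kernel_bounds[OF q_pos t(2), of x] q_pos t
            by (intro mult_mono) auto
          have "\<bar>g (real n) - g t\<bar> = 2 * \<bar>Ms\<bar> * \<bar>?G (real n) / ln (real n) - ?G t / ln t\<bar>"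
            unfolding g_def right_diff_distrib[symmetric] by (simp add: abs_mult)
          also have "\<dots> \<le> 2 * \<bar>Ms\<bar> * (CG * \<bar>real n - t\<bar> / (t / 2)\<^sup>2 + (G0 / t) * (2 * \<bar>real n - t\<bar> / t))"
            unfolding eq using 1 2 by (intro mult_left_mono order_trans[OF abs_triangle_ineq add_mono]) auto
          also have "\<dots> = K * \<bar>real n - t\<bar> / t\<^sup>2"
            using t by (simp add: K_def field_simps power2_eq_square)
          finally show ?thesis .
        qed
        \<comment> \<open>The deviation \<open>|n - t|\<close> is traded for its square at scale
          \<open>sqrt t\<close>, the standard deviation; thus the variance suffices and no first
          absolute moment is computed.\<close>
        also have "\<dots> \<le> K * (sqrt t + (real n - t)\<^sup>2 / sqrt t) / t\<^sup>2"
        proof -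
          have "0 \<le> (\<bar>real n - t\<bar> - sqrt t / 2)\<^sup>2 + 3/4 * t" using t by simp
          then have "\<bar>real n - t\<bar> * sqrt t \<le> sqrt t * sqrt t + (real n - t)\<^sup>2"
            using t by (simp add: power2_diff power2_eq_square[of "sqrt t / 2"])
          then have "\<bar>real n - t\<bar> \<le> (sqrt t * sqrt t + (real n - t)\<^sup>2) / sqrt t" using t by (simp add: pos_le_divide_eq)
          also have "\<dots> = sqrt t + (real n - t)\<^sup>2 / sqrt t" using t by (simp add: add_divide_distrib real_div_sqrt)
          finally show ?thesis using K t by (intro divide_right_mono mult_left_mono) auto
        qed
        also have "\<dots> = K / t\<^sup>2 * sqrt t + K / (t\<^sup>2 * sqrt t) * (real n - t)\<^sup>2"
          by (simp add: distrib_left add_divide_distrib)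
        finally have "\<bar>g (real n) - g t\<bar> \<le> K / t\<^sup>2 * sqrt t + K / (t\<^sup>2 * sqrt t) * (real n - t)\<^sup>2" .
        moreover have "0 \<le> 4 * K2 / t ^ 3 * (real n - t)\<^sup>2" using K t by simp
        moreover have "0 \<le> 4 * C / t\<^sup>2 * ((real n - t)\<^sup>2 / (real n + 1))" using C by simp
        ultimately show ?thesis using A unfolding distrib_right by linarith
      next
        case False
        then have "(t / 2)\<^sup>2 \<le> \<bar>real n - t\<bar>\<^sup>2" using t by (intro power_mono) auto
        \<comment> \<open>This factor, at least 1 away from \<open>t\<close>, converts a tail
          probability into a variance.\<close>
        then have far: "1 \<le> 4 * (real n - t)\<^sup>2 / t\<^sup>2" using t by (simp add: power_divide)
        have "\<bar>g t\<bar> = 2 * \<bar>Ms\<bar> * (?G t / ln t)"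
          using heat_kernel_nonneg[OF q_pos t(2), of x] lt by (simp add: g_def abs_mult)
        also have "\<dots> \<le> 2 * \<bar>Ms\<bar> * (G0 / t / 1)"
          unfolding G0_def using heat_kernel_bounds[OF q_pos t(2), of x] lt q_pos t by (intro mult_left_mono frac_le) auto
        finally have gt: "\<bar>g t\<bar> \<le> K2 / t" by (simp add: K2_def)
        have "\<bar>v n x - g t\<bar> \<le> C / (real n + 1) + K2 / t"
          using gt C(2)[of n x] v_nonneg[of n x] by linarith
        also have "\<dots> \<le> (C / (real n + 1) + K2 / t) * (4 * (real n - t)\<^sup>2 / t\<^sup>2)"
          using far C K t mult_left_mono[OF far, of "C / (real n + 1) + K2 / t"] by simp
        also have "\<dots> = 4 * K2 / t ^ 3 * (real n - t)\<^sup>2 + 4 * C / t\<^sup>2 * ((real n - t)\<^sup>2 / (real n + 1))"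
        proof -
          have eq: "(a + b / t) * (4 * N / t\<^sup>2) = 4 * b / t ^ 3 * N + 4 * (a * N) / t\<^sup>2" for a b N :: real
            using t by (simp add: field_simps power2_eq_square power3_eq_cube)
          have "4 * (C / (real n + 1) * (real n - t)\<^sup>2) / t\<^sup>2 = 4 * C / t\<^sup>2 * ((real n - t)\<^sup>2 / (real n + 1))"
            by (simp add: mult_ac)
          then show ?thesis unfolding eq by (simp only:)
        qed
        finally have "\<bar>v n x - g t\<bar> \<le> 4 * K2 / t ^ 3 * (real n - t)\<^sup>2 + 4 * C / t\<^sup>2 * ((real n - t)\<^sup>2 / (real n + 1))" .
        moreover have "0 \<le> 4 * \<epsilon>' / (t * ln t)" "0 \<le> K / t\<^sup>2 * sqrt t" "0 \<le> K / (t\<^sup>2 * sqrt t) * (real n - t)\<^sup>2"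
          using \<epsilon>' t lt K by auto
        ultimately show ?thesis unfolding distrib_right by linarith
      qed
      obtain S where S: "(\<lambda>n. (real n - t)\<^sup>2 / (real n + 1) * poisson t n) sums S" "S \<le> (t + 1) / t"
        using poisson_shifted_variance[OF t(2)] by blast
      have bs: "b sums (4 * \<epsilon>' / (t * ln t) * 1 + K / t\<^sup>2 * sqrt t * 1 + (K / (t\<^sup>2 * sqrt t) + 4 * K2 / t ^ 3) * t + 4 * C / t\<^sup>2 * S)"
        unfolding b_def[abs_def] by (intro sums_add sums_mult poisson_sums poisson_variance S)
      have "(\<lambda>n. poisson t n * v n x - poisson t n * g t) sums (U t x - 1 * g t)"
        unfolding U_def using t by (intro sums_diff sums_mult2 poisson_sums summable_sums U_summable) auto
      then have "U t x - g t = (\<Sum>n. poisson t n * v n x - poisson t n * g t)" by (simp add: sums_iff)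
      moreover have "norm (\<Sum>n. poisson t n * v n x - poisson t n * g t) \<le> suminf b"
      proof (rule norm_suminf_le)
        show "summable b" using bs by (rule sums_summable)
        fix n
        have "norm (poisson t n * v n x - poisson t n * g t) = \<bar>poisson t n * (v n x - g t)\<bar>"
          by (simp add: right_diff_distrib)
        also have "\<dots> = \<bar>v n x - g t\<bar> * poisson t n"
          using poisson_nonneg[of t n] t by (simp add: abs_mult mult.commute)
        also have "\<dots> \<le> b n"
          using mult_right_mono[OF pw[of n] poisson_nonneg[of t n]] t unfolding b_def by (simp add: distrib_right mult.assoc)
        finally show "norm (poisson t n * v n x - poisson t n * g t) \<le> b n" .
      qed
      ultimately have "\<bar>U t x - g t\<bar> \<le> 4 * \<epsilon>' / (t * ln t) * 1 + K / t\<^sup>2 * sqrt t * 1 + (K / (t\<^sup>2 * sqrt t) + 4 * K2 / t ^ 3) * t + 4 * C / t\<^sup>2 * S"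
        using bs by (simp add: sums_iff)
      also have "\<dots> \<le> 4 * \<epsilon>' / (t * ln t) * 1 + K / t\<^sup>2 * sqrt t * 1 + (K / (t\<^sup>2 * sqrt t) + 4 * K2 / t ^ 3) * t + 4 * C / t\<^sup>2 * 2"
      proof -
        have "(t + 1) / t \<le> 2" using t by (simp add: pos_divide_le_eq)
        then have "S \<le> 2" using S(2) by linarith
        then show ?thesis using C by (intro add_left_mono mult_left_mono) auto
      qed
      also have "\<dots> = (4 * \<epsilon>' + (2 * K / sqrt t + (4 * K2 + 8 * C) / t) * ln t) / (t * ln t)"
      proof -
        have r: "sqrt t > 0" "t = sqrt t * sqrt t" using t by auto
        have k1: "K / t\<^sup>2 * sqrt t * 1 = K / sqrt t / t"
          using r t by (simp add: power2_eq_square field_simps)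
        have k2: "K / (t\<^sup>2 * sqrt t) * t = K / sqrt t / t" using r(1) t by (simp add: power2_eq_square)
        have k3: "4 * K2 / t ^ 3 * t = 4 * K2 / t / t" using t by (simp add: power3_eq_cube)
        have k4: "4 * C / t\<^sup>2 * 2 = 8 * C / t / t" by (simp add: power2_eq_square)
        have k5: "(2 * K / sqrt t + (4 * K2 + 8 * C) / t) * ln t / (t * ln t) = (K / sqrt t + K / sqrt t + (4 * K2 / t + 8 * C / t)) / t"
          using lt by (simp add: add_divide_distrib)
        show ?thesis unfolding distrib_right[of _ _ t] k1 k2 k3 k4 add_divide_distrib[of "4 * \<epsilon>'"] k5
          by (simp add: add_divide_distrib)
      qed
      also have "\<dots> \<le> \<epsilon> / (t * ln t)"
        using elim(1) t lt by (intro divide_right_mono) auto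
      finally show "\<bar>U t x - 2 * Ms * (?G t / ln t)\<bar> \<le> \<epsilon> / (t * ln t)" unfolding g_def .
    qed
  qed
qed

end

subsection \<open>Identification of the solution\<close>

text \<open>Measurability is asked only eventually, because the solution is controlled only at
  nonnegative times while difference quotients use increments of both signs.\<close>

lemma tendsto_integral_abs:
  fixes f :: "'b \<Rightarrow> 'a::euclidean_space \<Rightarrow> real"
  assumes lim: "((\<lambda>s. \<integral>\<^sup>+x. ennreal \<bar>f s x\<bar> \<partial>lborel) \<longlongrightarrow> 0) F"
    and meas: "eventually (\<lambda>s. f s \<in> borel_measurable borel) F"
  shows "((\<lambda>s. LINT x|lborel. \<bar>f s x\<bar>) \<longlongrightarrow> 0) F"
proof -
  have "((\<lambda>s. enn2real (\<integral>\<^sup>+x. ennreal \<bar>f s x\<bar> \<partial>lborel)) \<longlongrightarrow> 0) F"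
    using tendsto_enn2real[of "\<lambda>s. \<integral>\<^sup>+x. ennreal \<bar>f s x\<bar> \<partial>lborel" 0 F] lim by simp
  moreover have "eventually (\<lambda>s. enn2real (\<integral>\<^sup>+x. ennreal \<bar>f s x\<bar> \<partial>lborel) = (LINT x|lborel. \<bar>f s x\<bar>)) F"
    using meas by eventually_elim (auto simp: integral_eq_nn_integral)
  ultimately show ?thesis by (rule Lim_transform_eventually)
qed

lemma integral_mult_bounded_le:
  fixes h g :: "'a::euclidean_space \<Rightarrow> real"
  assumes "integrable lborel h" "g \<in> borel_measurable borel" "\<And>x. \<bar>g x\<bar> \<le> G"
  shows integrable_mult_bounded: "integrable lborel (\<lambda>x. h x * g x)"
    and abs_integral_mult_bounded_le: "\<bar>LINT x|lborel. h x * g x\<bar> \<le> G * (LINT x|lborel. \<bar>h x\<bar>)"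
proof -
  note [measurable] = assms(2)
  have [measurable]: "h \<in> borel_measurable borel" using assms(1) by auto
  have le: "\<bar>h x * g x\<bar> \<le> G * \<bar>h x\<bar>" for x
    using mult_left_mono[OF assms(3)[of x], of "\<bar>h x\<bar>"] by (simp add: abs_mult mult.commute)
  show I: "integrable lborel (\<lambda>x. h x * g x)"
    by (rule Bochner_Integration.integrable_bound[of _ "\<lambda>x. G * \<bar>h x\<bar>"]) (use assms(1) le in \<open>auto intro!: AE_I2 order_trans[OF le abs_ge_self]\<close>)
  have "\<bar>LINT x|lborel. h x * g x\<bar> \<le> (LINT x|lborel. G * \<bar>h x\<bar>)"
    using assms(1) le by (intro integral_abs_bound_integral I) auto
  then show "\<bar>LINT x|lborel. h x * g x\<bar> \<le> G * (LINT x|lborel. \<bar>h x\<bar>)" by simp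
qed

context radial_kernel begin

text \<open>Complements \<open>conv_duality\<close>: the density is merely integrable and the weight
  bounded, since no sup bound or second moment is known in advance for the solution.\<close>

lemma conv_pairing:
  assumes h: "integrable lborel h" and [measurable]: "g \<in> borel_measurable borel" and G: "\<And>x. \<bar>g x\<bar> \<le> G"
  shows conv_pairing_integrable: "integrable lborel (\<lambda>x. conv J h x * g x)"
    and "(LINT x|lborel. conv J h x * g x) = (LINT x|lborel. h x * conv J g x)"
proof -
  have [measurable]: "h \<in> borel_measurable borel" using h by auto
  have i: "integrable lborel (\<lambda>x. J (x - y) *\<^sub>R g x)" for y
    by (rule J_growth_integrable) (use G in auto)
  have b: "(LINT x|lborel. \<bar>J (x - y)\<bar> * norm (g x)) \<le> G" for y
  proof -
    have "(LINT x|lborel. \<bar>J (x - y)\<bar> * norm (g x)) \<le> (LINT x|lborel. G * J (x - y))"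
    proof (rule integral_mono)
      show "integrable lborel (\<lambda>x. \<bar>J (x - y)\<bar> * norm (g x))" using integrable_norm[OF i[of y]] by (simp add: abs_mult)
      show "integrable lborel (\<lambda>x. G * J (x - y))"
        using J_integrable integrable_lborel_diff(2)[OF J_measurable, of y] by simp
      show "\<bar>J (x - y)\<bar> * norm (g x) \<le> G * J (x - y)" for x
        using mult_left_mono[OF G[of x] J_nonneg[of "x - y"]] J_nonneg[of "x - y"] by (simp add: mult.commute)
    qed
    then show ?thesis by (simp add: J_shift_mass)
  qed
  have c: "(LINT x|lborel. J (x - y) *\<^sub>R g x) = conv J g y" for y
    unfolding conv_def J_diff_commute[of y] by simp
  have *: "integrable lborel (\<lambda>x. conv J h x *\<^sub>R g x) \<and>
    (LINT x|lborel. conv J h x *\<^sub>R g x) = (LINT y|lborel. h y *\<^sub>R (LINT x|lborel. J (x - y) *\<^sub>R g x))"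
    using h by (intro conjI conv_duality_general[OF _ _ _ i b]) auto
  then show "integrable lborel (\<lambda>x. conv J h x * g x)"
    "(LINT x|lborel. conv J h x * g x) = (LINT x|lborel. h x * conv J g x)"
    by (simp_all add: c[simplified])
qed

end

context exterior_walk begin

text \<open>The solution is identified with \<open>U\<close> by testing against bounded \<open>g\<close> vanishing in the hole:
  \<open>e\<^sup>t \<integral> w t g\<close> has derivative \<open>e\<^sup>t \<integral> w t (T g)\<close>, so its Taylor coefficients at \<open>0\<close> are
  \<open>\<integral> v0 (T\<^sup>k g) = \<integral> v k g\<close>.\<close>

definition T :: "(plane \<Rightarrow> real) \<Rightarrow> plane \<Rightarrow> real" where "T g = (\<lambda>x. indicator (- H) x * conv J g x)"

text \<open>The bound belongs to the predicate because \<open>T\<close> preserves it, so that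
  remainder estimates are uniform along the iterates of \<open>T\<close>.\<close>

definition testfn :: "real \<Rightarrow> (plane \<Rightarrow> real) \<Rightarrow> bool" where
  "testfn G g \<longleftrightarrow> g \<in> borel_measurable borel \<and> (\<forall>x. \<bar>g x\<bar> \<le> G) \<and> (\<forall>x\<in>H. g x = 0)"

lemma testfnD:
  assumes "testfn G g"
  shows "g \<in> borel_measurable borel" "\<bar>g x\<bar> \<le> G" "x \<in> H \<Longrightarrow> g x = 0" "0 \<le> G"
  using assms unfolding testfn_def by (auto intro: order_trans[OF abs_ge_zero])

lemma testfn_T:
  assumes "testfn G g" shows "testfn G (T g)"
proof -
  note [measurable] = testfnD(1)[OF assms]
  have "\<bar>conv J g x\<bar> \<le> G" for x by (intro conv_J_le testfnD[OF assms])
  then show ?thesis using testfnD(4)[OF assms] unfolding testfn_def T_def by (auto simp: indicator_def)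
qed

lemma pairing_conv_T:
  assumes h: "integrable lborel h" and hH: "AE x in lborel. x \<in> H \<longrightarrow> h x = 0" and g: "testfn G g"
  shows "(LINT x|lborel. conv J h x * g x) = (LINT x|lborel. h x * T g x)"
proof -
  note [measurable] = testfnD(1)[OF g]
  have [measurable]: "h \<in> borel_measurable borel" using h by auto
  have "(LINT x|lborel. conv J h x * g x) = (LINT x|lborel. h x * conv J g x)"
    by (rule conv_pairing(2)[OF h testfnD(1,2)[OF g]])
  also have "\<dots> = (LINT x|lborel. h x * T g x)"
    unfolding T_def
  proof (rule integral_cong_AE)
    show "AE x in lborel. h x * conv J g x = h x * (indicator (- H) x * conv J g x)"
      using hH by eventually_elim (auto simp: indicator_def)
  qed measurable
  finally show ?thesis .
qed

lemma v_pairing_Suc: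
  assumes g: "testfn G g" shows "(LINT x|lborel. v (Suc k) x * g x) = (LINT x|lborel. v k x * T g x)"
proof -
  have "v (Suc k) x * g x = conv J (v k) x * g x" for x
    using testfnD(3)[OF g, of x] by (auto simp: indicator_def)
  then have "(LINT x|lborel. v (Suc k) x * g x) = (LINT x|lborel. conv J (v k) x * g x)" by (simp only:)
  also have "\<dots> = (LINT x|lborel. v k x * T g x)"
    by (rule pairing_conv_T[OF v_integrable _ g]) (simp add: v_H)
  finally show ?thesis .
qed

text \<open>All \<open>v n\<close> have mass at most \<open>M 0\<close>, so the Poisson weights make
  the series of integrals absolutely convergent and summation commutes with integration.\<close>

lemma U_pairing:
  assumes t: "t \<ge> 0" and [measurable]: "g \<in> borel_measurable borel" and G: "\<And>x. \<bar>g x\<bar> \<le> G"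
  shows U_pairing_integrable: "integrable lborel (\<lambda>x. U t x * g x)"
    and "(\<lambda>n. poisson t n * (LINT x|lborel. v n x * g x)) sums (LINT x|lborel. U t x * g x)"
proof -
  have G0: "G \<ge> 0" using order_trans[OF abs_ge_zero G] .
  let ?f = "\<lambda>n x. poisson t n * (v n x * g x)"
  note B = integral_mult_bounded_le[OF v_integrable assms(2) G]
  have i: "integrable lborel (?f n)" for n using B(1) by simp
  have s1: "AE x in lborel. summable (\<lambda>n. norm (?f n x))"
  proof (rule AE_I2)
    fix x
    have "norm (?f n x) = (poisson t n * v n x) * \<bar>g x\<bar>" for n
      using poisson_nonneg[OF t, of n] v_nonneg[of n x] by (simp add: abs_mult)
    then show "summable (\<lambda>n. norm (?f n x))" using U_summable[OF t, of x] by (simp add: summable_mult2)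
  qed
  have s2: "summable (\<lambda>n. LINT x|lborel. norm (?f n x))"
  proof (rule summable_comparison_test'[where N = 0])
    show "summable (\<lambda>n. poisson t n * (G * M 0))" using sums_summable[OF poisson_sums] by (rule summable_mult2)
    fix n
    have "(LINT x|lborel. norm (?f n x)) = poisson t n * (LINT x|lborel. v n x * \<bar>g x\<bar>)"
      using poisson_nonneg[OF t, of n] v_nonneg by (simp add: abs_mult)
    also have "\<dots> \<le> poisson t n * (G * M 0)"
    proof (rule mult_left_mono)
      have "(LINT x|lborel. v n x * \<bar>g x\<bar>) \<le> G * (LINT x|lborel. \<bar>v n x\<bar>)"
        using abs_integral_mult_bounded_le[OF v_integrable, of "\<lambda>x. \<bar>g x\<bar>" G n] G by (simp add: abs_le_iff)
      also have "\<dots> \<le> G * M 0" using v_nonneg M_antimono[of 0 n] G0 by (simp add: mult_left_mono flip: M_def)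
      finally show "(LINT x|lborel. v n x * \<bar>g x\<bar>) \<le> G * M 0" .
    qed (rule poisson_nonneg[OF t])
    finally show "norm (LINT x|lborel. norm (?f n x)) \<le> poisson t n * (G * M 0)"
      by (simp add: integral_nonneg_AE)
  qed
  have eq: "(\<Sum>n. ?f n x) = U t x * g x" for x
    unfolding U_def using suminf_mult2[OF U_summable[OF t, of x], of "g x"] by (simp add: mult.assoc)
  show "integrable lborel (\<lambda>x. U t x * g x)"
    using integrable_suminf[OF i s1 s2] unfolding eq .
  have "(\<lambda>n. LINT x|lborel. ?f n x) sums (LINT x|lborel. (\<Sum>n. ?f n x))"
    by (rule sums_integral[OF i s1 s2])
  then show "(\<lambda>n. poisson t n * (LINT x|lborel. v n x * g x)) sums (LINT x|lborel. U t x * g x)"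
    unfolding eq by simp
qed

lemma U_H: "x \<in> H \<Longrightarrow> U t x = 0"
  by (simp add: U_def v_H)

lemma U_integrable: "t \<ge> 0 \<Longrightarrow> integrable lborel (U t)"
  using U_pairing_integrable[of t "\<lambda>_. 1" 1] by simp

lemma solution_unique:
  fixes w :: "real \<Rightarrow> plane \<Rightarrow> real"
  assumes int: "\<And>t. t \<ge> 0 \<Longrightarrow> integrable lborel (w t)"
    and cont: "\<And>t. t \<ge> 0 \<Longrightarrow> ((\<lambda>s. \<integral>\<^sup>+x. ennreal \<bar>w s x - w t x\<bar> \<partial>lborel) \<longlongrightarrow> 0) (at t within {0..})"
    and deriv: "\<And>t. t > 0 \<Longrightarrow> ((\<lambda>h. \<integral>\<^sup>+x\<in>- H. ennreal \<bar>(w (t + h) x - w t x) / h - (conv J (w t) x - w t x)\<bar> \<partial>lborel) \<longlongrightarrow> 0) (at 0)"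
    and zero: "\<And>t. t > 0 \<Longrightarrow> AE x in lborel. x \<in> H \<longrightarrow> w t x = 0"
    and init: "AE x in lborel. w 0 x = v0 x"
    and t0: "t0 > 0"
  shows "AE x in lborel. w t0 x = U t0 x"
proof -
  have m: "w t \<in> borel_measurable borel" if "t \<ge> 0" for t using int[OF that] by auto
  define N where "N t = (LINT x|lborel. \<bar>w t x\<bar>)" for t
  define F where "F g t = (LINT x|lborel. w t x * g x)" for g t
  have F_le: "\<bar>F g t\<bar> \<le> G * N t" if "t \<ge> 0" "testfn G g" for g G t
    unfolding F_def N_def by (rule abs_integral_mult_bounded_le[OF int[OF that(1)] testfnD(1,2)[OF that(2)]])
  have D_lim: "((\<lambda>s. LINT x|lborel. \<bar>w s x - w t x\<bar>) \<longlongrightarrow> 0) (at t within {0..})" if "t \<ge> 0" for t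
  proof (rule tendsto_integral_abs[OF cont[OF that]])
    show "eventually (\<lambda>s. (\<lambda>x. w s x - w t x) \<in> borel_measurable borel) (at t within {0..})"
      using m that by (auto simp: eventually_at_filter intro!: always_eventually borel_measurable_diff)
  qed
  have N_cont: "continuous_on {0..} N"
    unfolding continuous_on_def
  proof
    fix t :: real assume t: "t \<in> {0..}"
    have "((\<lambda>s. N s - N t) \<longlongrightarrow> 0) (at t within {0..})"
    proof (rule Lim_null_comparison)
      show "eventually (\<lambda>s. norm (N s - N t) \<le> (LINT x|lborel. \<bar>w s x - w t x\<bar>)) (at t within {0..})"
        unfolding eventually_at_filter
      proof (intro always_eventually allI impI)
        fix s :: real assume s: "s \<in> {0..}"
        have "N s - N t = (LINT x|lborel. \<bar>w s x\<bar> - \<bar>w t x\<bar>)"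
          using int s t by (simp add: N_def)
        also have "\<bar>\<dots>\<bar> \<le> (LINT x|lborel. \<bar>w s x - w t x\<bar>)"
          using int s t by (intro integral_abs_bound_integral) auto
        finally show "norm (N s - N t) \<le> (LINT x|lborel. \<bar>w s x - w t x\<bar>)" by simp
      qed
      show "((\<lambda>s. LINT x|lborel. \<bar>w s x - w t x\<bar>) \<longlongrightarrow> 0) (at t within {0..})" using D_lim t by simp
    qed
    then show "(N \<longlongrightarrow> N t) (at t within {0..})" by (simp add: LIM_zero_iff)
  qed
  have F_cont: "continuous_on {0..} (F g)" if g: "testfn G g" for g G
    unfolding continuous_on_def
  proof
    fix t :: real assume t: "t \<in> {0..}"
    have "((\<lambda>s. F g s - F g t) \<longlongrightarrow> 0) (at t within {0..})"
    proof (rule Lim_null_comparison)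
      show "eventually (\<lambda>s. norm (F g s - F g t) \<le> G * (LINT x|lborel. \<bar>w s x - w t x\<bar>)) (at t within {0..})"
        unfolding eventually_at_filter
      proof (intro always_eventually allI impI)
        fix s :: real assume s: "s \<in> {0..}"
        have "F g s - F g t = (LINT x|lborel. (w s x - w t x) * g x)"
          using integrable_mult_bounded[OF int testfnD(1,2)[OF g], of s] integrable_mult_bounded[OF int testfnD(1,2)[OF g], of t] s t
          by (simp add: F_def left_diff_distrib)
        moreover have "\<bar>LINT x|lborel. (w s x - w t x) * g x\<bar> \<le> G * (LINT x|lborel. \<bar>w s x - w t x\<bar>)"
          using int s t by (intro abs_integral_mult_bounded_le testfnD[OF g]) auto
        ultimately show "norm (F g s - F g t) \<le> G * (LINT x|lborel. \<bar>w s x - w t x\<bar>)" by simp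
      qed
      show "((\<lambda>s. G * (LINT x|lborel. \<bar>w s x - w t x\<bar>)) \<longlongrightarrow> 0) (at t within {0..})"
        using tendsto_mult_right_zero[OF D_lim] t by simp
    qed
    then show "(F g \<longlongrightarrow> F g t) (at t within {0..})" by (simp add: LIM_zero_iff)
  qed
  have F_deriv: "(F g has_real_derivative F (T g) t - F g t) (at t)" if g: "testfn G g" and t: "t > 0" for g G t
  proof -
    \<comment> \<open>The equation holds only off the hole; the cutoff is harmless because test
      functions vanish in the hole.\<close>
    let ?e = "\<lambda>h x. indicator (- H) x * ((w (t + h) x - w t x) / h - (conv J (w t) x - w t x))"
    have ev: "eventually (\<lambda>h. t + h \<ge> 0) (at 0)"
      unfolding eventually_at using t by (intro exI[of _ t]) (auto simp: dist_real_def)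
    have iw: "integrable lborel (conv J (w t))"
      using conv_pairing_integrable[OF int, of t "\<lambda>_. 1" 1] t by simp
    have ie: "integrable lborel (?e h)" if "t + h \<ge> 0" for h
    proof -
      have "integrable lborel (\<lambda>x. (w (t + h) x - w t x) / h - (conv J (w t) x - w t x))"
        using int[OF that] int[of t] iw t by simp
      from integrable_mult_bounded[OF this, of "indicator (- H)" 1]
      show ?thesis by (simp add: mult.commute indicator_le_1)
    qed
    have lim: "((\<lambda>h. LINT x|lborel. \<bar>?e h x\<bar>) \<longlongrightarrow> 0) (at 0)"
    proof (rule tendsto_integral_abs)
      have "ennreal \<bar>?e h x\<bar> = ennreal \<bar>(w (t + h) x - w t x) / h - (conv J (w t) x - w t x)\<bar> * indicator (- H) x" for h x
        by (auto simp: indicator_def)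
      then show "((\<lambda>h. \<integral>\<^sup>+x. ennreal \<bar>?e h x\<bar> \<partial>lborel) \<longlongrightarrow> 0) (at 0)" using deriv[OF t] by simp
      show "eventually (\<lambda>h. ?e h \<in> borel_measurable borel) (at 0)"
        using ev by eventually_elim (use ie in auto)
    qed
    have "((\<lambda>h. (F g (t + h) - F g t) / h - (F (T g) t - F g t)) \<longlongrightarrow> 0) (at 0)"
    proof (rule Lim_null_comparison)
      show "((\<lambda>h. G * (LINT x|lborel. \<bar>?e h x\<bar>)) \<longlongrightarrow> 0) (at 0)"
        using tendsto_mult_right_zero[OF lim] .
      show "eventually (\<lambda>h. norm ((F g (t + h) - F g t) / h - (F (T g) t - F g t)) \<le> G * (LINT x|lborel. \<bar>?e h x\<bar>)) (at 0)"
        using ev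
      proof eventually_elim
        case (elim h)
        note I = integrable_mult_bounded[OF _ testfnD(1,2)[OF g]]
        have cT: "F (T g) t = (LINT x|lborel. conv J (w t) x * g x)"
          unfolding F_def using pairing_conv_T[OF int zero g, of t] t by simp
        have "(F g (t + h) - F g t) / h - (F (T g) t - F g t) =
          (LINT x|lborel. (w (t + h) x * g x - w t x * g x) / h - (conv J (w t) x * g x - w t x * g x))"
          unfolding cT unfolding F_def using I[OF int[OF elim]] I[OF int[of t]] I[OF iw] t by simp
        also have "\<dots> = (LINT x|lborel. ?e h x * g x)"
          by (intro Bochner_Integration.integral_cong refl)
             (use testfnD(3)[OF g] in \<open>auto simp: indicator_def left_diff_distrib diff_divide_distrib\<close>)
        finally have "(F g (t + h) - F g t) / h - (F (T g) t - F g t) = (LINT x|lborel. ?e h x * g x)" .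
        then show ?case
          using abs_integral_mult_bounded_le[OF ie[OF elim] testfnD(1,2)[OF g]] by simp
      qed
    qed
    then show ?thesis unfolding DERIV_def by (simp add: LIM_zero_iff)
  qed
  define c where "c k g = (LINT x|lborel. v k x * g x)" for k g
  obtain C0 where C0: "\<And>t. t \<in> {0..t0} \<Longrightarrow> \<bar>N t\<bar> \<le> C0"
  proof -
    have "bounded (N ` {0..t0})"
      using N_cont by (intro compact_imp_bounded compact_continuous_image) (auto intro: continuous_on_subset)
    then show ?thesis using that unfolding bounded_iff by (metis imageI real_norm_def)
  qed
  define C where "C = exp t0 * C0"
  have C00: "C0 \<ge> 0" using C0[of 0] t0 by simp
  \<comment> \<open>The factor \<open>exp t\<close> cancels the loss term, so differentiating
    replaces \<open>g\<close> by \<open>T g\<close> and lowers the order by one; for this the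
    induction generalises over \<open>g\<close>. The base case is the a priori bound
    \<open>|exp t * F g t| \<le> C * G\<close> on \<open>{0..t0}\<close>.\<close>
  have taylor: "\<bar>exp t * F g t - (\<Sum>k<n. t ^ k / fact k * c k g)\<bar> \<le> C * G * (t ^ n / fact n)"
    if "testfn G g" "t \<in> {0..t0}" for n g G t
    using that
  proof (induction n arbitrary: g t)
    case 0
    have "\<bar>exp t * F g t\<bar> = exp t * \<bar>F g t\<bar>" by (simp add: abs_mult)
    also have "\<dots> \<le> exp t0 * (G * C0)"
    proof (rule mult_mono)
      have "\<bar>F g t\<bar> \<le> G * N t" using F_le 0 by simp
      also have "\<dots> \<le> G * C0" using C0[OF 0(2)] testfnD(4)[OF 0(1)] by (intro mult_left_mono) auto
      finally show "\<bar>F g t\<bar> \<le> G * C0" .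
    qed (use 0 in auto)
    finally show ?case by (simp add: C_def mult_ac)
  next
    case (Suc n)
    let ?D = "\<lambda>s. exp s * F g s - (\<Sum>k<Suc n. s ^ k / fact k * c k g)"
    let ?D' = "\<lambda>s. exp s * F (T g) s - (\<Sum>k<n. s ^ k / fact k * c k (T g))"
    let ?P = "\<lambda>s. C * G * (s ^ Suc n / fact (Suc n))"
    have g: "testfn G g" by fact
    have D0: "?D 0 = 0"
    proof -
      note [measurable] = m[of 0, simplified] testfnD(1)[OF g]
      have "F g 0 = c 0 g"
        unfolding F_def c_def
      proof (rule integral_cong_AE)
        show "AE x in lborel. w 0 x * g x = v 0 x * g x" using init by eventually_elim simp
      qed measurable
      then show ?thesis unfolding sum.lessThan_Suc_shift by simp
    qed
    have dD: "(?D has_real_derivative ?D' s) (at s)" if s: "s > 0" for s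
    proof -
      have c': "c (Suc k) g = c k (T g)" for k unfolding c_def by (rule v_pairing_Suc[OF g])
      have "((\<lambda>s. exp s * F g s) has_real_derivative (exp s * F g s + (F (T g) s - F g s) * exp s)) (at s)"
        by (rule DERIV_mult[OF DERIV_exp F_deriv[OF g s]])
      then have 1: "((\<lambda>s. exp s * F g s) has_real_derivative (exp s * F (T g) s)) (at s)" by (simp add: algebra_simps)
      have "((\<lambda>s. c 0 g + (\<Sum>k<n. s ^ Suc k / fact (Suc k) * c (Suc k) g)) has_real_derivative
          (0 + (\<Sum>k<n. s ^ k / fact k * c (Suc k) g))) (at s)"
      proof (intro DERIV_add DERIV_const DERIV_sum DERIV_cmult_right)
        fix k
        have "((\<lambda>s. s ^ Suc k / fact (Suc k)) has_real_derivative (real (Suc k) * s ^ k) / fact (Suc k)) (at s)"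
          using DERIV_cdivide[OF DERIV_pow[of "Suc k" s UNIV], of "fact (Suc k)"] by (simp only: diff_Suc_Suc diff_zero)
        moreover have "(real (Suc k) * s ^ k) / fact (Suc k) = s ^ k / fact k" by (simp add: fact_Suc del: of_nat_Suc)
        ultimately show "((\<lambda>s. s ^ Suc k / fact (Suc k)) has_real_derivative s ^ k / fact k) (at s)" by (simp only:)
      qed
      then have 2: "((\<lambda>s. \<Sum>k<Suc n. s ^ k / fact k * c k g) has_real_derivative (\<Sum>k<n. s ^ k / fact k * c k (T g))) (at s)"
        unfolding sum.lessThan_Suc_shift c' by simp
      show ?thesis by (rule DERIV_diff[OF 1 2])
    qed
    have dP: "(?P has_real_derivative C * G * (s ^ n / fact n)) (at s)" for s
    proof -
      have "((\<lambda>s. s ^ Suc n / fact (Suc n)) has_real_derivative (real (Suc n) * s ^ n) / fact (Suc n)) (at s)"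
        using DERIV_cdivide[OF DERIV_pow[of "Suc n" s UNIV], of "fact (Suc n)"] by (simp only: diff_Suc_Suc diff_zero)
      moreover have "(real (Suc n) * s ^ n) / fact (Suc n) = s ^ n / fact n" by (simp add: fact_Suc del: of_nat_Suc)
      ultimately show ?thesis by (intro DERIV_cmult) (simp only:)
    qed
    have cD: "continuous_on {0..t} ?D"
      by (intro continuous_intros continuous_on_subset[OF F_cont[OF g]]) auto
    have cP: "continuous_on {0..t} ?P" by (intro continuous_intros) auto
    have IH: "\<bar>?D' s\<bar> \<le> C * G * (s ^ n / fact n)" if "0 < s" "s < t" for s
      using Suc.IH[OF testfn_T[OF g], of s] Suc.prems that by simp
    have "0 \<le> t" using Suc.prems by simp
    \<comment> \<open>The remainder is differentiable only for positive times and merely continuous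
      at 0, so it is compared with \<open>?P\<close> through monotonicity on the open
      interval.\<close>
    have "?P 0 - ?D 0 \<le> ?P t - ?D t"
    proof (rule DERIV_nonneg_imp_increasing_open[OF \<open>0 \<le> t\<close>])
      fix s assume s: "0 < s" "s < t"
      show "\<exists>y. ((\<lambda>s. ?P s - ?D s) has_real_derivative y) (at s) \<and> 0 \<le> y"
        using DERIV_diff[OF dP dD[OF s(1)]] IH[OF s] by (intro exI conjI) (assumption, linarith)
    qed (intro continuous_on_diff cP cD)
    moreover have "?P 0 + ?D 0 \<le> ?P t + ?D t"
    proof (rule DERIV_nonneg_imp_increasing_open[OF \<open>0 \<le> t\<close>])
      fix s assume s: "0 < s" "s < t"
      show "\<exists>y. ((\<lambda>s. ?P s + ?D s) has_real_derivative y) (at s) \<and> 0 \<le> y"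
        using DERIV_add[OF dP dD[OF s(1)]] IH[OF s] by (intro exI conjI) (assumption, linarith)
    qed (intro continuous_on_add cP cD)
    moreover have "?P 0 = 0" by simp
    ultimately show ?case using D0 by linarith
  qed
  have F_eq: "F g t0 = (LINT x|lborel. U t0 x * g x)" if g: "testfn G g" for g G
  proof -
    have "(\<lambda>n. exp t0 * F g t0 - (\<Sum>k<n. t0 ^ k / fact k * c k g)) \<longlonglongrightarrow> 0"
    proof (rule Lim_null_comparison)
      show "eventually (\<lambda>n. norm (exp t0 * F g t0 - (\<Sum>k<n. t0 ^ k / fact k * c k g)) \<le> C * G * (t0 ^ n / fact n)) sequentially"
        using taylor[OF g, of t0] t0 by (intro always_eventually) simp
      have "(\<lambda>n. t0 ^ n / fact n) \<longlonglongrightarrow> 0"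
        using summable_LIMSEQ_zero[OF summable_exp[of t0]] by (simp add: field_simps)
      then show "(\<lambda>n. C * G * (t0 ^ n / fact n)) \<longlonglongrightarrow> 0" by (rule tendsto_mult_right_zero)
    qed
    then have "(\<lambda>n. exp t0 * F g t0 - (exp t0 * F g t0 - (\<Sum>k<n. t0 ^ k / fact k * c k g))) \<longlonglongrightarrow> exp t0 * F g t0 - 0"
      by (intro tendsto_diff tendsto_const)
    then have "(\<lambda>k. t0 ^ k / fact k * c k g) sums (exp t0 * F g t0)" by (simp add: sums_def)
    from sums_mult[OF this, of "exp (- t0)"]
    have "(\<lambda>k. poisson t0 k * c k g) sums (exp (- t0) * (exp t0 * F g t0))" by (simp add: poisson_def mult_ac)
    moreover have "exp (- t0) * (exp t0 * F g t0) = F g t0" by (simp add: mult.assoc[symmetric] flip: exp_add)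
    moreover have "(\<lambda>k. poisson t0 k * c k g) sums (LINT x|lborel. U t0 x * g x)"
      unfolding c_def using t0 by (intro U_pairing(2)[where G = G] testfnD[OF g]) simp
    ultimately show ?thesis using sums_unique2 by simp
  qed
  note [measurable] = m[of t0]
  have mU[measurable]: "U t0 \<in> borel_measurable borel" using U_integrable[of t0] t0 by auto
  \<comment> \<open>Testing with the sign of the difference turns equality of pairings into a
    vanishing L1 norm off the hole.\<close>
  define g where "g x = indicator (- H) x * sgn (w t0 x - U t0 x)" for x
  have g: "testfn 1 g"
    unfolding testfn_def g_def using m[of t0] t0 by (auto simp: indicator_def sgn_if)
  have "(LINT x|lborel. (w t0 x - U t0 x) * g x) = 0"
    using F_eq[OF g] integrable_mult_bounded[OF int testfnD(1,2)[OF g], of t0] integrable_mult_bounded[OF U_integrable testfnD(1,2)[OF g], of t0] t0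
    by (simp add: left_diff_distrib F_def)
  moreover have ge: "(w t0 x - U t0 x) * g x = indicator (- H) x * \<bar>w t0 x - U t0 x\<bar>" for x
    by (auto simp: g_def sgn_if indicator_def)
  ultimately have "(LINT x|lborel. indicator (- H) x * \<bar>w t0 x - U t0 x\<bar>) = 0" by simp
  moreover have "integrable lborel (\<lambda>x. indicator (- H) x * \<bar>w t0 x - U t0 x\<bar>)"
    unfolding ge[symmetric] using int[of t0] U_integrable[of t0] t0 by (intro integrable_mult_bounded[OF _ testfnD(1,2)[OF g]]) simp
  ultimately have "AE x in lborel. indicator (- H) x * \<bar>w t0 x - U t0 x\<bar> = 0"
    by (subst (asm) integral_nonneg_eq_0_iff_AE) auto
  then show ?thesis using zero[OF t0]
    by eventually_elim (auto simp: indicator_def U_H split: if_splits)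
qed

end

subsection \<open>The theorem\<close>

lemma C2_continuous: "C2 f \<Longrightarrow> continuous_on UNIV f"
  unfolding C2_def by (meson has_derivative_continuous continuous_at_imp_continuous_on)

lemma integral_lebesgue_cong_lborel:
  fixes f g :: "'a::euclidean_space \<Rightarrow> real"
  assumes "f \<in> borel_measurable lebesgue" and "g \<in> borel_measurable borel" and "AE x in lborel. f x = g x"
  shows "(LINT x|lebesgue. f x) = (LINT x|lborel. g x)"
    and "integrable lebesgue f \<longleftrightarrow> integrable lborel g"
proof -
  have m: "g \<in> borel_measurable lborel" using assms(2) by simp
  then have m': "g \<in> borel_measurable lebesgue" by (rule measurable_completion)
  have ae: "AE x in lebesgue. f x = g x" using assms(3) by (rule AE_completion)
  have "(LINT x|lebesgue. f x) = (LINT x|lebesgue. g x)" by (rule integral_cong_AE[OF assms(1) m' ae])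
  then show "(LINT x|lebesgue. f x) = (LINT x|lborel. g x)" using integral_completion[OF m] by simp
  have "integrable lebesgue f \<longleftrightarrow> integrable lebesgue g" by (rule integrable_cong_AE[OF assms(1) m' ae])
  then show "integrable lebesgue f \<longleftrightarrow> integrable lborel g" using integrable_completion[OF m] by simp
qed

text \<open>A change on a null set is invisible under the integral, so the convolutions agree at
  every point although the functions agree only almost everywhere.\<close>

lemma convolution2_eq_conv:
  assumes J: "J \<in> borel_measurable borel" and f: "f \<in> borel_measurable lebesgue"
    and g: "g \<in> borel_measurable borel" and ae: "AE x in lborel. f x = g x"
  shows "convolution2 J f x = conv J g x"
  unfolding convolution2_def conv_def
proof (rule integral_lebesgue_cong_lborel(1))
  note [measurable] = J g
  have "(\<lambda>y. J (x - y)) \<in> borel_measurable lebesgue" by (rule measurable_completion) measurable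
  then show "(\<lambda>y. J (x - y) * f y) \<in> borel_measurable lebesgue" using f by measurable
  show "(\<lambda>y. J (x - y) * g y) \<in> borel_measurable borel" by measurable
  show "AE y in lborel. J (x - y) * f y = J (x - y) * g y" using ae by eventually_elim simp
qed

text \<open>Nonnegativity is not automatic, since an essential supremum over a null set is the
  bottom value. The region is not null: its complement is a ball of finite measure in a plane of
  infinite measure.\<close>

lemma esssup_on_bounds:
  fixes f :: "plane \<Rightarrow> real"
  assumes f: "f \<in> borel_measurable lebesgue"
  shows esssup_on_le: "(AE x in lborel. norm x \<ge> r \<longrightarrow> f x \<le> c) \<Longrightarrow> esssup_on {x. norm x \<ge> r} f \<le> ereal c"
    and esssup_on_nonneg: "(\<And>x. 0 \<le> f x) \<Longrightarrow> 0 \<le> esssup_on {x. norm x \<ge> r} f"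
proof -
  let ?A = "{x::plane. norm x \<ge> r}"
  have Ab: "?A \<in> sets borel" by measurable
  then have A: "?A \<in> sets lebesgue" by (simp add: sets_completionI_sets)
  have m: "(\<lambda>x. ereal (f x)) \<in> borel_measurable (restrict_space lebesgue ?A)"
    using f by (intro measurable_restrict_space1) measurable
  show "esssup_on ?A f \<le> ereal c" if "AE x in lborel. norm x \<ge> r \<longrightarrow> f x \<le> c"
    unfolding esssup_on_def
  proof (rule esssup_I[OF m])
    show "AE x in restrict_space lebesgue ?A. ereal (f x) \<le> ereal c"
      using AE_completion[OF that] A by (simp add: AE_restrict_space_iff)
  qed
  show "0 \<le> esssup_on ?A f" if "\<And>x. 0 \<le> f x"
  proof -
    have "emeasure lborel ?A \<noteq> 0"
    proof
      assume 0: "emeasure lborel ?A = 0"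
      have "UNIV = ?A \<union> ball 0 r" by auto
      then have "emeasure lborel (UNIV :: plane set) \<le> emeasure lborel ?A + emeasure lborel (ball (0::plane) r)"
        using emeasure_subadditive[of ?A lborel "ball 0 r"] Ab by simp
      also have "\<dots> < \<infinity>" using 0 emeasure_lborel_ball_finite[of "0::plane" r] by simp
      finally show False by simp
    qed
    then have "emeasure (restrict_space lebesgue ?A) (space (restrict_space lebesgue ?A)) \<noteq> 0"
      using A Ab by (simp add: emeasure_restrict_space space_restrict_space)
    then have "0 = esssup (restrict_space lebesgue ?A) (\<lambda>x. 0 :: ereal)" by (simp add: esssup_const)
    also have "\<dots> \<le> esssup_on ?A f"
      unfolding esssup_on_def using that by (intro esssup_mono) auto
    finally show ?thesis .
  qed
qed

theorem theorem1p1: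
  fixes H :: "plane set" and J u0 \<phi> :: "plane \<Rightarrow> real"
    and u :: "real \<Rightarrow> plane \<Rightarrow> real" and R d :: real
  assumes "H \<noteq> {}" and "bounded H" and "open H"
    and "2 < R" and "ball 0 2 \<subseteq> H" and "H \<subseteq> ball 0 R"
    and "C2 J" and "radially_symmetric J"
    and "0 < d"
    and "\<And>x. norm x < d \<Longrightarrow> J x > 0"
    and "\<And>x. norm x \<ge> d \<Longrightarrow> J x = 0"
    and "(LINT x|lebesgue. J x) = 1"
    and "AE x in lebesgue. 0 \<le> u0 x"
    and "AE x in lebesgue. x \<in> H \<longrightarrow> u0 x = 0"
    and "Linfty_on UNIV u0"
    and "integrable lebesgue (\<lambda>x. u0 x * ln (norm x))"
    and "integrable lebesgue (\<lambda>x. u0 x * (norm x)\<^sup>2)"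
    and "exterior_solution J H u0 u"
    and "log_stationary_solution J H \<phi>"
  defines "M \<equiv> (LINT x|lebesgue. u0 x * \<phi> x)"
  shows "\<forall>\<delta>>0.
    ((\<lambda>t. ereal (t * ln t) *
          esssup_on {x. norm x \<ge> \<delta> * sqrt t}
            (\<lambda>x. \<bar>u t x - 2 * M * (heat_kernel2 (diffusivity J) x t / ln t)\<bar>))
      \<longlongrightarrow> 0) at_top"
proof -
  note H_open = \<open>open H\<close> and H_ball = \<open>ball 0 2 \<subseteq> H\<close> and H_bounded = \<open>H \<subseteq> ball 0 R\<close>
    and sol = \<open>exterior_solution J H u0 u\<close> and stat = \<open>log_stationary_solution J H \<phi>\<close>
  have Hb[measurable]: "H \<in> sets borel" using H_open by simp
  have J_cont: "continuous_on UNIV J" using \<open>C2 J\<close> by (rule C2_continuous)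
  then have J_meas[measurable]: "J \<in> borel_measurable borel" by (rule borel_measurable_continuous_onI)
  have "(LINT x|lborel. J x) = 1"
    using \<open>(LINT x|lebesgue. J x) = 1\<close> by (subst (asm) integral_completion) auto
  then interpret radial_kernel J d
    using assms(8-11) J_cont by unfold_locales auto
  have norm2: "norm x \<ge> 2" if "x \<notin> H" for x
    using H_ball that by (auto simp: subset_iff) (meson not_le)

  \<comment> \<open>Borel representative of the initial datum\<close>
  obtain C where C: "AE x in lebesgue. \<bar>u0 x\<bar> \<le> C" and u0_meas: "u0 \<in> borel_measurable lebesgue"
    using \<open>Linfty_on UNIV u0\<close> by (auto simp: Linfty_on_def borel_measurable_restrict_space_iff)
  obtain u0' where u0'[measurable]: "u0' \<in> borel_measurable borel" and u0'_eq: "AE x in lborel. u0 x = u0' x"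
    using completion_ex_borel_measurable_real[OF u0_meas] by auto
  \<comment> \<open>Wherever the representative violates the sign, the bound or the vanishing in
    \<open>H\<close>, it is set to 0; this happens on a null set and makes these properties
    pointwise.\<close>
  define v0 where "v0 x = (if x \<notin> H \<and> 0 \<le> u0' x \<and> u0' x \<le> C then u0' x else 0)" for x
  have v0_meas[measurable]: "v0 \<in> borel_measurable borel" unfolding v0_def[abs_def] by measurable
  have v0_eq: "AE x in lborel. u0 x = v0 x"
    using u0'_eq C[unfolded AE_completion_iff] assms(13,14)[unfolded AE_completion_iff]
    by eventually_elim (auto simp: v0_def)
  have "tame v0"
    unfolding tame_def
  proof (intro conjI)
    show "\<exists>C. \<forall>x. v0 x \<le> C" by (rule exI[of _ "\<bar>C\<bar>"]) (auto simp: v0_def)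
    have "integrable lborel (\<lambda>x. v0 x * (norm x)\<^sup>2)"
      using \<open>integrable lebesgue (\<lambda>x. u0 x * (norm x)\<^sup>2)\<close> v0_eq
      by (subst integral_lebesgue_cong_lborel(2)[symmetric, of "\<lambda>x. u0 x * (norm x)\<^sup>2"])
         (auto elim!: eventually_mono)
    \<comment> \<open>Off the hole \<open>norm x \<ge> 2\<close>, so the second moment alone
      controls the weight \<open>1 + |x|^2\<close>.\<close>
    then have "integrable lborel (\<lambda>x. 2 * (v0 x * (norm x)\<^sup>2))" by simp
    then show "integrable lborel (\<lambda>x. v0 x * (1 + (norm x)\<^sup>2))"
    proof (rule Bochner_Integration.integrable_bound)
      show "AE x in lborel. norm (v0 x * (1 + (norm x)\<^sup>2)) \<le> norm (2 * (v0 x * (norm x)\<^sup>2))"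
      proof (rule AE_I2)
        fix x
        show "norm (v0 x * (1 + (norm x)\<^sup>2)) \<le> norm (2 * (v0 x * (norm x)\<^sup>2))"
        proof (cases "x \<in> H")
          case False
          have "1 \<le> (norm x)\<^sup>2" using norm2[OF False] by (simp add: one_le_power)
          then have "\<bar>v0 x\<bar> * (1 + (norm x)\<^sup>2) \<le> \<bar>v0 x\<bar> * (2 * (norm x)\<^sup>2)" by (intro mult_left_mono) auto
          then show ?thesis by (simp add: abs_mult)
        qed (simp add: v0_def)
      qed
    qed measurable
  qed (auto simp: v0_def)

  \<comment> \<open>Borel representative of the stationary solution\<close>
  have \<phi>_meas: "\<phi> \<in> borel_measurable lebesgue" and \<phi>_eq: "\<And>x. x \<notin> H \<Longrightarrow> nonlocal_op J \<phi> x = 0"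
    and \<phi>_H: "\<And>x. x \<in> H \<Longrightarrow> \<phi> x = 0" and \<phi>_log: "Linfty_on (- H) (\<lambda>x. \<phi> x - ln (norm x))"
    using stat by (auto simp: log_stationary_solution_def)
  obtain B where B: "AE x in lebesgue. x \<in> - H \<longrightarrow> \<bar>\<phi> x - ln (norm x)\<bar> \<le> B"
    using \<phi>_log by (auto simp: Linfty_on_def)
  obtain \<phi>' where \<phi>'[measurable]: "\<phi>' \<in> borel_measurable borel" and \<phi>'_eq: "AE x in lborel. \<phi> x = \<phi>' x"
    using completion_ex_borel_measurable_real[OF \<phi>_meas] by auto
  \<comment> \<open>Where the representative breaks the logarithmic bound, the logarithm itself is
    substituted; the bound then holds at every point off the hole.\<close>
  define \<psi> where "\<psi> x = (if x \<in> H then 0 else if \<bar>\<phi>' x - ln (norm x)\<bar> \<le> B then \<phi>' x else ln (norm x))" for x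
  have \<psi>_meas[measurable]: "\<psi> \<in> borel_measurable borel" unfolding \<psi>_def[abs_def] by measurable
  have \<psi>_eq: "AE x in lborel. \<phi> x = \<psi> x"
    using \<phi>'_eq B[unfolded AE_completion_iff] by eventually_elim (auto simp: \<psi>_def \<phi>_H)
  interpret walk: exterior_walk J d H R "\<bar>B\<bar>" \<psi> v0
  proof unfold_locales
    \<comment> \<open>The convolutions of \<open>\<phi>\<close> and \<open>\<psi>\<close> coincide
      everywhere; exceptions arise only where the values \<open>\<phi> x\<close> and
      \<open>\<psi> x\<close> differ.\<close>
    show "AE x in lborel. x \<notin> H \<longrightarrow> conv J \<psi> x = \<psi> x"
      using \<psi>_eq
    proof eventually_elim
      case (elim x)
      show ?case
        using \<phi>_eq[of x] convolution2_eq_conv[OF J_meas \<phi>_meas \<psi>_meas \<psi>_eq, of x] elim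
        by (auto simp: nonlocal_op_def)
    qed
  qed (use H_open H_ball H_bounded \<open>tame v0\<close> in \<open>auto simp: \<psi>_def v0_def\<close>)
  have Ms_eq: "walk.Ms = M"
  proof -
    have "M = (LINT x|lborel. v0 x * \<psi> x)"
      unfolding M_def
    proof (rule integral_lebesgue_cong_lborel(1))
      show "(\<lambda>x. u0 x * \<phi> x) \<in> borel_measurable lebesgue" using u0_meas \<phi>_meas by measurable
      show "AE x in lborel. u0 x * \<phi> x = v0 x * \<psi> x" using v0_eq \<psi>_eq by eventually_elim simp
    qed measurable
    then show ?thesis by (simp add: walk.Ms_def)
  qed

  \<comment> \<open>Identification of the solution with the Poisson average\<close>
  have u_int: "\<And>t. t \<ge> 0 \<Longrightarrow> integrable lebesgue (u t)"
    and u_cont: "\<And>t. t \<ge> 0 \<Longrightarrow> ((\<lambda>s. L1_seminorm_on UNIV (\<lambda>x. u s x - u t x)) \<longlongrightarrow> 0) (at t within {0..})"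
    and u_deriv: "\<And>t. t > 0 \<Longrightarrow> ((\<lambda>h. L1_seminorm_on (- H)
                 (\<lambda>x. (u (t + h) x - u t x) / h - nonlocal_op J (u t) x)) \<longlongrightarrow> 0) (at 0)"
    and u_H: "\<And>t. t > 0 \<Longrightarrow> AE x in lborel. x \<in> H \<longrightarrow> u t x = 0"
    and u_0: "AE x in lborel. u 0 x = u0 x"
    using sol by (auto simp: exterior_solution_def continuous_into_L1_def AE_completion_iff)
  \<comment> \<open>Representatives are chosen for each time separately, with no regularity in
    \<open>t\<close>; this suffices because all hypotheses of \<open>solution_unique\<close> are L1
    or almost-everywhere statements at fixed times.\<close>
  have "\<exists>w. \<forall>t\<ge>0. w t \<in> borel_measurable borel \<and> (AE x in lborel. u t x = w t x)"
  proof -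
    have "\<exists>w. w \<in> borel_measurable borel \<and> (AE x in lborel. u t x = w x)" if "t \<ge> 0" for t
      using completion_ex_borel_measurable_real[OF borel_measurable_integrable[OF u_int[OF that]]] by auto
    then show ?thesis by metis
  qed
  then obtain w where w_meas: "\<And>t. t \<ge> 0 \<Longrightarrow> w t \<in> borel_measurable borel"
    and w_eq: "\<And>t. t \<ge> 0 \<Longrightarrow> AE x in lborel. u t x = w t x" by blast
  have u_meas: "t \<ge> 0 \<Longrightarrow> u t \<in> borel_measurable lebesgue" for t
    using u_int by (rule borel_measurable_integrable)
  have u_U: "AE x in lborel. u t x = walk.U t x" if t: "t > 0" for t
  proof -
    have "AE x in lborel. w t x = walk.U t x"
    proof (rule walk.solution_unique)
      show "integrable lborel (w s)" if "s \<ge> 0" for s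
        using integral_lebesgue_cong_lborel(2)[OF u_meas w_meas w_eq] u_int that by blast
      show "((\<lambda>r. \<integral>\<^sup>+x. ennreal \<bar>w r x - w s x\<bar> \<partial>lborel) \<longlongrightarrow> 0) (at s within {0..})" if s: "s \<ge> 0" for s
      proof (rule Lim_transform_eventually[OF u_cont[OF s]])
        have "L1_seminorm_on UNIV (\<lambda>x. u r x - u s x) = (\<integral>\<^sup>+x. ennreal \<bar>w r x - w s x\<bar> \<partial>lborel)" if "r \<ge> 0" for r
        proof -
          have "AE x in lborel. ennreal \<bar>u r x - u s x\<bar> * indicator UNIV x = ennreal \<bar>w r x - w s x\<bar>"
            using w_eq[OF that] w_eq[OF s] by eventually_elim simp
          then show ?thesis
            unfolding L1_seminorm_on_def nn_integral_completion by (rule nn_integral_cong_AE)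
        qed
        then show "eventually (\<lambda>r. L1_seminorm_on UNIV (\<lambda>x. u r x - u s x) = (\<integral>\<^sup>+x. ennreal \<bar>w r x - w s x\<bar> \<partial>lborel)) (at s within {0..})"
          by (auto simp: eventually_at_filter intro!: always_eventually)
      qed
      show "((\<lambda>h. \<integral>\<^sup>+x\<in>- H. ennreal \<bar>(w (s + h) x - w s x) / h - (conv J (w s) x - w s x)\<bar> \<partial>lborel) \<longlongrightarrow> 0) (at 0)"
        if s: "s > 0" for s
      proof (rule Lim_transform_eventually[OF u_deriv[OF s]])
        have ev: "eventually (\<lambda>h. s + h \<ge> 0) (at 0)"
          unfolding eventually_at using s by (intro exI[of _ s]) (auto simp: dist_real_def)
        have s0: "s \<ge> 0" using s by simp
        have cv: "convolution2 J (u s) x = conv J (w s) x" for x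
          by (rule convolution2_eq_conv[OF J_meas u_meas[OF s0] w_meas[OF s0] w_eq[OF s0]])
        show "eventually (\<lambda>h. L1_seminorm_on (- H) (\<lambda>x. (u (s + h) x - u s x) / h - nonlocal_op J (u s) x) =
            (\<integral>\<^sup>+x\<in>- H. ennreal \<bar>(w (s + h) x - w s x) / h - (conv J (w s) x - w s x)\<bar> \<partial>lborel)) (at 0)"
          using ev
        proof eventually_elim
          case (elim h)
          have "AE x in lborel. ennreal \<bar>(u (s + h) x - u s x) / h - (conv J (w s) x - u s x)\<bar> * indicator (- H) x =
              ennreal \<bar>(w (s + h) x - w s x) / h - (conv J (w s) x - w s x)\<bar> * indicator (- H) x"
            using w_eq[OF elim] w_eq[OF s0] by eventually_elim simp
          then show ?case
            unfolding L1_seminorm_on_def nn_integral_completion nonlocal_op_def cv by (rule nn_integral_cong_AE)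
        qed
      qed
      show "AE x in lborel. x \<in> H \<longrightarrow> w s x = 0" if s: "s > 0" for s
        using u_H[OF s] w_eq[OF less_imp_le[OF s]] by eventually_elim simp
      show "AE x in lborel. w 0 x = v0 x"
        using u_0 w_eq[of 0, simplified] v0_eq by eventually_elim simp
    qed (rule t)
    then show ?thesis using w_eq[OF less_imp_le[OF t]] by eventually_elim simp
  qed

  \<comment> \<open>Passage to the essential supremum\<close>
  show ?thesis
  proof (intro allI impI)
    fix \<delta> :: real assume \<delta>: "\<delta> > 0"
    let ?f = "\<lambda>t x. \<bar>u t x - 2 * M * (heat_kernel2 (diffusivity J) x t / ln t)\<bar>"
    have f_meas: "?f t \<in> borel_measurable lebesgue" if "t > 0" for t
    proof -
      have "(\<lambda>x. 2 * M * (heat_kernel2 (diffusivity J) x t / ln t)) \<in> borel_measurable lebesgue"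
        unfolding heat_kernel2_def by (rule measurable_completion) measurable
      moreover have "u t \<in> borel_measurable lebesgue" using that by (intro u_meas) simp
      ultimately show ?thesis by (intro borel_measurable_abs borel_measurable_diff)
    qed
    have ev: "eventually (\<lambda>t::real. t > 1) at_top" by (rule eventually_gt_at_top)
    show "((\<lambda>t. ereal (t * ln t) * esssup_on {x. norm x \<ge> \<delta> * sqrt t} (?f t)) \<longlongrightarrow> 0) at_top"
    proof (rule order_tendstoI)
      fix a :: ereal assume a: "a < 0"
      show "eventually (\<lambda>t. a < ereal (t * ln t) * esssup_on {x. norm x \<ge> \<delta> * sqrt t} (?f t)) at_top"
        using ev
      proof eventually_elim
        case (elim t)
        have "0 \<le> esssup_on {x. norm x \<ge> \<delta> * sqrt t} (?f t)"
          using elim by (intro esssup_on_nonneg f_meas) auto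
        then have "0 \<le> ereal (t * ln t) * esssup_on {x. norm x \<ge> \<delta> * sqrt t} (?f t)"
          using elim by (intro ereal_0_le_mult) auto
        then show ?case using a by (rule less_le_trans[rotated])
      qed
    next
      fix a :: ereal assume "0 < a"
      then obtain e where e: "0 < ereal e" "ereal e < a" using ereal_dense2[of 0 a] by auto
      then have "e > 0" by simp
      from walk.U_far_field[OF \<delta> this] ev
      show "eventually (\<lambda>t. ereal (t * ln t) * esssup_on {x. norm x \<ge> \<delta> * sqrt t} (?f t) < a) at_top"
      proof eventually_elim
        case (elim t)
        have t: "t * ln t > 0" using elim(2) by simp
        have "esssup_on {x. norm x \<ge> \<delta> * sqrt t} (?f t) \<le> ereal (e / (t * ln t))"
        proof (rule esssup_on_le[OF f_meas])
          show "AE x in lborel. norm x \<ge> \<delta> * sqrt t \<longrightarrow> ?f t x \<le> e / (t * ln t)"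
            using u_U[of t] elim(2) elim(1)
            by (auto simp: Ms_eq q_def elim!: eventually_mono)
        qed (use elim(2) in simp)
        then have "ereal (t * ln t) * esssup_on {x. norm x \<ge> \<delta> * sqrt t} (?f t) \<le> ereal (t * ln t) * ereal (e / (t * ln t))"
          using t by (intro ereal_mult_left_mono) auto
        also have "\<dots> = ereal e" using elim(2) by simp
        finally show ?case using e(2) by (rule le_less_trans)
      qed
    qed
  qed
qed

end
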